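(* Let $\Sigma$ be a simplicial fan with rays $\rho_1,\dots,\rho_r$, $X=X(\Sigma)$, and let $\Psi$ be a choice of complements for $\Sigma$. Let $\mathbb{Q}[Y_1,\dots,Y_r]$ act on $Z_*(X)_{\mathbb{Q}}=\bigoplus_{k=0}^n Z_k(X)_{\mathbb{Q}}$ by letting $Y_i$ act as $D_i\cdot{}$. Then $Z_*(X)_{\mathbb{Q}}$ is a $\mathbb{Q}[Y_1,\dots,Y_r]$-module which is generated by $[X]$. Consequently $Z_*(X)_{\mathbb{Q}}\cong\mathbb{Q}[Y_1,\dots,Y_r]/I$ for some ideal $I$, and this puts a commutative ring structure on $Z_*(X)_{\mathbb{Q}}$.
   Context: Setting. $N$ is a free abelian group of rank $n$, $M=\operatorname{Hom}(N,\mathbb{Z})$, $N_{\mathbb{Q}}=\mathbb{Q}\otimes N$, $M_{\mathbb{Q}}=\mathbb{Q}\otimes M$, $\Sigma$ is a fan of strongly convex rational polyhedral cones in $N_{\mathbb{Q}}$, and $X=X(\Sigma)$ is the associated toric variety. $\Sigma$ is simplicial if every $k$-dimensional cone of $\Sigma$ has exactly $k$ extremal rays, for all $k$. For cones, $\tau\succ\sigma$ means $\sigma$ is a proper face of $\tau$, and $\tau\to\sigma$ means $\sigma$ is a facet of $\tau$. For $\sigma\in\Sigma$, $N_\sigma$ is the subgroup of $N$ generated by $\sigma\cap N$. Write $M(\sigma)=\sigma^\perp\subset M_{\mathbb{Q}}$, $M_\tau=M_{\mathbb{Q}}/M(\tau)$, and for $\sigma\prec\tau$, $M(\sigma)_\tau=M(\sigma)/M(\tau)$,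 which is dual to $\mathbb{Q}\otimes(N_\tau/N_\sigma)$; $\langle\cdot,\cdot\rangle$ denotes the duality pairings. If $\tau\to\sigma$, $n_{\tau,\sigma}$ is the generator of $N_\tau/N_\sigma\cong\mathbb{Z}$ lying in the image of $\tau$. For $\sigma\in\Sigma$ of dimension $n-k$, $V(\sigma)$ is the associated $k$-dimensional torus-invariant subvariety; $Z_k(X)_{\mathbb{Q}}$ is the $\mathbb{Q}$-vector space with basis the $[V(\sigma)]$, $\dim\sigma=n-k$; $[X]=[V(0)]$. An equivariant $\mathbb{Q}$-Cartier divisor $D$ is a collection of local equations $m_\sigma\in M_\sigma$ such that for $\tau\prec\sigma$ the natural map $M_\sigma\to M_\tau$ sends $m_\sigma$ to $m_\tau$; its cycle is $[D]=\sum_i\langle m_{\rho_i},v_i\rangle[V(\rho_i)]$, with $v_i$ the first lattice point of $N$ along $\rho_i$. When $\Sigma$ is simplicial, $D\mapsto[D]$ is an isomorphism from $\mathbb{Q}$-Cartier divisors to $Z_{n-1}(X)_{\mathbb{Q}}$, and $D_i$ denotes both the cycle $[V(\rho_i)]$ and the corresponding $\mathbb{Q}$-Cartier divisor. A choice of complements $\Psi$ assigns to each $\sigma\in\Sigma$ a linear subspace $\Psi(\sigma)\subset M_{\mathbb{Q}}$ of dimension $\dim\sigma$ such that $\Psi(\sigma)\cap M(\sigma)=0$, and $\Psi(\tau)\subset\Psi(\sigma)$ whenever $\tau\prec\sigma$. Let $\pi_\sigma:M_{\mathbb{Q}}\to M(\sigma)$ be the projection along $\Psi(\sigma)$; for $\tau\succ\sigma$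 it induces $\pi_\sigma:M_\tau\to M(\sigma)_\tau$. The action is $D\cdot[V(\sigma)]=\sum_{\tau\to\sigma}\langle\pi_\sigma(m_\tau),n_{\tau,\sigma}\rangle[V(\tau)]$, extended linearly. *)

theory Defs
  imports
    Complex_Main
    "HOL-Algebra.QuotRing"
    "HOL-Algebra.Module"
    "HOL-Algebra.Generated_Groups"
    "HOL-Library.FuncSet"
    "HOL-Library.Function_Algebras"
    "HOL-Library.Set_Algebras"
    "HOL-Library.Poly_Mapping"
begin

section \<open>Rational vector spaces\<close>

class rat_vector = ab_group_add +
  fixes scaleQ :: "rat \<Rightarrow> 'a \<Rightarrow> 'a" (infixr \<open>*\<^sub>Q\<close> 75)
  assumes scaleQ_add_right: "a *\<^sub>Q (x + y) = a *\<^sub>Q x + a *\<^sub>Q y"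
    and scaleQ_add_left: "(a + b) *\<^sub>Q x = a *\<^sub>Q x + b *\<^sub>Q x"
    and scaleQ_scaleQ: "a *\<^sub>Q b *\<^sub>Q x = (a * b) *\<^sub>Q x"
    and scaleQ_one: "1 *\<^sub>Q x = x"

global_interpretation rat_vector: vector_space "scaleQ :: rat \<Rightarrow> 'a \<Rightarrow> 'a::rat_vector"
  by unfold_locales (rule scaleQ_add_right scaleQ_add_left scaleQ_scaleQ scaleQ_one)+

instantiation rat :: rat_vector
begin
definition scaleQ_rat :: "rat \<Rightarrow> rat \<Rightarrow> rat" where "scaleQ_rat = (*)"
instance by standard (simp_all add: scaleQ_rat_def algebra_simps)
end

instantiation "fun" :: (type, rat_vector) rat_vector
begin
definition scaleQ_fun :: "rat \<Rightarrow> ('a \<Rightarrow> 'b) \<Rightarrow> 'a \<Rightarrow> 'b" where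
  "scaleQ_fun c f = (\<lambda>x. c *\<^sub>Q f x)"
instance
  by standard
    (simp_all add: scaleQ_fun_def fun_eq_iff scaleQ_add_right scaleQ_add_left scaleQ_scaleQ scaleQ_one)
end

instantiation poly_mapping :: (type, rat_vector) rat_vector
begin
definition scaleQ_poly_mapping :: "rat \<Rightarrow> ('a \<Rightarrow>\<^sub>0 'b) \<Rightarrow> 'a \<Rightarrow>\<^sub>0 'b" where
  "scaleQ_poly_mapping c = Poly_Mapping.map (scaleQ c)"
instance
proof -
  have lk: "Poly_Mapping.lookup (c *\<^sub>Q f) k = c *\<^sub>Q Poly_Mapping.lookup f k" for c k and f :: "'a \<Rightarrow>\<^sub>0 'b"
    by (simp add: scaleQ_poly_mapping_def Poly_Mapping.map.rep_eq when_def)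
  show "OFCLASS('a \<Rightarrow>\<^sub>0 'b, rat_vector_class)"
    by standard
      (rule poly_mapping_eqI,
       simp add: lk lookup_add scaleQ_add_right scaleQ_add_left scaleQ_scaleQ scaleQ_one)+
qed
end


section \<open>Lattices, cones and fans\<close>

text \<open>
  The free abelian group \<open>N\<close> of rank \<open>n\<close> is given inside \<open>N\<^sub>\<rat>\<close>, which is the whole type
  \<open>'v\<close>: as the group of integral combinations of some basis of \<open>'v\<close> with \<open>n\<close> elements.
\<close>

definition lattice_of_rank :: "'v::rat_vector set \<Rightarrow> nat \<Rightarrow> bool" where
  "lattice_of_rank N n \<longleftrightarrow>
     (\<exists>B. finite B \<and> card B = n \<and> rat_vector.independent B \<and> rat_vector.span B = UNIV \<and>
          N = {\<Sum>b\<in>B. rat_of_int (k b) *\<^sub>Q b | k. True})"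

text \<open>
  \<open>M\<^sub>\<rat> = \<rat> \<otimes> Hom(N, \<int>)\<close> is identified with \<open>Hom(N\<^sub>\<rat>, \<rat>)\<close>, so that the duality pairing is
  evaluation.
\<close>

definition M_rat :: "('v::rat_vector \<Rightarrow> rat) set" where
  "M_rat = {m. Vector_Spaces.linear scaleQ scaleQ m}"

definition cone_gen :: "'v::rat_vector set \<Rightarrow> 'v set" where
  "cone_gen S = {\<Sum>s\<in>S. c s *\<^sub>Q s | c. \<forall>s\<in>S. 0 \<le> c s}"

definition rational_polyhedral_cone :: "'v::rat_vector set \<Rightarrow> 'v set \<Rightarrow> bool" where
  "rational_polyhedral_cone N \<sigma> \<longleftrightarrow> (\<exists>S. finite S \<and> S \<subseteq> N \<and> \<sigma> = cone_gen S)"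

definition strongly_convex :: "'v::rat_vector set \<Rightarrow> bool" where
  "strongly_convex \<sigma> \<longleftrightarrow> \<sigma> \<inter> uminus ` \<sigma> = {0}"

definition is_face :: "'v::rat_vector set \<Rightarrow> 'v set \<Rightarrow> bool" where
  "is_face \<tau> \<sigma> \<longleftrightarrow> (\<exists>m\<in>M_rat. (\<forall>x\<in>\<sigma>. 0 \<le> m x) \<and> \<tau> = {x\<in>\<sigma>. m x = 0})"

definition proper_face :: "'v::rat_vector set \<Rightarrow> 'v set \<Rightarrow> bool" where
  "proper_face \<tau> \<sigma> \<longleftrightarrow> is_face \<tau> \<sigma> \<and> \<tau> \<noteq> \<sigma>"

text \<open>The dimension of a cone is the dimension of its linear span, since
  \<open>rat_vector.dim \<sigma> = rat_vector.dim (rat_vector.span \<sigma>)\<close>.\<close>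

definition is_facet :: "'v::rat_vector set \<Rightarrow> 'v set \<Rightarrow> bool" where
  "is_facet \<tau> \<sigma> \<longleftrightarrow> is_face \<tau> \<sigma> \<and> rat_vector.dim \<sigma> = rat_vector.dim \<tau> + 1"

definition fan :: "'v::rat_vector set \<Rightarrow> 'v set set \<Rightarrow> bool" where
  "fan N \<Sigma> \<longleftrightarrow>
     finite \<Sigma> \<and> \<Sigma> \<noteq> {} \<and>
     (\<forall>\<sigma>\<in>\<Sigma>. rational_polyhedral_cone N \<sigma> \<and> strongly_convex \<sigma>) \<and>
     (\<forall>\<sigma>\<in>\<Sigma>. \<forall>\<tau>. is_face \<tau> \<sigma> \<longrightarrow> \<tau> \<in> \<Sigma>) \<and>
     (\<forall>\<sigma>\<in>\<Sigma>. \<forall>\<tau>\<in>\<Sigma>. is_face (\<sigma> \<inter> \<tau>) \<sigma> \<and> is_face (\<sigma> \<inter> \<tau>) \<tau>)"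

definition extremal_rays :: "'v::rat_vector set \<Rightarrow> 'v set set" where
  "extremal_rays \<sigma> = {\<rho>. is_face \<rho> \<sigma> \<and> rat_vector.dim \<rho> = 1}"

definition simplicial :: "'v::rat_vector set set \<Rightarrow> bool" where
  "simplicial \<Sigma> \<longleftrightarrow> (\<forall>\<sigma>\<in>\<Sigma>. card (extremal_rays \<sigma>) = rat_vector.dim \<sigma>)"

definition rays :: "'v::rat_vector set set \<Rightarrow> 'v set set" where
  "rays \<Sigma> = {\<rho>\<in>\<Sigma>. rat_vector.dim \<rho> = 1}"


section \<open>Lattices and dual spaces attached to cones\<close>

definition add_grp :: "'v::ab_group_add set \<Rightarrow> 'v monoid" where
  "add_grp A = \<lparr>carrier = A, monoid.mult = (+), one = 0\<rparr>"

definition sublattice :: "'v::rat_vector set \<Rightarrow> 'v set \<Rightarrow> 'v set" where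
  "sublattice N \<sigma> = generate (add_grp N) (\<sigma> \<inter> N)"

definition quot_lattice :: "'v::rat_vector set \<Rightarrow> 'v set \<Rightarrow> 'v set \<Rightarrow> 'v set monoid" where
  "quot_lattice N \<tau> \<sigma> = add_grp (sublattice N \<tau>) Mod sublattice N \<sigma>"

text \<open>
  The generator \<open>n\<^bsub>\<tau>,\<sigma>\<^esub>\<close>, a coset of \<open>N\<^sub>\<sigma>\<close> in \<open>N\<^sub>\<tau>\<close>. The last conjunct says that its class in
  \<open>\<rat> \<otimes> (N\<^sub>\<tau> / N\<^sub>\<sigma>) = span \<tau> / span \<sigma>\<close> lies in the image of \<open>\<tau>\<close>.
\<close>

definition normal_gen :: "'v::rat_vector set \<Rightarrow> 'v set \<Rightarrow> 'v set \<Rightarrow> 'v set" where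
  "normal_gen N \<tau> \<sigma> =
     (THE c. c \<in> carrier (quot_lattice N \<tau> \<sigma>) \<and>
             generate (quot_lattice N \<tau> \<sigma>) {c} = carrier (quot_lattice N \<tau> \<sigma>) \<and>
             (\<exists>x\<in>c. \<exists>t\<in>\<tau>. x - t \<in> rat_vector.span \<sigma>))"

definition first_lattice_point :: "'v::rat_vector set \<Rightarrow> 'v set \<Rightarrow> 'v" where
  "first_lattice_point N \<rho> =
     (THE v. v \<in> \<rho> \<inter> N - {0} \<and> (\<forall>w\<in>\<rho> \<inter> N - {0}. \<exists>q\<ge>1. w = q *\<^sub>Q v))"

definition M_perp :: "'v::rat_vector set \<Rightarrow> ('v \<Rightarrow> rat) set" where
  "M_perp \<sigma> = {m\<in>M_rat. \<forall>x\<in>\<sigma>. m x = 0}"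

definition M_quot :: "'v::rat_vector set \<Rightarrow> ('v \<Rightarrow> rat) set set" where
  "M_quot \<tau> = (\<lambda>m. m +o M_perp \<tau>) ` M_rat"

text \<open>For a proper face \<open>\<tau>\<close> of \<open>\<sigma>\<close>, the natural map \<open>M\<^sub>\<sigma> \<rightarrow> M\<^sub>\<tau>\<close> (sum of sets, taking
  \<open>m + M(\<sigma>)\<close> to \<open>m + M(\<tau>)\<close>).\<close>

definition M_restr :: "'v::rat_vector set \<Rightarrow> ('v \<Rightarrow> rat) set \<Rightarrow> ('v \<Rightarrow> rat) set" where
  "M_restr \<tau> C = C + M_perp \<tau>"

text \<open>
  The pairing induced by evaluation on a coset \<open>C\<close> of functionals and a coset \<open>A\<close> of lattice
  points. It is used for \<open>C \<in> M(\<sigma>)\<^sub>\<tau>\<close> and \<open>A \<in> N\<^sub>\<tau> / N\<^sub>\<sigma>\<close>, and for \<open>C \<in> M\<^sub>\<rho>\<close> and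
  \<open>A = {v}\<close> with \<open>v \<in> N\<^sub>\<rho>\<close>; in both cases the value does not depend on representatives.
\<close>

definition pairing :: "('v \<Rightarrow> rat) set \<Rightarrow> 'v set \<Rightarrow> rat" where
  "pairing C A = (THE q. \<forall>m\<in>C. \<forall>v\<in>A. m v = q)"


section \<open>Cycles, Cartier divisors and complements\<close>

text \<open>A cycle is a finitely supported function on cones; \<open>[V(\<sigma>)]\<close> is the indicator of \<open>\<sigma>\<close>.\<close>

type_synonym 'v cyc = "'v set \<Rightarrow>\<^sub>0 rat"

definition V_cycle :: "'v set \<Rightarrow> 'v cyc" where
  "V_cycle \<sigma> = Poly_Mapping.single \<sigma> 1"

definition X_cycle :: "'v::zero cyc" where
  "X_cycle = V_cycle {0}"

definition Z_cycles :: "nat \<Rightarrow> 'v::rat_vector set set \<Rightarrow> nat \<Rightarrow> 'v cyc set" where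
  "Z_cycles n \<Sigma> k = rat_vector.span (V_cycle ` {\<sigma>\<in>\<Sigma>. rat_vector.dim \<sigma> + k = n})"

text \<open>The sum below is direct because the \<open>Z\<^sub>k\<close> are spanned by disjoint sets of basis vectors.\<close>

definition Z_star :: "nat \<Rightarrow> 'v::rat_vector set set \<Rightarrow> 'v cyc set" where
  "Z_star n \<Sigma> = {\<Sum>k\<le>n. z k | z. \<forall>k\<le>n. z k \<in> Z_cycles n \<Sigma> k}"

text \<open>A divisor is extensional (\<open>undefined\<close> outside \<open>\<Sigma>\<close>), so it is determined by its local
  equations.\<close>

definition rat_cartier :: "'v::rat_vector set set \<Rightarrow> ('v set \<Rightarrow> ('v \<Rightarrow> rat) set) \<Rightarrow> bool" where
  "rat_cartier \<Sigma> D \<longleftrightarrow>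
     D \<in> (\<Pi>\<^sub>E \<sigma>\<in>\<Sigma>. M_quot \<sigma>) \<and>
     (\<forall>\<sigma>\<in>\<Sigma>. \<forall>\<tau>\<in>\<Sigma>. proper_face \<tau> \<sigma> \<longrightarrow> M_restr \<tau> (D \<sigma>) = D \<tau>)"

definition divisor_cycle ::
    "'v::rat_vector set \<Rightarrow> 'v set set \<Rightarrow> ('v set \<Rightarrow> ('v \<Rightarrow> rat) set) \<Rightarrow> 'v cyc" where
  "divisor_cycle N \<Sigma> D =
     (\<Sum>\<rho>\<in>rays \<Sigma>. pairing (D \<rho>) {first_lattice_point N \<rho>} *\<^sub>Q V_cycle \<rho>)"

definition ray_divisor ::
    "'v::rat_vector set \<Rightarrow> 'v set set \<Rightarrow> 'v set \<Rightarrow> 'v set \<Rightarrow> ('v \<Rightarrow> rat) set" where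
  "ray_divisor N \<Sigma> \<rho> = (THE D. rat_cartier \<Sigma> D \<and> divisor_cycle N \<Sigma> D = V_cycle \<rho>)"

definition choice_of_complements ::
    "'v::rat_vector set set \<Rightarrow> ('v set \<Rightarrow> ('v \<Rightarrow> rat) set) \<Rightarrow> bool" where
  "choice_of_complements \<Sigma> \<Psi> \<longleftrightarrow>
     (\<forall>\<sigma>\<in>\<Sigma>. \<Psi> \<sigma> \<subseteq> M_rat \<and> rat_vector.subspace (\<Psi> \<sigma>) \<and>
             rat_vector.dim (\<Psi> \<sigma>) = rat_vector.dim \<sigma> \<and> \<Psi> \<sigma> \<inter> M_perp \<sigma> = {0}) \<and>
     (\<forall>\<sigma>\<in>\<Sigma>. \<forall>\<tau>\<in>\<Sigma>. proper_face \<tau> \<sigma> \<longrightarrow> \<Psi> \<tau> \<subseteq> \<Psi> \<sigma>)"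

definition proj ::
    "('v::rat_vector set \<Rightarrow> ('v \<Rightarrow> rat) set) \<Rightarrow> 'v set \<Rightarrow> ('v \<Rightarrow> rat) \<Rightarrow> 'v \<Rightarrow> rat" where
  "proj \<Psi> \<sigma> m = (THE x. x \<in> M_perp \<sigma> \<and> m - x \<in> \<Psi> \<sigma>)"

text \<open>
  The map \<open>M\<^sub>\<tau> \<rightarrow> M(\<sigma>)\<^sub>\<tau>\<close> induced by \<open>\<pi>\<^sub>\<sigma>\<close> takes a coset of \<open>M(\<tau>)\<close> to its image, again
  a coset of \<open>M(\<tau>)\<close> because \<open>\<pi>\<^sub>\<sigma>\<close> is the identity on \<open>M(\<tau>) \<subseteq> M(\<sigma>)\<close>.
\<close>

definition act_V ::
    "'v::rat_vector set \<Rightarrow> 'v set set \<Rightarrow> ('v set \<Rightarrow> ('v \<Rightarrow> rat) set)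
      \<Rightarrow> ('v set \<Rightarrow> ('v \<Rightarrow> rat) set) \<Rightarrow> 'v set \<Rightarrow> 'v cyc" where
  "act_V N \<Sigma> \<Psi> D \<sigma> =
     (\<Sum>\<tau> | \<tau> \<in> \<Sigma> \<and> is_facet \<sigma> \<tau>. pairing (proj \<Psi> \<sigma> ` D \<tau>) (normal_gen N \<tau> \<sigma>) *\<^sub>Q V_cycle \<tau>)"

definition divisor_act ::
    "'v::rat_vector set \<Rightarrow> 'v set set \<Rightarrow> ('v set \<Rightarrow> ('v \<Rightarrow> rat) set)
      \<Rightarrow> ('v set \<Rightarrow> ('v \<Rightarrow> rat) set) \<Rightarrow> 'v cyc \<Rightarrow> 'v cyc" where
  "divisor_act N \<Sigma> \<Psi> D z =
     (\<Sum>\<sigma>\<in>Poly_Mapping.keys z. Poly_Mapping.lookup z \<sigma> *\<^sub>Q act_V N \<Sigma> \<Psi> D \<sigma>)"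


section \<open>The polynomial ring and its action\<close>

text \<open>Polynomials map exponent vectors to coefficients; \<open>\<rat>[Y\<^sub>1, \<dots>, Y\<^sub>r]\<close> consists of those
  in which only variables with index in \<open>{1..r}\<close> occur.\<close>

type_synonym rat_mpoly = "(nat \<Rightarrow>\<^sub>0 nat) \<Rightarrow>\<^sub>0 rat"

definition const_Y :: "rat \<Rightarrow> rat_mpoly" where
  "const_Y c = Poly_Mapping.single 0 c"

definition var_Y :: "nat \<Rightarrow> rat_mpoly" where
  "var_Y i = Poly_Mapping.single (Poly_Mapping.single i 1) 1"

definition poly_ring_Y :: "nat \<Rightarrow> rat_mpoly ring" where
  "poly_ring_Y r =
     \<lparr>carrier = {p. \<forall>e\<in>Poly_Mapping.keys p. Poly_Mapping.keys e \<subseteq> {1..r}},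
      monoid.mult = (*), one = 1, zero = 0, add = (+)\<rparr>"

text \<open>The monomial \<open>Y\<^sub>1\<^bsup>e\<^sub>1\<^esup> \<cdots> Y\<^sub>r\<^bsup>e\<^sub>r\<^esup>\<close> acts as the composition
  \<open>T\<^sub>1\<^bsup>e\<^sub>1\<^esup> \<circ> \<cdots> \<circ> T\<^sub>r\<^bsup>e\<^sub>r\<^esup>\<close>, in this order. That the order is irrelevant is part of the
  module axioms.\<close>

definition monom_act :: "nat \<Rightarrow> (nat \<Rightarrow> 'z \<Rightarrow> 'z) \<Rightarrow> (nat \<Rightarrow>\<^sub>0 nat) \<Rightarrow> 'z \<Rightarrow> 'z" where
  "monom_act r T e = foldr (\<lambda>i. T i ^^ Poly_Mapping.lookup e i) [1..<Suc r]"

definition poly_act :: "nat \<Rightarrow> (nat \<Rightarrow> 'z \<Rightarrow> 'z) \<Rightarrow> rat_mpoly \<Rightarrow> 'z \<Rightarrow> 'z::rat_vector" where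
  "poly_act r T p z = (\<Sum>e\<in>Poly_Mapping.keys p. Poly_Mapping.lookup p e *\<^sub>Q monom_act r T e z)"

text \<open>The record type for modules extends that of rings; the locale \<open>module\<close> does not use the
  fields \<open>mult\<close> and \<open>one\<close> of the module.\<close>

definition cycle_module ::
    "'v::rat_vector set \<Rightarrow> nat \<Rightarrow> 'v set set \<Rightarrow> ('v set \<Rightarrow> ('v \<Rightarrow> rat) set)
      \<Rightarrow> nat \<Rightarrow> (nat \<Rightarrow> 'v set) \<Rightarrow> (rat_mpoly, 'v cyc) module" where
  "cycle_module N n \<Sigma> \<Psi> r \<rho> =
     \<lparr>carrier = Z_star n \<Sigma>, monoid.mult = undefined, one = undefined, zero = 0, add = (+),
      smult = poly_act r (\<lambda>i. divisor_act N \<Sigma> \<Psi> (ray_divisor N \<Sigma> (\<rho> i)))\<rparr>"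

definition submodule_gen :: "('a, 'b) ring_scheme \<Rightarrow> ('a, 'c, 'd) module_scheme \<Rightarrow> 'c set \<Rightarrow> 'c set" where
  "submodule_gen R M S = \<Inter>{H. submodule H R M \<and> S \<subseteq> H}"

definition quot_module :: "('a, 'b) ring_scheme \<Rightarrow> 'a set \<Rightarrow> ('a, 'a set) module" where
  "quot_module R I =
     \<lparr>carrier = carrier (R Quot I), monoid.mult = monoid.mult (R Quot I), one = one (R Quot I),
      zero = zero (R Quot I), add = add (R Quot I),
      smult = (\<lambda>a C. (I +>\<^bsub>R\<^esub> a) \<otimes>\<^bsub>R Quot I\<^esub> C)\<rparr>"

definition module_iso ::
    "('a, 'b) ring_scheme \<Rightarrow> ('a, 'c, 'd) module_scheme \<Rightarrow> ('a, 'e, 'f) module_scheme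
      \<Rightarrow> ('c \<Rightarrow> 'e) set" where
  "module_iso R M M' =
     {f. bij_betw f (carrier M) (carrier M') \<and>
         (\<forall>x\<in>carrier M. \<forall>y\<in>carrier M. f (x \<oplus>\<^bsub>M\<^esub> y) = f x \<oplus>\<^bsub>M'\<^esub> f y) \<and>
         (\<forall>a\<in>carrier R. \<forall>x\<in>carrier M. f (a \<odot>\<^bsub>M\<^esub> x) = a \<odot>\<^bsub>M'\<^esub> f x)}"

end

theory Submission
  imports Defs
begin

text \<open>
  Let \<open>\<tau>\<^sub>1, \<tau>\<^sub>2\<close> be the two cones strictly between \<open>\<sigma>\<close> and a cone \<open>\<gamma>\<close> of dimension two more, with
  new rays \<open>v, w\<close>. The coefficient of \<open>[V(\<gamma>)]\<close> in \<open>D \<cdot> (D' \<cdot> [V(\<sigma>)])\<close> is a sum over \<open>\<tau>\<^sub>1, \<tau>\<^sub>2\<close>. The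
  lattice factors of both terms equal the covolume of the image of \<open>N\<^sub>\<gamma>\<close> in the plane spanned by \<open>v, w\<close>
  modulo \<open>\<sigma>\<close>. Since \<open>\<Psi>(\<sigma>) \<subseteq> \<Psi>(\<tau>\<^sub>i)\<close>, the projection along \<open>\<Psi>(\<tau>\<^sub>i)\<close> differs from the one along
  \<open>\<Psi>(\<sigma>)\<close> by a rank one correction, which contributes symmetrically in \<open>D\<close> and \<open>D'\<close>. Hence the
  actions commute. Adding one ray at a time to the zero cone, each \<open>[V(\<tau>)]\<close> is obtained from \<open>[X]\<close> up
  to a nonzero factor, so the module is cyclic and inherits a ring structure.
\<close>

section \<open>Linear functionals\<close>

text \<open>The data enter through definite descriptions (\<open>normal_gen\<close>,
  \<open>first_lattice_point\<close>, \<open>pairing\<close>, \<open>proj\<close>,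
  \<open>ray_divisor\<close>) and through cones with arbitrary finite generating sets, so each
  description must be evaluated before anything can be computed. Two devices do this. Gordan's
  alternative shows that irredundant generators of a strongly convex cone span faces; counting them
  against the dimension turns simpliciality into linear independence. A cone of the fan is then
  handled as the finite set \<open>gens \<sigma>\<close> of first lattice points on its rays, and
  faces become subsets. On the lattice side, a rank one quotient is read through a functional f that
  is 1 on the new ray vector and 0 on the facet; having bounded denominators on N, it takes exactly
  the multiples of some \<alpha> > 0 as values. This \<alpha> need not be 1, because first lattice
  points on the rays need not generate the lattice of a cone. The lattice factors along the two
  flags may therefore differ one by one, and only their products agree. After this evaluation a ray
  divisor acts by the matrix \<open>coeff\<close>, and commutation is an identity between matrix
  products.\<close>

lemma M_rat_iff:
  fixes m :: "'a::rat_vector \<Rightarrow> rat"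
  shows "m \<in> M_rat \<longleftrightarrow> (\<forall>x y. m (x + y) = m x + m y) \<and> (\<forall>c x. m (c *\<^sub>Q x) = c * m x)"
  using rat_vector.vector_space_axioms[where 'a = rat] rat_vector.vector_space_axioms[where 'a = 'a]
  by (auto simp: M_rat_def Vector_Spaces.linear_iff scaleQ_rat_def)

lemma M_rat_simps:
  assumes "m \<in> M_rat"
  shows "m (x + y) = m x + m y" "m (c *\<^sub>Q x) = c * m x" "m 0 = 0" "m (- x) = - m x"
    "m (x - y) = m x - m y" "m (\<Sum>a\<in>A. g a) = (\<Sum>a\<in>A. m (g a))"
proof -
  interpret additive m using assms by unfold_locales (simp add: M_rat_iff)
  show "m (x + y) = m x + m y" "m 0 = 0" "m (- x) = - m x"
    "m (x - y) = m x - m y" "m (\<Sum>a\<in>A. g a) = (\<Sum>a\<in>A. m (g a))"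
    by (rule add zero minus diff sum)+
  show "m (c *\<^sub>Q x) = c * m x" using assms by (simp add: M_rat_iff)
qed

lemma M_rat_zero: "0 \<in> M_rat"
  by (simp add: M_rat_iff)

lemma M_rat_add: "m \<in> M_rat \<Longrightarrow> m' \<in> M_rat \<Longrightarrow> m + m' \<in> M_rat"
  by (simp add: M_rat_iff algebra_simps)

lemma M_rat_diff: "m \<in> M_rat \<Longrightarrow> m' \<in> M_rat \<Longrightarrow> m - m' \<in> M_rat"
  by (simp add: M_rat_iff algebra_simps)

lemma M_rat_scale: "m \<in> M_rat \<Longrightarrow> c *\<^sub>Q m \<in> M_rat"
  by (simp add: M_rat_iff scaleQ_fun_def scaleQ_rat_def algebra_simps)

lemma M_rat_eq_on_span:
  assumes "m \<in> M_rat" "m' \<in> M_rat" "x \<in> rat_vector.span S" "\<And>s. s \<in> S \<Longrightarrow> m s = m' s"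
  shows "m x = m' x"
  using assms(3)
  by (induction rule: rat_vector.span_induct_alt) (simp_all add: M_rat_simps assms)

lemma M_rat_zero_on_span:
  assumes "m \<in> M_rat" "x \<in> rat_vector.span S" "\<And>s. s \<in> S \<Longrightarrow> m s = 0"
  shows "m x = 0"
  using M_rat_eq_on_span[OF assms(1) M_rat_zero assms(2)] assms(3) by simp

section \<open>Existence of functionals with prescribed values or signs\<close>

lemma functional_extend:
  fixes B :: "'v::rat_vector set"
  assumes "rat_vector.independent B"
  obtains m where "m \<in> M_rat" "\<And>b. b \<in> B \<Longrightarrow> m b = g b"
proof -
  interpret vector_space_pair "scaleQ :: rat \<Rightarrow> 'v \<Rightarrow> 'v" "scaleQ :: rat \<Rightarrow> rat \<Rightarrow> rat" ..
  show thesis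
    using linear_independent_extend[OF assms, of g] that by (auto simp: M_rat_def)
qed

lemma functional_separating:
  assumes "rat_vector.subspace U" "t \<notin> U"
  obtains m where "m \<in> M_rat" "\<And>u. u \<in> U \<Longrightarrow> m u = 0" "m t = 1"
proof -
  obtain B where B: "B \<subseteq> U" "rat_vector.independent B" "U \<subseteq> rat_vector.span B"
    using rat_vector.maximal_independent_subset by blast
  then have U: "rat_vector.span B = U"
    using assms(1) rat_vector.span_subspace by blast
  have t: "t \<notin> B" using B assms by auto
  have "rat_vector.independent (insert t B)"
    using B U assms by (simp add: rat_vector.independent_insert)
  then obtain m where m: "m \<in> M_rat" "\<And>b. b \<in> insert t B \<Longrightarrow> m b = (if b = t then 1 else 0)"
    by (rule functional_extend[where g = "\<lambda>b. if b = t then 1 else 0"]) blast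
  have "m u = 0" if "u \<in> U" for u
  proof (rule M_rat_zero_on_span[OF m(1)])
    show "u \<in> rat_vector.span B" using that U by simp
    show "m b = 0" if "b \<in> B" for b using m(2)[of b] t that by auto
  qed
  with m that show thesis by auto
qed

text \<open>Gordan's alternative modulo a subspace. In the induction step, if a positive combination of
  \<open>T\<close> lies in the span of \<open>U\<close> and the new vector \<open>t\<close>, then the functional for \<open>T\<close> is already positive
  at \<open>t\<close>; otherwise a functional vanishing at \<open>t\<close> is perturbed.\<close>

lemma gordan:
  assumes "finite T" "rat_vector.subspace U"
    and "\<And>c. (\<And>t. t \<in> T \<Longrightarrow> 0 \<le> c t) \<Longrightarrow> (\<Sum>t\<in>T. c t *\<^sub>Q t) \<in> U \<Longrightarrow> \<forall>t\<in>T. c t = 0"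
  shows "\<exists>m\<in>M_rat. (\<forall>u\<in>U. m u = 0) \<and> (\<forall>t\<in>T. 0 < m t)"
  using assms
proof (induction T arbitrary: U rule: finite_induct)
  case empty
  then show ?case using M_rat_zero by (auto intro!: bexI[of _ 0])
next
  case (insert t T)
  have sum_ins: "(\<Sum>s\<in>insert t T. (c(t := k)) s *\<^sub>Q s) = k *\<^sub>Q t + (\<Sum>s\<in>T. c s *\<^sub>Q s)" for c k
  proof -
    have "(\<Sum>s\<in>T. (c(t := k)) s *\<^sub>Q s) = (\<Sum>s\<in>T. c s *\<^sub>Q s)"
      using insert.hyps by (intro sum.cong) auto
    then show ?thesis using insert.hyps by simp
  qed
  \<comment> \<open>The hypothesis of the alternative with the coefficient of t split off. It is
    used with k = 0 to apply the induction hypothesis to T alone, and with negated k when t appears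
    on the other side.\<close>
  have step: "k = 0 \<and> (\<forall>s\<in>T. c s = 0)"
    if "0 \<le> k" "\<And>s. s \<in> T \<Longrightarrow> 0 \<le> c s" "k *\<^sub>Q t + (\<Sum>s\<in>T. c s *\<^sub>Q s) \<in> U" for c k
  proof -
    have "\<forall>s\<in>insert t T. (c(t := k)) s = 0"
    proof (rule insert.prems(2))
      show "0 \<le> (c(t := k)) s" if "s \<in> insert t T" for s
        using that \<open>0 \<le> k\<close> \<open>\<And>s. s \<in> T \<Longrightarrow> 0 \<le> c s\<close> by auto
      show "(\<Sum>s\<in>insert t T. (c(t := k)) s *\<^sub>Q s) \<in> U"
        unfolding sum_ins by (rule that(3))
    qed
    then show ?thesis using insert.hyps by (auto split: if_splits)
  qed
  have "\<exists>m\<in>M_rat. (\<forall>u\<in>U. m u = 0) \<and> (\<forall>t\<in>T. 0 < m t)"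
    using step[of 0] by (intro insert.IH insert.prems) auto
  then obtain m where m: "m \<in> M_rat" "\<And>u. u \<in> U \<Longrightarrow> m u = 0" "\<And>s. s \<in> T \<Longrightarrow> 0 < m s"
    by blast
  define U1 where "U1 = rat_vector.span (insert t U)"
  have U1: "x \<in> U1 \<longleftrightarrow> (\<exists>k. x - k *\<^sub>Q t \<in> U)" for x
    unfolding U1_def rat_vector.span_insert using insert.prems(1)
    by (simp add: rat_vector.span_eq_iff[THEN iffD2])
  show ?case
  proof (cases "\<exists>c. (\<forall>s\<in>T. 0 \<le> c s) \<and> (\<Sum>s\<in>T. c s *\<^sub>Q s) \<in> U1 \<and> \<not> (\<forall>s\<in>T. c s = 0)")
    case True
    then obtain c k where c: "\<And>s. s \<in> T \<Longrightarrow> 0 \<le> c s" "\<not> (\<forall>s\<in>T. c s = 0)"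
        and k: "(\<Sum>s\<in>T. c s *\<^sub>Q s) - k *\<^sub>Q t \<in> U"
      unfolding U1 by blast
    \<comment> \<open>If k were at most 0, moving k t to the other side would give a nonnegative
      relation modulo U in which c is not zero.\<close>
    have "0 < k"
    proof (rule ccontr)
      assume "\<not> 0 < k"
      then show False using step[of "- k" c] c k by (simp add: algebra_simps)
    qed
    have "m ((\<Sum>s\<in>T. c s *\<^sub>Q s) - k *\<^sub>Q t) = 0" using k m(2) by blast
    then have "k * m t = (\<Sum>s\<in>T. c s * m s)" by (simp add: M_rat_simps m(1))
    moreover have "0 < (\<Sum>s\<in>T. c s * m s)"
    proof -
      obtain s where "s \<in> T" "c s \<noteq> 0" using c by blast
      then have "0 < c s * m s" using c(1)[of s] m(3)[of s] by simp
      then show ?thesis using \<open>s \<in> T\<close> insert.hyps(1) c(1) m(3)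
        by (intro sum_pos2[of T s] mult_nonneg_nonneg) (auto intro: less_imp_le)
    qed
    ultimately have "0 < m t" using \<open>0 < k\<close> by (metis zero_less_mult_pos)
    then show ?thesis using m by auto
  next
    case False
    have "\<exists>m\<in>M_rat. (\<forall>u\<in>U1. m u = 0) \<and> (\<forall>t\<in>T. 0 < m t)"
      using False by (intro insert.IH) (auto simp: U1_def)
    then obtain m' where m': "m' \<in> M_rat" "\<And>u. u \<in> U1 \<Longrightarrow> m' u = 0" "\<And>s. s \<in> T \<Longrightarrow> 0 < m' s"
      by blast
    have "t \<notin> U" using step[of 1 "\<lambda>_. 0"] by auto
    then obtain f where f: "f \<in> M_rat" "\<And>u. u \<in> U \<Longrightarrow> f u = 0" "f t = 1"
      using functional_separating insert.prems(1) by blast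
    \<comment> \<open>The functional f makes t positive but may be negative on T. A multiple of m'
      compensates for this without changing the value at t; K is chosen so large that every s in T
      gets a value of at least 1.\<close>
    obtain K where K: "\<And>s. s \<in> T \<Longrightarrow> 0 < K * m' s + f s"
    proof -
      define K where "K = Max (insert 1 ((\<lambda>s. (1 - f s) / m' s) ` T))"
      have K: "(1 - f s) / m' s \<le> K" if "s \<in> T" for s
        using that insert.hyps(1) unfolding K_def by (intro Max_ge) auto
      then have "1 - f s \<le> K * m' s" if "s \<in> T" for s
        using m'(3)[OF that] K[OF that] by (simp add: pos_divide_le_eq)
      then show thesis by (intro that[of K]) force
    qed
    have mem: "t \<in> U1" "u \<in> U \<Longrightarrow> u \<in> U1" for u
      unfolding U1_def by (auto intro: rat_vector.span_base)
    have "K *\<^sub>Q m' + f \<in> M_rat" using f(1) m'(1) by (intro M_rat_add M_rat_scale)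
    then show ?thesis
      using K f m' mem by (intro bexI[of _ "K *\<^sub>Q m' + f"])
        (auto simp: scaleQ_fun_def scaleQ_rat_def)
  qed
qed

section \<open>Cones\<close>

lemma cone_genI:
  "(\<And>s. s \<in> S \<Longrightarrow> 0 \<le> c s) \<Longrightarrow> x = (\<Sum>s\<in>S. c s *\<^sub>Q s) \<Longrightarrow> x \<in> cone_gen S"
  unfolding cone_gen_def by blast

lemma cone_genE:
  assumes "x \<in> cone_gen S"
  obtains c where "\<And>s. s \<in> S \<Longrightarrow> 0 \<le> c s" "x = (\<Sum>s\<in>S. c s *\<^sub>Q s)"
  using assms unfolding cone_gen_def by blast

lemma cone_gen_zero: "0 \<in> cone_gen S"
  by (rule cone_genI[of _ "\<lambda>_. 0"]) auto

lemma cone_gen_add: "x \<in> cone_gen S \<Longrightarrow> y \<in> cone_gen S \<Longrightarrow> x + y \<in> cone_gen S"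
  by (elim cone_genE, rule_tac c = "\<lambda>s. c s + ca s" in cone_genI)
    (simp_all add: scaleQ_add_left sum.distrib)

lemma cone_gen_scale: "x \<in> cone_gen S \<Longrightarrow> 0 \<le> k \<Longrightarrow> k *\<^sub>Q x \<in> cone_gen S"
  by (elim cone_genE, rule_tac c = "\<lambda>s. k * c s" in cone_genI)
    (simp_all add: rat_vector.scale_sum_right)

lemma cone_gen_sum: "(\<And>a. a \<in> A \<Longrightarrow> g a \<in> cone_gen S) \<Longrightarrow> sum g A \<in> cone_gen S"
  by (induction A rule: infinite_finite_induct) (auto intro: cone_gen_zero cone_gen_add)

lemma cone_gen_base:
  assumes "finite S" "s \<in> S"
  shows "s \<in> cone_gen S"
  using assms by (intro cone_genI[of _ "\<lambda>x. if x = s then 1 else 0"])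
    (auto simp: if_distrib[of "\<lambda>c. c *\<^sub>Q _"] cong: if_cong)

lemma cone_gen_minimal: "S \<subseteq> cone_gen T \<Longrightarrow> cone_gen S \<subseteq> cone_gen T"
  by (auto elim!: cone_genE intro!: cone_gen_sum cone_gen_scale)

lemma cone_gen_mono: "finite T \<Longrightarrow> S \<subseteq> T \<Longrightarrow> cone_gen S \<subseteq> cone_gen T"
  by (rule cone_gen_minimal) (auto intro: cone_gen_base)

lemma cone_gen_empty: "cone_gen {} = {0}"
  by (auto simp: cone_gen_def)

lemma cone_gen_singleton: "x \<in> cone_gen {s} \<longleftrightarrow> (\<exists>k\<ge>0. x = k *\<^sub>Q s)"
  by (auto simp: cone_gen_def)

lemma span_cone_gen:
  assumes "finite S"
  shows "rat_vector.span (cone_gen S) = rat_vector.span S"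
  unfolding rat_vector.span_eq
  using cone_gen_base[OF assms] rat_vector.span_base[of _ S] rat_vector.span_base[of _ "cone_gen S"]
  by (auto elim!: cone_genE intro!: rat_vector.span_sum rat_vector.span_scale)

lemma dim_cone_gen: "finite S \<Longrightarrow> rat_vector.dim (cone_gen S) = rat_vector.dim S"
  by (metis span_cone_gen rat_vector.dim_span)

lemma independent_if_card_le_dim:
  assumes "finite S" "card S \<le> rat_vector.dim S"
  shows "rat_vector.independent S"
proof -
  obtain B where B: "B \<subseteq> S" "rat_vector.independent B" "S \<subseteq> rat_vector.span B"
    "card B = rat_vector.dim S"
    using rat_vector.basis_exists by blast
  then show ?thesis using card_seteq[OF assms(1) B(1)] assms(2) by simp
qed

text \<open>A sum of nonnegative terms vanishes only if all terms do, so the supporting hyperplane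
  sees nothing but the generators lying on it.\<close>

lemma cone_gen_zero_set:
  assumes "finite S" "m \<in> M_rat" "\<And>s. s \<in> S \<Longrightarrow> 0 \<le> m s"
  shows "cone_gen {s\<in>S. m s = 0} = {x \<in> cone_gen S. m x = 0}" (is "?L = ?R")
proof
  show "?L \<subseteq> ?R"
  proof
    fix x assume x: "x \<in> ?L"
    then have "m x = 0" by (auto elim!: cone_genE simp: M_rat_simps assms)
    moreover have "x \<in> cone_gen S" using x cone_gen_mono[of S "{s\<in>S. m s = 0}"] assms(1) by auto
    ultimately show "x \<in> ?R" by simp
  qed
  show "?R \<subseteq> ?L"
  proof
    fix x assume "x \<in> ?R"
    then obtain c where c: "\<And>s. s \<in> S \<Longrightarrow> 0 \<le> c s" "x = (\<Sum>s\<in>S. c s *\<^sub>Q s)" and "m x = 0"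
      by (auto elim: cone_genE)
    then have "(\<Sum>s\<in>S. c s * m s) = 0" by (simp add: M_rat_simps assms)
    then have "\<forall>s\<in>S. c s * m s = 0"
      using assms c by (subst (asm) sum_nonneg_eq_0_iff) auto
    then have "x = (\<Sum>s\<in>{s\<in>S. m s = 0}. c s *\<^sub>Q s)"
      unfolding c(2) using assms(1) by (intro sum.mono_neutral_right) auto
    then show "x \<in> ?L" using c(1) by (intro cone_genI[of _ c]) auto
  qed
qed

lemma face_of_cone_gen:
  assumes "finite S" "m \<in> M_rat" "\<And>s. s \<in> S \<Longrightarrow> 0 \<le> m s"
  shows "is_face (cone_gen {s\<in>S. m s = 0}) (cone_gen S)"
proof -
  have "0 \<le> m x" if "x \<in> cone_gen S" for x
    using that assms by (auto elim!: cone_genE simp: M_rat_simps intro!: sum_nonneg)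
  then show ?thesis unfolding is_face_def using assms(2) cone_gen_zero_set[OF assms] by blast
qed

lemma is_face_subset: "is_face \<tau> \<sigma> \<Longrightarrow> \<tau> \<subseteq> \<sigma>"
  by (auto simp: is_face_def)

lemma is_face_refl: "is_face \<sigma> \<sigma>"
  unfolding is_face_def by (rule bexI[of _ 0]) (auto simp: M_rat_zero)

text \<open>Independence allows a functional that is 0 on \<open>S'\<close> and 1 on the remaining
  generators; it exposes the subcone.\<close>

lemma is_face_independent:
  assumes "finite S" "rat_vector.independent S" "S' \<subseteq> S"
  shows "is_face (cone_gen S') (cone_gen S)"
proof -
  obtain m where m: "m \<in> M_rat" "\<And>s. s \<in> S \<Longrightarrow> m s = (if s \<in> S' then 0 else 1)"
    using assms(2) by (rule functional_extend[where g = "\<lambda>s. if s \<in> S' then 0 else 1"]) blast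
  then have "{s\<in>S. m s = 0} = S'" using assms(3) by (auto split: if_splits)
  then show ?thesis using face_of_cone_gen[OF assms(1) m(1)] m(2) by auto
qed

text \<open>Gordan's alternative, applied to the other generators modulo the line through s, yields
  a functional that vanishes at s and is positive on all others. The work lies in excluding a
  nontrivial nonnegative combination of the others on that line.\<close>

lemma irredundant_generator_spans_ray:
  assumes S: "finite S" "strongly_convex (cone_gen S)"
    and irr: "\<And>s. s \<in> S \<Longrightarrow> s \<notin> cone_gen (S - {s})"
    and s: "s \<in> S"
  shows "is_face (cone_gen {s}) (cone_gen S)"
proof -
  have "\<forall>t\<in>S - {s}. c t = 0"
    if c: "\<And>t. t \<in> S - {s} \<Longrightarrow> 0 \<le> c t" and mem: "(\<Sum>t\<in>S - {s}. c t *\<^sub>Q t) \<in> rat_vector.span {s}"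
    for c
  proof (rule ccontr)
    assume "\<not> (\<forall>t\<in>S - {s}. c t = 0)"
    then obtain t where t: "t \<in> S - {s}" "0 < c t" using c by force
    obtain k where k: "(\<Sum>t\<in>S - {s}. c t *\<^sub>Q t) = k *\<^sub>Q s"
      using mem by (auto simp: rat_vector.span_singleton)
    \<comment> \<open>For k > 0 division by k makes s redundant. For k \<le> 0 the term of t is the
      negative of an element of the cone, so strong convexity forces t = 0, and 0 is always a
      redundant generator.\<close>
    show False
    proof (cases "0 < k")
      case True
      have "(1 / k) *\<^sub>Q (\<Sum>t\<in>S - {s}. c t *\<^sub>Q t) \<in> cone_gen (S - {s})"
        using c True by (intro cone_gen_scale cone_genI[of _ c]) auto
      moreover have "(1 / k) *\<^sub>Q (\<Sum>t\<in>S - {s}. c t *\<^sub>Q t) = s" using True by (simp add: k)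
      ultimately have "s \<in> cone_gen (S - {s})" by (simp only:)
      then show False using irr[OF s] by blast
    next
      case False
      have "c t *\<^sub>Q t + (\<Sum>u\<in>S - {s} - {t}. c u *\<^sub>Q u) = k *\<^sub>Q s"
        unfolding k[symmetric] using t(1) S(1) by (subst sum.remove[of _ t]) auto
      then have "c t *\<^sub>Q t = - ((\<Sum>u\<in>S - {s} - {t}. c u *\<^sub>Q u) + (- k) *\<^sub>Q s)"
        by (simp add: algebra_simps)
      moreover have "(\<Sum>u\<in>S - {s} - {t}. c u *\<^sub>Q u) + (- k) *\<^sub>Q s \<in> cone_gen S"
        using c s S(1) False
        by (intro cone_gen_add cone_gen_sum cone_gen_scale cone_gen_base) auto
      moreover have "c t *\<^sub>Q t \<in> cone_gen S"
        using t S(1) by (intro cone_gen_scale cone_gen_base) auto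
      ultimately have "c t *\<^sub>Q t = 0"
        using S(2) unfolding strongly_convex_def by blast
      then have "t = 0" using t by simp
      then show False using irr[of t] t(1) by (auto simp: cone_gen_zero)
    qed
  qed
  then obtain m where m: "m \<in> M_rat" "\<And>u. u \<in> rat_vector.span {s} \<Longrightarrow> m u = 0"
      "\<And>t. t \<in> S - {s} \<Longrightarrow> 0 < m t"
    using gordan[of "S - {s}" "rat_vector.span {s}"] S(1) by blast
  have "m s = 0" using m(2) by (simp add: rat_vector.span_base)
  then have "{t\<in>S. m t = 0} = {s}" using m(3) s by force
  moreover have "0 \<le> m t" if "t \<in> S" for t
    using m(3)[of t] \<open>m s = 0\<close> that by (cases "t = s") (auto intro: less_imp_le)
  ultimately show ?thesis using face_of_cone_gen[OF S(1) m(1)] by simp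
qed

text \<open>A generating set of least cardinality is irredundant, so its members span distinct
  extremal rays. There are at least \<open>dim\<close> of them because they span, while the number
  of extremal rays is exactly \<open>dim\<close>; hence no extremal ray is missed.\<close>

lemma simplicial_cone_generators:
  assumes "rational_polyhedral_cone N \<sigma>" "strongly_convex \<sigma>"
    and "finite (extremal_rays \<sigma>)" "card (extremal_rays \<sigma>) = rat_vector.dim \<sigma>"
  obtains S where "finite S" "S \<subseteq> N" "\<sigma> = cone_gen S" "extremal_rays \<sigma> = (\<lambda>s. cone_gen {s}) ` S"
proof -
  define P where "P S \<longleftrightarrow> finite S \<and> S \<subseteq> N \<and> \<sigma> = cone_gen S" for S
  obtain S where S: "P S" and least: "\<And>S'. P S' \<Longrightarrow> card S \<le> card S'"
  proof -
    have "\<exists>S. P S" using assms(1) unfolding rational_polyhedral_cone_def P_def by blast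
    then show thesis using that exists_least_iff[of "\<lambda>k. \<exists>S. P S \<and> card S = k"]
      by (metis linorder_not_less)
  qed
  then have fin: "finite S" and gen: "\<sigma> = cone_gen S" by (auto simp: P_def)
  have irr: "s \<notin> cone_gen (S - {s})" if "s \<in> S" for s
  proof
    assume s: "s \<in> cone_gen (S - {s})"
    have "S \<subseteq> cone_gen (S - {s})" using s fin by (auto intro: cone_gen_base)
    then have "cone_gen S = cone_gen (S - {s})"
      using cone_gen_minimal cone_gen_mono[OF fin, of "S - {s}"] by blast
    then have "P (S - {s})" using S by (auto simp: P_def)
    then show False using least fin that by (meson card_Diff1_less not_le)
  qed
  have nz: "s \<noteq> 0" if "s \<in> S" for s using irr[OF that] cone_gen_zero by metis
  have sub: "(\<lambda>s. cone_gen {s}) ` S \<subseteq> extremal_rays \<sigma>"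
  proof -
    have "rat_vector.dim (cone_gen {s}) = 1" if "s \<in> S" for s
      using nz[OF that] by (simp add: dim_cone_gen rat_vector.dim_eq_card_independent)
    then show ?thesis
      using irredundant_generator_spans_ray[OF fin _ irr] assms(2) gen
      by (auto simp: extremal_rays_def)
  qed
  have "inj_on (\<lambda>s. cone_gen {s}) S"
  proof
    fix s t assume st: "s \<in> S" "t \<in> S" "cone_gen {s} = cone_gen {t}"
    show "s = t"
    proof (rule ccontr)
      assume "s \<noteq> t"
      then have "cone_gen {t} \<subseteq> cone_gen (S - {s})" using fin st by (intro cone_gen_mono) auto
      then show False using irr[OF st(1)] st(3) cone_gen_base[of "{s}" s] by auto
    qed
  qed
  then have "card ((\<lambda>s. cone_gen {s}) ` S) = card S" by (rule card_image)
  moreover have "rat_vector.dim \<sigma> \<le> card S"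
    unfolding gen dim_cone_gen[OF fin]
    using fin rat_vector.span_superset by (intro rat_vector.dim_le_card) auto
  ultimately have "(\<lambda>s. cone_gen {s}) ` S = extremal_rays \<sigma>"
    using card_seteq[OF assms(3) sub] assms(4) by simp
  then show thesis using that[of S] S by (simp add: P_def)
qed

section \<open>Lattices\<close>

text \<open>A predicate on plain sets, so that lattice arguments stay within the type class of
  vectors; group structures appear only where \<open>quot_lattice\<close> and
  \<open>generate\<close> demand them.\<close>

definition add_subgroup :: "'a::ab_group_add set \<Rightarrow> bool" where
  "add_subgroup H \<longleftrightarrow> 0 \<in> H \<and> (\<forall>x\<in>H. \<forall>y\<in>H. x - y \<in> H)"

lemma add_subgroup_simps:
  assumes "add_subgroup H"
  shows "0 \<in> H" "x \<in> H \<Longrightarrow> y \<in> H \<Longrightarrow> x - y \<in> H" "x \<in> H \<Longrightarrow> - x \<in> H"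
    "x \<in> H \<Longrightarrow> y \<in> H \<Longrightarrow> x + y \<in> H"
proof -
  show zero: "0 \<in> H" using assms by (simp add: add_subgroup_def)
  show diff: "x - y \<in> H" if "x \<in> H" "y \<in> H" for x y
    using assms that by (simp add: add_subgroup_def)
  show minus: "- x \<in> H" if "x \<in> H" for x
    using diff[OF zero that] by simp
  show "x + y \<in> H" if "x \<in> H" "y \<in> H" for x y
    using diff[OF that(1) minus[OF that(2)]] by simp
qed

lemma add_subgroup_scale:
  fixes H :: "'v::rat_vector set"
  assumes "add_subgroup H" "x \<in> H"
  shows "rat_of_int k *\<^sub>Q x \<in> H"
proof (induction k rule: int_induct[where k = 0])
  case base
  then show ?case using assms by (simp add: add_subgroup_simps)
next
  case (step1 i)
  then show ?case using assms by (simp add: scaleQ_add_left scaleQ_one add_subgroup_simps)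
next
  case (step2 i)
  then show ?case
    using assms by (simp add: rat_vector.scale_left_diff_distrib scaleQ_one add_subgroup_simps)
qed

lemma add_subgroup_Int_subspace:
  "add_subgroup N \<Longrightarrow> rat_vector.subspace U \<Longrightarrow> add_subgroup (N \<inter> U)"
  by (auto simp: add_subgroup_def rat_vector.subspace_0 rat_vector.subspace_diff)

lemma lattice_add_subgroup:
  assumes "lattice_of_rank N n"
  shows "add_subgroup N"
proof -
  obtain B where N: "N = {\<Sum>b\<in>B. rat_of_int (k b) *\<^sub>Q b | k. True}"
    using assms unfolding lattice_of_rank_def by blast
  show ?thesis
    unfolding add_subgroup_def
  proof (intro conjI ballI)
    show "0 \<in> N" unfolding N by (auto intro!: exI[of _ "\<lambda>_. 0"])
    fix x y assume "x \<in> N" "y \<in> N"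
    then obtain k l where "x = (\<Sum>b\<in>B. rat_of_int (k b) *\<^sub>Q b)" "y = (\<Sum>b\<in>B. rat_of_int (l b) *\<^sub>Q b)"
      unfolding N by blast
    then have "x - y = (\<Sum>b\<in>B. rat_of_int (k b - l b) *\<^sub>Q b)"
      by (simp add: rat_vector.scale_left_diff_distrib sum_subtractf)
    then show "x - y \<in> N" unfolding N by (auto intro!: exI[of _ "\<lambda>b. k b - l b"])
  qed
qed

section \<open>Discreteness of the values of functionals on a lattice\<close>

lemma common_denominator:
  assumes "finite Q"
  obtains k :: int where "0 < k" "\<And>q :: rat. q \<in> Q \<Longrightarrow> of_int k * q \<in> \<int>"
proof -
  have "\<exists>k>0. \<forall>q\<in>Q. rat_of_int k * q \<in> \<int>"
    using assms
  proof (induction Q rule: finite_induct)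
    case empty
    show ?case by (rule exI[of _ 1]) simp
  next
    case (insert q Q)
    obtain k where k: "0 < k" "\<And>q. q \<in> Q \<Longrightarrow> rat_of_int k * q \<in> \<int>" using insert by blast
    obtain a d where q: "q = rat_of_int a / of_int d" "0 < d" by (cases q) (simp add: Fract_of_int_quotient)
    have "rat_of_int (k * d) * q = of_int (k * a)" using q by simp
    moreover have "rat_of_int (k * d) * p \<in> \<int>" if "p \<in> Q" for p
      using Ints_mult[OF Ints_of_int[of d] k(2)[OF that]] by (simp add: ac_simps)
    ultimately show ?case using k q by (intro exI[of _ "k * d"]) (auto simp del: of_int_mult)
  qed
  then show thesis using that by blast
qed

lemma lattice_bounded_denominator:
  assumes "lattice_of_rank N n" "f \<in> M_rat"
  obtains k :: int where "0 < k" "\<And>x. x \<in> N \<Longrightarrow> of_int k * f x \<in> \<int>"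
proof -
  obtain B where B: "finite B" "N = {\<Sum>b\<in>B. rat_of_int (k b) *\<^sub>Q b | k. True}"
    using assms unfolding lattice_of_rank_def by blast
  obtain k :: int where k: "0 < k" "\<And>q. q \<in> f ` B \<Longrightarrow> of_int k * q \<in> \<int>"
    using common_denominator[of "f ` B"] B(1) by blast
  have "of_int k * f x \<in> \<int>" if x: "x \<in> N" for x
  proof -
    obtain l where "x = (\<Sum>b\<in>B. rat_of_int (l b) *\<^sub>Q b)" using x B(2) by auto
    then have "of_int k * f x = (\<Sum>b\<in>B. rat_of_int (l b) * (of_int k * f b))"
      by (simp add: M_rat_simps assms sum_distrib_left ac_simps)
    also have "\<dots> \<in> \<int>" by (intro Ints_sum Ints_mult[OF Ints_of_int] k(2) imageI)
    finally show ?thesis .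
  qed
  then show thesis using k that by blast
qed

text \<open>Division with remainder by the least positive element, which exists because a common
  denominator makes the group discrete.\<close>

lemma cyclic_rat_subgroup:
  fixes H :: "rat set"
  assumes H: "add_subgroup H" "\<exists>x\<in>H. x \<noteq> 0"
    and k: "0 < k" "\<And>x. x \<in> H \<Longrightarrow> of_int k * x \<in> \<int>"
  obtains \<alpha> where "0 < \<alpha>" "H = range (\<lambda>j. of_int j * \<alpha>)"
proof -
  \<comment> \<open>The numbers p are the numerators over k of the positive elements of H. All of
    these are positive integers, so a least one exists.\<close>
  define P where "P p \<longleftrightarrow> 0 < p \<and> rat_of_nat p / of_int k \<in> H" for p
  have P: "P (nat \<lfloor>of_int k * x\<rfloor>)" "rat_of_nat (nat \<lfloor>of_int k * x\<rfloor>) = of_int k * x" if x: "x \<in> H" "0 < x" for x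
  proof -
    obtain j where j: "of_int k * x = of_int j" using k(2)[OF x(1)] by (elim Ints_cases)
    then have "0 < j" using k(1) x(2) by (metis mult_pos_pos of_int_0_less_iff)
    moreover have "x = of_int j / of_int k" using j k(1) by (simp add: field_simps)
    ultimately show "P (nat \<lfloor>of_int k * x\<rfloor>)" "rat_of_nat (nat \<lfloor>of_int k * x\<rfloor>) = of_int k * x"
      unfolding P_def j using x(1) by simp_all
  qed
  obtain x where "x \<in> H" "0 < x"
    using H add_subgroup_simps(3)[OF H(1)] by (metis neg_0_less_iff_less linorder_neqE)
  then have "\<exists>p. P p" using P by blast
  define p where "p = (LEAST p. P p)"
  have p: "P p" unfolding p_def using \<open>\<exists>p. P p\<close> by (rule LeastI_ex)
  define \<alpha> where "\<alpha> = rat_of_nat p / of_int k"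
  have \<alpha>: "0 < \<alpha>" "\<alpha> \<in> H" using p k(1) by (auto simp: \<alpha>_def P_def)
  have mult: "of_int j * \<alpha> \<in> H" for j
    using add_subgroup_scale[OF H(1) \<alpha>(2)] by (simp add: scaleQ_rat_def)
  have "x \<in> range (\<lambda>j. of_int j * \<alpha>)" if x: "x \<in> H" for x
  proof -
    define y where "y = x - of_int \<lfloor>x / \<alpha>\<rfloor> * \<alpha>"
    have "y \<in> H" unfolding y_def using x mult add_subgroup_simps(2)[OF H(1)] by blast
    have "0 \<le> y" "y < \<alpha>"
      unfolding y_def using \<alpha>(1) floor_divide_lower[of \<alpha> x] floor_divide_upper[of \<alpha> x]
      by (auto simp: algebra_simps)
    have "y = 0"
    proof (rule ccontr)
      assume "y \<noteq> 0"
      then have "0 < y" using \<open>0 \<le> y\<close> by simp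
      then have "p \<le> nat \<lfloor>of_int k * y\<rfloor>"
        unfolding p_def using P(1)[OF \<open>y \<in> H\<close>] by (intro Least_le)
      then have "rat_of_nat p \<le> of_int k * y"
        using P(2)[OF \<open>y \<in> H\<close> \<open>0 < y\<close>] of_nat_le_iff by metis
      then have "\<alpha> \<le> y" using k(1) by (simp add: \<alpha>_def divide_le_eq ac_simps)
      then show False using \<open>y < \<alpha>\<close> by simp
    qed
    then show ?thesis unfolding y_def by auto
  qed
  then have "H = range (\<lambda>j. of_int j * \<alpha>)" using mult by blast
  then show thesis using that \<alpha>(1) by blast
qed

lemma lattice_image_cyclic:
  assumes "lattice_of_rank N n" "f \<in> M_rat" "H \<subseteq> N" "add_subgroup H" "\<exists>x\<in>H. f x \<noteq> 0"
  obtains \<alpha> where "0 < \<alpha>" "f ` H = range (\<lambda>j. of_int j * \<alpha>)"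
proof -
  obtain k :: int where k: "0 < k" "\<And>x. x \<in> N \<Longrightarrow> of_int k * f x \<in> \<int>"
    using lattice_bounded_denominator assms by blast
  have "add_subgroup (f ` H)"
    unfolding add_subgroup_def
  proof (intro conjI ballI)
    show "0 \<in> f ` H"
      using add_subgroup_simps(1)[OF assms(4)] M_rat_simps(3)[OF assms(2)] by force
    fix x y assume "x \<in> f ` H" "y \<in> f ` H"
    then show "x - y \<in> f ` H"
      using add_subgroup_simps(2)[OF assms(4)]
      by (auto simp: M_rat_simps(5)[OF assms(2), symmetric] intro!: imageI)
  qed
  then show thesis using cyclic_rat_subgroup[of "f ` H" k] k assms that by blast
qed

text \<open>The functional with value 1 at s is the coordinate on the line through s. It maps the
  lattice points there onto the multiples of some \<alpha> > 0, and the preimage of \<alpha> is the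
  first lattice point.\<close>

lemma first_lattice_point_ray:
  assumes N: "lattice_of_rank N n" and s: "s \<in> N" "s \<noteq> 0"
  shows "first_lattice_point N (cone_gen {s}) \<in> N - {0}"
    and "cone_gen {first_lattice_point N (cone_gen {s})} = cone_gen {s}"
proof -
  have "rat_vector.independent {s}" using s by simp
  then obtain f where f: "f \<in> M_rat" "\<And>b. b \<in> {s} \<Longrightarrow> f b = 1"
    by (rule functional_extend[where g = "\<lambda>_. 1"]) blast
  define H where "H = N \<inter> rat_vector.span {s}"
  have H: "add_subgroup H"
    unfolding H_def using lattice_add_subgroup[OF N]
    by (intro add_subgroup_Int_subspace) auto
  have "s \<in> H" using s by (simp add: H_def rat_vector.span_base)
  obtain \<alpha> where \<alpha>: "0 < \<alpha>" "f ` H = range (\<lambda>j. of_int j * \<alpha>)"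
  proof (rule lattice_image_cyclic[OF N f(1) _ H])
    show "H \<subseteq> N" by (simp add: H_def)
    show "\<exists>x\<in>H. f x \<noteq> 0" using \<open>s \<in> H\<close> f(2)[of s] by (auto intro!: bexI[of _ s])
  qed
  have "of_int 1 * \<alpha> \<in> f ` H" unfolding \<alpha>(2) by (rule rangeI)
  then obtain v where v: "v \<in> H" "f v = \<alpha>" by auto
  have H_eq: "x = f x *\<^sub>Q s" if "x \<in> H" for x
    using that f by (auto simp: H_def rat_vector.span_singleton M_rat_simps)
  have v_eq: "v = \<alpha> *\<^sub>Q s" using H_eq v by metis
  have first: "\<exists>q\<ge>1. w = q *\<^sub>Q v" if w: "w \<in> cone_gen {s} \<inter> N - {0}" for w
  proof -
    obtain k where k: "0 \<le> k" "w = k *\<^sub>Q s" using w by (auto simp: cone_gen_singleton)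
    then have "w \<in> H" using w by (auto simp: H_def intro: rat_vector.span_scale rat_vector.span_base)
    moreover have "f w = k" using f k by (simp add: M_rat_simps)
    ultimately obtain j where j: "k = of_int j * \<alpha>" using \<alpha>(2) by blast
    have "0 < k" using k w by (cases "k = 0") auto
    then have "1 \<le> rat_of_int j" unfolding j using \<alpha>(1) by (simp add: zero_less_mult_iff)
    then show ?thesis unfolding k(2) j v_eq by (intro exI[of _ "rat_of_int j"]) (simp add: mult.commute)
  qed
  have v_mem: "v \<in> cone_gen {s} \<inter> N - {0}"
    using v \<alpha>(1) s unfolding H_def v_eq by (auto simp: cone_gen_singleton)
  have "first_lattice_point N (cone_gen {s}) = v"
    unfolding first_lattice_point_def
  proof (rule the_equality)
    show "v \<in> cone_gen {s} \<inter> N - {0} \<and> (\<forall>w\<in>cone_gen {s} \<inter> N - {0}. \<exists>q\<ge>1. w = q *\<^sub>Q v)"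
      using v_mem first by blast
    \<comment> \<open>Two candidates are multiples of each other by factors that are at least 1 and
      have product 1.\<close>
    fix u assume u: "u \<in> cone_gen {s} \<inter> N - {0} \<and> (\<forall>w\<in>cone_gen {s} \<inter> N - {0}. \<exists>q\<ge>1. w = q *\<^sub>Q u)"
    obtain p where p: "1 \<le> p" "u = p *\<^sub>Q v" using first u by blast
    obtain q where q: "1 \<le> q" "v = q *\<^sub>Q u" using u v_mem by blast
    have "(q * p) *\<^sub>Q v = 1 *\<^sub>Q v" using p q by (metis scaleQ_scaleQ scaleQ_one)
    then have "q * p = 1" using v_mem by (simp only: rat_vector.scale_cancel_right) auto
    moreover have "1 * p \<le> q * p" using p q by (intro mult_right_mono) auto
    ultimately have "p = 1" using p by simp
    then show "u = v" using p by simp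
  qed
  moreover have "cone_gen {v} = cone_gen {s}"
  proof
    show "cone_gen {v} \<subseteq> cone_gen {s}" using v_mem by (intro cone_gen_minimal) auto
    have "s = (1 / \<alpha>) *\<^sub>Q v" using v_eq \<alpha>(1) by simp
    then have "s \<in> cone_gen {v}" unfolding cone_gen_singleton using \<alpha>(1) by (metis divide_nonneg_pos zero_le_one)
    then show "cone_gen {s} \<subseteq> cone_gen {v}" by (intro cone_gen_minimal) auto
  qed
  ultimately show "first_lattice_point N (cone_gen {s}) \<in> N - {0}"
    and "cone_gen {first_lattice_point N (cone_gen {s})} = cone_gen {s}"
    using v_mem by auto
qed

section \<open>Quotient lattices\<close>

lemma span_insert_decomp:
  assumes f: "f \<in> M_rat" "f v = 1" "\<And>s. s \<in> S \<Longrightarrow> f s = 0"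
    and x: "x \<in> rat_vector.span (insert v S)"
  shows "x - f x *\<^sub>Q v \<in> rat_vector.span S"
proof -
  obtain k where k: "x - k *\<^sub>Q v \<in> rat_vector.span S"
    using x by (auto simp: rat_vector.span_insert)
  then have "f (x - k *\<^sub>Q v) = 0" using M_rat_zero_on_span[OF f(1)] f(3) by blast
  then have "f x = k" using f by (simp add: M_rat_simps)
  then show ?thesis using k by simp
qed

text \<open>This identifies the lattice of a facet with the kernel of f on the larger lattice, both
  for the quotient and for the covolume comparison.\<close>

lemma span_insert_kernel:
  assumes f: "f \<in> M_rat" "f v = 1" "\<And>s. s \<in> S \<Longrightarrow> f s = 0"
  shows "{x \<in> rat_vector.span (insert v S). f x = 0} = rat_vector.span S"
proof
  show "{x \<in> rat_vector.span (insert v S). f x = 0} \<subseteq> rat_vector.span S"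
  proof
    fix x assume "x \<in> {x \<in> rat_vector.span (insert v S). f x = 0}"
    then show "x \<in> rat_vector.span S" using span_insert_decomp[OF f, where x = x] by simp
  qed
  show "rat_vector.span S \<subseteq> {x \<in> rat_vector.span (insert v S). f x = 0}"
    using rat_vector.span_mono[of S "insert v S"] M_rat_zero_on_span[OF f(1)] f(3) by auto
qed

lemma add_grp_simps [simp]:
  "carrier (add_grp A) = A" "mult (add_grp A) = (+)" "one (add_grp A) = 0"
  by (simp_all add: add_grp_def)

lemma comm_group_add_grp:
  assumes "add_subgroup H"
  shows "comm_group (add_grp H)"
proof (rule comm_groupI)
  fix x assume "x \<in> carrier (add_grp H)"
  then show "\<exists>y\<in>carrier (add_grp H). y \<otimes>\<^bsub>add_grp H\<^esub> x = \<one>\<^bsub>add_grp H\<^esub>"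
    using assms by (intro bexI[of _ "- x"]) (auto simp: add_subgroup_simps)
qed (use assms in \<open>auto simp: add_subgroup_simps ac_simps\<close>)

lemma inv_add_grp:
  assumes "add_subgroup H" "x \<in> H"
  shows "inv\<^bsub>add_grp H\<^esub> x = - x"
proof -
  interpret comm_group "add_grp H" by (rule comm_group_add_grp[OF assms(1)])
  show ?thesis using assms by (intro inv_equality) (auto simp: add_subgroup_simps)
qed

lemma int_pow_add_grp:
  fixes H :: "'v::rat_vector set"
  assumes "add_subgroup H" "x \<in> H"
  shows "x [^]\<^bsub>add_grp H\<^esub> (k::int) = rat_of_int k *\<^sub>Q x"
proof -
  interpret comm_group "add_grp H" by (rule comm_group_add_grp[OF assms(1)])
  have nat: "x [^]\<^bsub>add_grp H\<^esub> (i::nat) = rat_of_nat i *\<^sub>Q x" for i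
    by (induction i) (simp_all add: scaleQ_add_left scaleQ_one)
  show ?thesis
  proof (cases "0 \<le> k")
    case True
    then show ?thesis unfolding int_pow_def2 nat by simp
  next
    case False
    have "inv\<^bsub>add_grp H\<^esub> (rat_of_nat (nat (- k)) *\<^sub>Q x) = - (rat_of_nat (nat (- k)) *\<^sub>Q x)"
      using add_subgroup_scale[OF assms, of "int (nat (- k))"]
      by (intro inv_add_grp[OF assms(1)]) (simp only: of_int_of_nat_eq)
    with False show ?thesis unfolding int_pow_def2 nat by simp
  qed
qed

text \<open>The group generated by the lattice points of a cone is saturated: any lattice point x of
  the span becomes a point of the cone after adding a large lattice point y of the cone, and x = (x
  + y) - y.\<close>

lemma sublattice_cone_gen:
  assumes N: "add_subgroup N" and S: "finite S" "S \<subseteq> N"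
  shows "sublattice N (cone_gen S) = N \<inter> rat_vector.span (cone_gen S)"
proof
  interpret comm_group "add_grp N" by (rule comm_group_add_grp[OF N])
  have sub: "add_subgroup (N \<inter> rat_vector.span (cone_gen S))"
    using N by (rule add_subgroup_Int_subspace) auto
  show "sublattice N (cone_gen S) \<subseteq> N \<inter> rat_vector.span (cone_gen S)"
    unfolding sublattice_def
  proof (rule generate_subgroup_incl)
    show "cone_gen S \<inter> N \<subseteq> N \<inter> rat_vector.span (cone_gen S)"
      by (auto intro: rat_vector.span_base)
    show "subgroup (N \<inter> rat_vector.span (cone_gen S)) (add_grp N)"
      using add_subgroup_simps[OF sub]
      by (intro subgroupI) (auto simp: inv_add_grp[OF N])
  qed
  show "N \<inter> rat_vector.span (cone_gen S) \<subseteq> sublattice N (cone_gen S)"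
  proof
    fix x assume x: "x \<in> N \<inter> rat_vector.span (cone_gen S)"
    then obtain c where c: "x = (\<Sum>s\<in>S. c s *\<^sub>Q s)"
      by (auto simp: span_cone_gen[OF S(1)] rat_vector.span_finite[OF S(1)])
    \<comment> \<open>K bounds all coefficients of x in absolute value, so adding K to each of them
      makes them nonnegative. The inserted 0 covers empty S and gives K \<ge> 0.\<close>
    define K where "K = \<lceil>Max (insert 0 ((\<lambda>s. \<bar>c s\<bar>) ` S))\<rceil>"
    have K: "\<bar>c s\<bar> \<le> of_int K" if "s \<in> S" for s
    proof -
      have "\<bar>c s\<bar> \<le> Max (insert 0 ((\<lambda>s. \<bar>c s\<bar>) ` S))" using that S(1) by (intro Max_ge) auto
      also have "\<dots> \<le> of_int K" unfolding K_def by (rule le_of_int_ceiling)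
      finally show ?thesis .
    qed
    have K0: "0 \<le> rat_of_int K"
    proof -
      have "0 \<le> Max (insert 0 ((\<lambda>s. \<bar>c s\<bar>) ` S))" using S(1) by (intro Max_ge) auto
      also have "\<dots> \<le> of_int K" unfolding K_def by (rule le_of_int_ceiling)
      finally show ?thesis .
    qed
    define y where "y = (\<Sum>s\<in>S. rat_of_int K *\<^sub>Q s)"
    have "y \<in> N" unfolding y_def using S(2)
      by (induction S rule: infinite_finite_induct)
        (auto intro!: add_subgroup_simps[OF N] add_subgroup_scale[OF N])
    have y: "y \<in> cone_gen S \<inter> N"
      using \<open>y \<in> N\<close> K0 unfolding y_def by (auto intro!: cone_genI[of _ "\<lambda>_. of_int K"])
    have "x + y = (\<Sum>s\<in>S. (c s + of_int K) *\<^sub>Q s)"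
      by (simp add: c y_def scaleQ_add_left sum.distrib)
    moreover have "0 \<le> c s + of_int K" if "s \<in> S" for s using K[OF that] by linarith
    ultimately have "x + y \<in> cone_gen S \<inter> N"
      using x \<open>y \<in> N\<close> add_subgroup_simps(4)[OF N, of x y]
      by (auto intro!: cone_genI[of _ "\<lambda>s. c s + of_int K"])
    then have "(x + y) \<otimes>\<^bsub>add_grp N\<^esub> inv\<^bsub>add_grp N\<^esub> y \<in> sublattice N (cone_gen S)"
      unfolding sublattice_def using y by (intro generate.eng generate.incl generate.inv)
    then show "x \<in> sublattice N (cone_gen S)" using \<open>y \<in> N\<close> by (simp add: inv_add_grp[OF N])
  qed
qed

text \<open>The functional \<open>f\<close> identifies \<open>N\<^sub>\<tau> / N\<^sub>\<sigma>\<close> with \<open>\<int>\<alpha>\<close>; the generator on the side of \<open>\<tau>\<close>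
  is the coset on which \<open>f\<close> takes the value \<open>\<alpha>\<close>.\<close>

lemma normal_gen_cone_gen:
  assumes N: "lattice_of_rank N n" and S: "finite S" "insert v S \<subseteq> N"
    and f: "f \<in> M_rat" "f v = 1" "\<And>s. s \<in> S \<Longrightarrow> f s = 0"
  obtains \<alpha> where "0 < \<alpha>"
    and "f ` (N \<inter> rat_vector.span (insert v S)) = range (\<lambda>j. of_int j * \<alpha>)"
    and "normal_gen N (cone_gen (insert v S)) (cone_gen S)
      = {x \<in> N \<inter> rat_vector.span (insert v S). f x = \<alpha>}"
proof -
  have NN: "add_subgroup N" by (rule lattice_add_subgroup[OF N])
  let ?\<tau> = "cone_gen (insert v S)" and ?\<sigma> = "cone_gen S"
  define L where "L = N \<inter> rat_vector.span (insert v S)"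
  define K where "K = N \<inter> rat_vector.span S"
  define Q where "Q = quot_lattice N ?\<tau> ?\<sigma>"
  have L: "add_subgroup L"
    unfolding L_def using NN by (rule add_subgroup_Int_subspace) auto
  have K: "add_subgroup K"
    unfolding K_def using NN by (rule add_subgroup_Int_subspace) auto
  have f_span: "f x = 0" if "x \<in> rat_vector.span S" for x
    using M_rat_zero_on_span[OF f(1) that] f(3) by blast
  have decomp: "x - f x *\<^sub>Q v \<in> rat_vector.span S" if "x \<in> rat_vector.span (insert v S)" for x
    using span_insert_decomp[OF f that] .
  have K_eq: "K = {x \<in> L. f x = 0}"
    unfolding K_def L_def using span_insert_kernel[where S = S, OF f] by blast
  have "v \<in> L" using S by (simp add: L_def rat_vector.span_base)
  obtain \<alpha> where \<alpha>: "0 < \<alpha>" "f ` L = range (\<lambda>j. of_int j * \<alpha>)"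
  proof (rule lattice_image_cyclic[OF N f(1) _ L])
    show "L \<subseteq> N" by (simp add: L_def)
    show "\<exists>x\<in>L. f x \<noteq> 0" using \<open>v \<in> L\<close> f(2) by (auto intro!: bexI[of _ v])
  qed
  have "of_int 1 * \<alpha> \<in> f ` L" unfolding \<alpha>(2) by (rule rangeI)
  then obtain x0 where x0: "x0 \<in> L" "f x0 = \<alpha>" by auto
  interpret L: comm_group "add_grp L" by (rule comm_group_add_grp[OF L])
  \<comment> \<open>Cosets of the kernel of f in L are the level sets of f, so an element of the
    quotient is known by one rational number.\<close>
  define C where "C x = {y \<in> L. f y = f x}" for x
  have KL: "subgroup K (add_grp L)"
    using add_subgroup_simps[OF K] K_eq
    by (intro L.subgroupI) (auto simp: inv_add_grp[OF L])
  have normal: "K \<lhd> add_grp L"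
    using L.subgroup_imp_normal[OF KL] .
  then interpret normal K "add_grp L" .
  have Q: "Q = add_grp L Mod K"
    unfolding Q_def quot_lattice_def L_def K_def
    using sublattice_cone_gen[OF NN, of S] sublattice_cone_gen[OF NN, of "insert v S"] S
    by (simp add: span_cone_gen)
  have coset: "K #>\<^bsub>add_grp L\<^esub> x = C x" if x: "x \<in> L" for x
  proof
    show "K #>\<^bsub>add_grp L\<^esub> x \<subseteq> C x"
      using x K_eq f(1) add_subgroup_simps(4)[OF L]
      by (auto simp: r_coset_def C_def M_rat_simps)
    show "C x \<subseteq> K #>\<^bsub>add_grp L\<^esub> x"
    proof
      fix y assume y: "y \<in> C x"
      then have "y - x \<in> K"
        using x K_eq f(1) add_subgroup_simps(2)[OF L] by (auto simp: C_def M_rat_simps)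
      then show "y \<in> K #>\<^bsub>add_grp L\<^esub> x" by (force simp: r_coset_def)
    qed
  qed
  have carrier_Q: "carrier Q = C ` L"
    unfolding Q by (auto simp: FactGroup_def RCOSETS_def coset)
  have gen: "generate Q {C x} = range (\<lambda>j. C (rat_of_int j *\<^sub>Q x))" if x: "x \<in> L" for x
  proof -
    interpret h: group_hom "add_grp L" Q "\<lambda>x. K #>\<^bsub>add_grp L\<^esub> x"
      unfolding Q using r_coset_hom_Mod factorgroup_is_group L.is_group
      by (simp add: group_hom_def group_hom_axioms_def)
    have "generate (add_grp L) {x} = range (\<lambda>j. rat_of_int j *\<^sub>Q x)"
      using L.generate_pow[of x] x int_pow_add_grp[OF L x] by auto
    then show ?thesis
      using h.generate_img[of "{x}"] x coset add_subgroup_scale[OF L x]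
      by (simp add: image_image)
  qed
  have "normal_gen N ?\<tau> ?\<sigma> = C x0"
    unfolding normal_gen_def Q_def[symmetric]
  proof (rule the_equality)
    have "C y \<in> range (\<lambda>j. C (rat_of_int j *\<^sub>Q x0))" if y: "y \<in> L" for y
    proof -
      obtain j where "f y = of_int j * \<alpha>" using y \<alpha>(2) by blast
      then have "C y = C (rat_of_int j *\<^sub>Q x0)" using f(1) x0(2) by (simp add: C_def M_rat_simps)
      then show ?thesis by blast
    qed
    then have "generate Q {C x0} = carrier Q"
      unfolding gen[OF x0(1)] carrier_Q using add_subgroup_scale[OF L x0(1)] by blast
    moreover have "x0 - \<alpha> *\<^sub>Q v \<in> rat_vector.span ?\<sigma>"
      using decomp[of x0] x0 S(1) by (simp add: span_cone_gen L_def)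
    moreover have "\<alpha> *\<^sub>Q v \<in> ?\<tau>"
      using \<alpha>(1) S(1) by (intro cone_gen_scale cone_gen_base) auto
    ultimately show "C x0 \<in> carrier Q \<and> generate Q {C x0} = carrier Q \<and>
        (\<exists>x\<in>C x0. \<exists>t\<in>?\<tau>. x - t \<in> rat_vector.span ?\<sigma>)"
      using x0(1) carrier_Q by (intro conjI bexI[of _ x0] bexI[of _ "\<alpha> *\<^sub>Q v"]) (auto simp: C_def)
  next
    fix c assume c: "c \<in> carrier Q \<and> generate Q {c} = carrier Q \<and>
        (\<exists>x\<in>c. \<exists>t\<in>?\<tau>. x - t \<in> rat_vector.span ?\<sigma>)"
    then obtain x where x: "x \<in> L" "c = C x" using carrier_Q by blast
    \<comment> \<open>A generating coset has f-value i \<alpha> with j i = 1 for some integer j, so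
      i is 1 or -1. Since f is nonnegative on \<tau>, the condition on the side of \<tau> excludes
      -1.\<close>
    have "C x0 \<in> generate Q {C x}" using c x x0 carrier_Q by blast
    then obtain j where "C x0 = C (rat_of_int j *\<^sub>Q x)" unfolding gen[OF x(1)] by blast
    then have "x0 \<in> C (rat_of_int j *\<^sub>Q x)" using x0 by (auto simp: C_def)
    then have j: "\<alpha> = of_int j * f x" using x0(2) f(1) by (simp add: C_def M_rat_simps)
    obtain i where i: "f x = of_int i * \<alpha>" using x(1) \<alpha>(2) by blast
    have "of_int (j * i) * \<alpha> = of_int j * (of_int i * \<alpha>)" by simp
    also have "\<dots> = 1 * \<alpha>" using i j by (simp only:)
    finally have "of_int (j * i) * \<alpha> = 1 * \<alpha>" .
    then have "j * i = 1" using \<alpha>(1) by (simp only: mult_cancel_right of_int_eq_1_iff) auto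
    obtain y t where y: "y \<in> C x" "t \<in> ?\<tau>" "y - t \<in> rat_vector.span ?\<sigma>" using c x by blast
    then have "f (y - t) = 0" using f_span S(1) by (simp add: span_cone_gen)
    then have "f x = f t" using y(1) f(1) by (simp add: C_def M_rat_simps)
    moreover have "0 \<le> f t"
      using y(2) S(1) f by (elim cone_genE) (auto simp: M_rat_simps intro!: sum_nonneg mult_nonneg_nonneg)
    ultimately have "0 \<le> of_int i * \<alpha>" using i by simp
    then have "0 \<le> i" using \<alpha>(1) by (simp add: zero_le_mult_iff)
    then have "i = 1" using \<open>j * i = 1\<close> by (auto simp: zmult_eq_1_iff)
    then show "c = C x0" using i x(2) x0(2) by (simp add: C_def)
  qed
  then show thesis using that[OF \<alpha>(1)] \<alpha>(2) x0(2) by (simp add: L_def C_def)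
qed

text \<open>Both products are the covolume of the image of \<open>L\<close> under \<open>(f, g)\<close>: a lattice in the plane
  has a basis whose first vector is primitive on a given axis.\<close>

lemma covolume_symmetric:
  fixes f g :: "'a::rat_vector \<Rightarrow> rat"
  assumes L: "add_subgroup L" and fg: "f \<in> M_rat" "g \<in> M_rat"
    and pos: "0 < \<alpha>\<^sub>1" "0 < \<beta>\<^sub>1" "0 < \<alpha>\<^sub>2" "0 < \<beta>\<^sub>2"
    and \<alpha>\<^sub>1: "f ` {x\<in>L. g x = 0} = range (\<lambda>j. of_int j * \<alpha>\<^sub>1)"
    and \<beta>\<^sub>1: "g ` L = range (\<lambda>j. of_int j * \<beta>\<^sub>1)"
    and \<alpha>\<^sub>2: "g ` {x\<in>L. f x = 0} = range (\<lambda>j. of_int j * \<alpha>\<^sub>2)"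
    and \<beta>\<^sub>2: "f ` L = range (\<lambda>j. of_int j * \<beta>\<^sub>2)"
  shows "\<alpha>\<^sub>1 * \<beta>\<^sub>1 = \<alpha>\<^sub>2 * \<beta>\<^sub>2"
proof -
  \<comment> \<open>Divisibility in one direction only; exchanging f and g gives the other, and
    positive numbers dividing each other are equal.\<close>
  have multiple: "\<exists>i. c * d = of_int i * (a * b)"
    if fg: "f \<in> M_rat" "g \<in> M_rat"
      and a: "f ` {x\<in>L. g x = 0} = range (\<lambda>j. of_int j * a)"
      and b: "g ` L = range (\<lambda>j. of_int j * b)"
      and c: "g ` {x\<in>L. f x = 0} = range (\<lambda>j. of_int j * c)"
      and d: "f ` L = range (\<lambda>j. of_int j * d)"
    for f g :: "'a \<Rightarrow> rat" and a b c d
  proof -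
    have one: "x \<in> range (\<lambda>j. of_int j * x)" for x :: rat
      using rangeI[of "\<lambda>j. of_int j * x" 1] by simp
    obtain B where B: "B \<in> L" "g B = b" using one[of b] b by (metis imageE)
    obtain C where C: "C \<in> L" "f C = 0" "g C = c" using one[of c] c[symmetric] by auto
    obtain D where D: "D \<in> L" "f D = d" using one[of d] d by (metis imageE)
    obtain q where q: "g C = of_int q * b" using C b by blast
    obtain s where s: "g D = of_int s * b" using D b by blast
    have mem: "x - rat_of_int j *\<^sub>Q B \<in> L" if "x \<in> L" for x j
      using that B(1) add_subgroup_simps(2)[OF L] add_subgroup_scale[OF L] by blast
    have "C - rat_of_int q *\<^sub>Q B \<in> {x\<in>L. g x = 0}" using mem C q B fg by (simp add: M_rat_simps)
    then obtain p where p: "f (C - rat_of_int q *\<^sub>Q B) = of_int p * a" using a by blast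
    have "D - rat_of_int s *\<^sub>Q B \<in> {x\<in>L. g x = 0}" using mem D s B fg by (simp add: M_rat_simps)
    then obtain r where r: "f (D - rat_of_int s *\<^sub>Q B) = of_int r * a" using a by blast
    have 1: "of_int q * f B = - (of_int p * a)" using p fg C by (simp add: M_rat_simps)
    have 2: "d = of_int r * a + of_int s * f B" using r fg D by (simp add: M_rat_simps)
    \<comment> \<open>Under (f, g), the points C and D have integral coordinates (p, q) and (r, s)
      in the basis consisting of (a, 0) and the image of B. Since f vanishes at C, the product c d
      is the determinant of D and C, hence the coordinate determinant q r - s p times a b.\<close>
    have "c * d = of_int q * b * (of_int r * a) + of_int s * b * (of_int q * f B)"
      using q C 2 by (simp add: algebra_simps)
    also have "\<dots> = of_int (q * r - s * p) * (a * b)" unfolding 1 by (simp add: algebra_simps)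
    finally show ?thesis by blast
  qed
  obtain i where i: "\<alpha>\<^sub>2 * \<beta>\<^sub>2 = of_int i * (\<alpha>\<^sub>1 * \<beta>\<^sub>1)"
    using multiple[OF fg \<alpha>\<^sub>1 \<beta>\<^sub>1 \<alpha>\<^sub>2 \<beta>\<^sub>2] by blast
  obtain j where j: "\<alpha>\<^sub>1 * \<beta>\<^sub>1 = of_int j * (\<alpha>\<^sub>2 * \<beta>\<^sub>2)"
    using multiple[OF fg(2,1) \<alpha>\<^sub>2 \<beta>\<^sub>2 \<alpha>\<^sub>1 \<beta>\<^sub>1] by blast
  have pos': "0 < \<alpha>\<^sub>1 * \<beta>\<^sub>1" "0 < \<alpha>\<^sub>2 * \<beta>\<^sub>2" using pos by simp_all
  have "0 < i" using i pos' by (metis of_int_0_less_iff zero_less_mult_pos2)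
  have "of_int (j * i) * (\<alpha>\<^sub>1 * \<beta>\<^sub>1) = of_int j * (of_int i * (\<alpha>\<^sub>1 * \<beta>\<^sub>1))" by simp
  also have "\<dots> = 1 * (\<alpha>\<^sub>1 * \<beta>\<^sub>1)" using i j by (simp only:)
  finally have "of_int (j * i) * (\<alpha>\<^sub>1 * \<beta>\<^sub>1) = 1 * (\<alpha>\<^sub>1 * \<beta>\<^sub>1)" .
  then have "j * i = 1" using pos'(1) by (simp only: mult_cancel_right of_int_eq_1_iff) auto
  then have "i = 1" using \<open>0 < i\<close> by (auto simp: zmult_eq_1_iff)
  then show ?thesis using i by simp
qed

section \<open>Simplicial fans\<close>

lemma sum_fun_apply: "(\<Sum>a\<in>A. f a) x = (\<Sum>a\<in>A. f a x)"
  by (induction A rule: infinite_finite_induct) simp_all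

text \<open>Restriction to \<open>G\<close> is injective on \<open>W\<close> and lands in a space of
  dimension at most \<open>card G = dim W\<close>, so it reaches every function on \<open>G\<close>:
  an unreached one could be added to the image of a basis, giving too many independent
  vectors.\<close>

lemma functionals_interpolate:
  fixes W :: "('v::rat_vector \<Rightarrow> rat) set"
  assumes W: "rat_vector.subspace W" and G: "finite G" "card G = rat_vector.dim W"
    and inj: "\<And>f. f \<in> W \<Longrightarrow> (\<And>x. x \<in> G \<Longrightarrow> f x = 0) \<Longrightarrow> f = 0"
  obtains f where "f \<in> W" "\<And>x. x \<in> G \<Longrightarrow> f x = g x"
proof -
  interpret p: vector_space_pair "scaleQ :: rat \<Rightarrow> ('v \<Rightarrow> rat) \<Rightarrow> _" "scaleQ :: rat \<Rightarrow> ('v \<Rightarrow> rat) \<Rightarrow> _" ..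
  \<comment> \<open>Restriction is extended by zero outside G, which keeps it a linear endomorphism
    of one function space; its image lies in the span of the indicators of points of G.\<close>
  define r where "r f x = (if x \<in> G then f x else 0)" for f :: "'v \<Rightarrow> rat" and x
  define \<delta> where "\<delta> b x = (if x = b then 1 else 0 :: rat)" for b x :: 'v
  have r: "Vector_Spaces.linear scaleQ scaleQ r"
    unfolding Vector_Spaces.linear_iff
    by (auto simp: r_def fun_eq_iff scaleQ_fun_def scaleQ_rat_def rat_vector.vector_space_axioms)
  have r_span: "r f \<in> rat_vector.span (\<delta> ` G)" for f
  proof -
    have "r f = (\<Sum>b\<in>G. f b *\<^sub>Q \<delta> b)"
    proof
      fix x
      have "(\<Sum>b\<in>G. f b *\<^sub>Q \<delta> b) x = (\<Sum>b\<in>G. if x = b then f b else 0)"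
        by (simp add: sum_fun_apply scaleQ_fun_def scaleQ_rat_def \<delta>_def if_distrib cong: if_cong)
      then show "r f x = (\<Sum>b\<in>G. f b *\<^sub>Q \<delta> b) x" using G(1) by (simp add: r_def)
    qed
    also have "\<dots> \<in> rat_vector.span (\<delta> ` G)"
      by (intro rat_vector.span_sum rat_vector.span_scale rat_vector.span_base imageI)
    finally show ?thesis .
  qed
  obtain B where B: "B \<subseteq> W" "rat_vector.independent B" "W \<subseteq> rat_vector.span B" "card B = card G"
    using rat_vector.basis_exists[of W] G(2) by metis
  have span_B: "rat_vector.span B = W" using B W by (intro rat_vector.span_subspace)
  have inj_r: "inj_on r W"
  proof
    fix f f' assume f: "f \<in> W" "f' \<in> W" "r f = r f'"
    have "f - f' = 0"
    proof (rule inj)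
      show "f - f' \<in> W" using f W by (intro rat_vector.subspace_diff)
      show "(f - f') x = 0" if "x \<in> G" for x using fun_cong[OF f(3), of x] that by (simp add: r_def)
    qed
    then show "f = f'" by simp
  qed
  have ind: "rat_vector.independent (r ` B)"
    using p.linear_independent_injective_image[OF r B(2)] inj_r span_B by simp
  have "r g \<in> rat_vector.span (r ` B)"
  proof (rule ccontr)
    assume not: "r g \<notin> rat_vector.span (r ` B)"
    then have "rat_vector.independent (insert (r g) (r ` B))"
      using ind by (rule rat_vector.independent_insertI)
    then have fin: "finite (insert (r g) (r ` B)) \<and> card (insert (r g) (r ` B)) \<le> card (\<delta> ` G)"
      using r_span G(1) by (intro rat_vector.independent_span_bound) auto
    moreover have "card (insert (r g) (r ` B)) = Suc (card (r ` B))"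
      using fin not rat_vector.span_base[of "r g" "r ` B"] by (intro card_insert_disjoint) auto
    moreover have "card (\<delta> ` G) \<le> card G" using G(1) by (rule card_image_le)
    moreover have "card (r ` B) = card G"
      using card_image[of r B] inj_on_subset[OF inj_r B(1)] B(4) by simp
    ultimately show False by linarith
  qed
  then obtain f where f: "f \<in> W" "r g = r f"
    using p.linear_span_image[OF r, of B] span_B by auto
  have "f x = g x" if "x \<in> G" for x using fun_cong[OF f(2), of x] that by (simp add: r_def)
  then show thesis by (rule that[OF f(1)])
qed

text \<open>The witnesses m and x guarantee uniqueness: on an empty coset every value would satisfy
  the description.\<close>

lemma pairing_eqI:
  assumes "m \<in> C" "x \<in> A" "\<And>m x. m \<in> C \<Longrightarrow> x \<in> A \<Longrightarrow> m x = q"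
  shows "pairing C A = q"
  unfolding pairing_def
proof (rule the_equality)
  show "\<forall>m\<in>C. \<forall>x\<in>A. m x = q" using assms(3) by blast
  show "q' = q" if "\<forall>m\<in>C. \<forall>x\<in>A. m x = q'" for q' using that assms by metis
qed

lemma singleton_cone_gen: "s \<in> cone_gen {s}"
  by (rule cone_gen_base) auto

lemma M_perp_cone_gen:
  assumes "finite S"
  shows "M_perp (cone_gen S) = {m \<in> M_rat. \<forall>s\<in>S. m s = 0}"
  using cone_gen_base[OF assms]
  by (auto simp: M_perp_def M_rat_simps elim!: cone_genE)

section \<open>Cones of a simplicial fan as finite sets of ray vectors\<close>

locale simplicial_fan =
  fixes N :: "'v::rat_vector set" and n :: nat and \<Sigma> :: "'v set set"
  assumes lattice: "lattice_of_rank N n" and is_fan: "fan N \<Sigma>" and is_simplicial: "simplicial \<Sigma>"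
begin

abbreviation ray_gen :: "'v set \<Rightarrow> 'v" where
  "ray_gen \<equiv> first_lattice_point N"

text \<open>Rays are taken from the whole fan and compared by inclusion rather than as faces of
  \<sigma>, which makes monotonicity immediate; \<open>extremal_rays_eq\<close> shows that on cones
  of the fan both readings agree.\<close>

definition gens :: "'v set \<Rightarrow> 'v set" where
  "gens \<sigma> = ray_gen ` {\<rho>\<in>rays \<Sigma>. \<rho> \<subseteq> \<sigma>}"

lemma finite_fan: "finite \<Sigma>"
  using is_fan by (simp add: fan_def)

lemma face_in_fan: "\<sigma> \<in> \<Sigma> \<Longrightarrow> is_face \<tau> \<sigma> \<Longrightarrow> \<tau> \<in> \<Sigma>"
  using is_fan by (auto simp: fan_def)

lemma is_face_iff_subset:
  assumes "\<sigma> \<in> \<Sigma>" "\<tau> \<in> \<Sigma>"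
  shows "is_face \<tau> \<sigma> \<longleftrightarrow> \<tau> \<subseteq> \<sigma>"
proof
  assume "\<tau> \<subseteq> \<sigma>"
  moreover have "is_face (\<sigma> \<inter> \<tau>) \<sigma>" using is_fan assms by (simp add: fan_def)
  ultimately show "is_face \<tau> \<sigma>" by (simp add: Int_absorb1)
qed (rule is_face_subset)

lemma cone_generators:
  assumes "\<sigma> \<in> \<Sigma>"
  obtains S where "finite S" "S \<subseteq> N" "\<sigma> = cone_gen S" "extremal_rays \<sigma> = (\<lambda>s. cone_gen {s}) ` S"
proof (rule simplicial_cone_generators)
  show "rational_polyhedral_cone N \<sigma>" "strongly_convex \<sigma>"
    using assms is_fan by (simp_all add: fan_def)
  show "finite (extremal_rays \<sigma>)"
    using face_in_fan[OF assms] by (intro finite_subset[OF _ finite_fan]) (auto simp: extremal_rays_def)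
  show "card (extremal_rays \<sigma>) = rat_vector.dim \<sigma>"
    using is_simplicial assms by (simp add: simplicial_def)
qed

text \<open>A ray is an extremal ray of itself, and simpliciality in dimension 1 says that it is the
  only one. So the generators found for the cone contain a single vector spanning it, to which the
  lattice computation applies.\<close>

lemma ray_gen:
  assumes "\<rho> \<in> rays \<Sigma>"
  shows "ray_gen \<rho> \<in> N" "ray_gen \<rho> \<noteq> 0" "cone_gen {ray_gen \<rho>} = \<rho>"
proof -
  have \<rho>: "\<rho> \<in> \<Sigma>" "rat_vector.dim \<rho> = 1" using assms by (auto simp: rays_def)
  obtain S where S: "finite S" "S \<subseteq> N" "\<rho> = cone_gen S" "extremal_rays \<rho> = (\<lambda>s. cone_gen {s}) ` S"
    using cone_generators[OF \<rho>(1)] by blast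
  have "\<rho> \<in> extremal_rays \<rho>" using \<rho> by (simp add: extremal_rays_def is_face_refl)
  moreover have "card (extremal_rays \<rho>) = 1" using is_simplicial \<rho> by (simp add: simplicial_def)
  ultimately obtain s where s: "s \<in> S" "\<rho> = cone_gen {s}" using S(4) by auto
  have "s \<noteq> 0"
  proof
    assume "s = 0"
    then have "rat_vector.dim \<rho> = rat_vector.dim (insert 0 {} :: 'v set)"
      using s(2) dim_cone_gen[of "{s}"] by simp
    also have "\<dots> = rat_vector.dim ({} :: 'v set)"
      by (intro rat_vector.span_eq_dim rat_vector.span_insert_0)
    also have "\<dots> = 0" by (simp add: rat_vector.dim_eq_card_independent rat_vector.independent_empty)
    finally show False using \<rho>(2) by simp
  qed
  then show "ray_gen \<rho> \<in> N" "ray_gen \<rho> \<noteq> 0" "cone_gen {ray_gen \<rho>} = \<rho>"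
    using first_lattice_point_ray[OF lattice, of s] s S(2) by auto
qed

lemma inj_ray_gen: "inj_on ray_gen (rays \<Sigma>)"
  by (metis inj_onI ray_gen(3))

lemma finite_rays: "finite (rays \<Sigma>)"
  using finite_fan by (simp add: rays_def)

lemma finite_gens: "finite (gens \<sigma>)"
  using finite_rays by (simp add: gens_def)

lemma gens_subset_lattice: "gens \<sigma> \<subseteq> N"
  using ray_gen(1) by (auto simp: gens_def)

lemma gens_mono: "\<tau> \<subseteq> \<sigma> \<Longrightarrow> gens \<tau> \<subseteq> gens \<sigma>"
  by (auto simp: gens_def)

lemma ray_gen_in_gens_iff:
  assumes "\<rho> \<in> rays \<Sigma>"
  shows "ray_gen \<rho> \<in> gens \<sigma> \<longleftrightarrow> \<rho> \<subseteq> \<sigma>"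
  using assms inj_ray_gen by (auto simp: gens_def inj_on_eq_iff)

lemma extremal_rays_eq:
  assumes "\<sigma> \<in> \<Sigma>"
  shows "extremal_rays \<sigma> = {\<rho>\<in>rays \<Sigma>. \<rho> \<subseteq> \<sigma>}"
  using face_in_fan[OF assms] is_face_iff_subset[OF assms] by (auto simp: extremal_rays_def rays_def)

lemma cone_gen_gens:
  assumes "\<sigma> \<in> \<Sigma>"
  shows "cone_gen (gens \<sigma>) = \<sigma>"
proof -
  obtain S where S: "finite S" "S \<subseteq> N" "\<sigma> = cone_gen S" "extremal_rays \<sigma> = (\<lambda>s. cone_gen {s}) ` S"
    using cone_generators[OF assms] .
  have "\<rho> \<subseteq> cone_gen (gens \<sigma>)" if "\<rho> \<in> extremal_rays \<sigma>" for \<rho>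
  proof -
    have \<rho>: "\<rho> \<in> rays \<Sigma>" "ray_gen \<rho> \<in> gens \<sigma>"
      using that by (auto simp: extremal_rays_eq[OF assms] gens_def)
    then have "cone_gen {ray_gen \<rho>} \<subseteq> cone_gen (gens \<sigma>)"
      using finite_gens by (intro cone_gen_mono) auto
    then show ?thesis using ray_gen(3) \<rho>(1) by simp
  qed
  then have "S \<subseteq> cone_gen (gens \<sigma>)" by (metis S(4) image_eqI singleton_cone_gen subsetD subsetI)
  moreover have "gens \<sigma> \<subseteq> cone_gen S"
    unfolding S(3)[symmetric] gens_def using ray_gen(3) singleton_cone_gen by auto
  ultimately show ?thesis unfolding S(3) using cone_gen_minimal by blast
qed

lemma span_gens:
  assumes "\<sigma> \<in> \<Sigma>"
  shows "rat_vector.span (gens \<sigma>) = rat_vector.span \<sigma>"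
  using span_cone_gen[OF finite_gens] cone_gen_gens[OF assms] by metis

lemma card_gens: "\<sigma> \<in> \<Sigma> \<Longrightarrow> card (gens \<sigma>) = rat_vector.dim \<sigma>"
  using is_simplicial extremal_rays_eq card_image[OF inj_on_subset[OF inj_ray_gen]]
  by (auto simp: gens_def simplicial_def)

text \<open>The ray vectors span a space whose dimension is their number. This is the form of
  simpliciality that provides functionals with arbitrary values on
  \<open>gens \<sigma>\<close>.\<close>

lemma independent_gens:
  assumes "\<sigma> \<in> \<Sigma>"
  shows "rat_vector.independent (gens \<sigma>)"
  using card_gens[OF assms] dim_cone_gen[OF finite_gens, of \<sigma>] cone_gen_gens[OF assms] finite_gens
  by (intro independent_if_card_le_dim) auto

lemma gens_subset_iff:
  assumes "\<sigma> \<in> \<Sigma>" "\<tau> \<in> \<Sigma>"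
  shows "gens \<tau> \<subseteq> gens \<sigma> \<longleftrightarrow> \<tau> \<subseteq> \<sigma>"
  using cone_gen_mono[OF finite_gens, of "gens \<tau>" \<sigma>] gens_mono assms by (auto simp: cone_gen_gens)

lemma gens_inj: "\<sigma> \<in> \<Sigma> \<Longrightarrow> \<tau> \<in> \<Sigma> \<Longrightarrow> gens \<sigma> = gens \<tau> \<Longrightarrow> \<sigma> = \<tau>"
  using cone_gen_gens by metis

text \<open>The subcone is a face by independence, hence a cone of the fan. No further ray of the
  fan can lie in it: such a ray is among the rays of \<sigma> and would depend linearly on
  \<open>G\<close>.\<close>

lemma cone_of_gens_subset:
  assumes \<sigma>: "\<sigma> \<in> \<Sigma>" and G: "G \<subseteq> gens \<sigma>"
  shows "cone_gen G \<in> \<Sigma>" "gens (cone_gen G) = G"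
proof -
  have fin: "finite G" using G finite_gens finite_subset by blast
  show in_fan: "cone_gen G \<in> \<Sigma>"
    using is_face_independent[OF finite_gens independent_gens[OF \<sigma>] G] cone_gen_gens[OF \<sigma>]
      face_in_fan[OF \<sigma>] by simp
  show "gens (cone_gen G) = G"
  proof
    show "gens (cone_gen G) \<subseteq> G"
    proof
      fix s assume s: "s \<in> gens (cone_gen G)"
      have "cone_gen G \<subseteq> \<sigma>" using cone_gen_mono[OF finite_gens G] cone_gen_gens[OF \<sigma>] by simp
      then have "s \<in> gens \<sigma>" using s gens_mono by blast
      have "s \<in> rat_vector.span G"
        using rat_vector.span_base[OF s] span_gens[OF in_fan] span_cone_gen[OF fin] by simp
      show "s \<in> G"
      proof (rule ccontr)
        assume "s \<notin> G"
        then have "rat_vector.span G \<subseteq> rat_vector.span (gens \<sigma> - {s})"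
          using G by (intro rat_vector.span_mono) auto
        then have "rat_vector.dependent (gens \<sigma>)"
          using \<open>s \<in> gens \<sigma>\<close> \<open>s \<in> rat_vector.span G\<close> by (auto simp: rat_vector.dependent_def)
        then show False using independent_gens[OF \<sigma>] by blast
      qed
    qed
    show "G \<subseteq> gens (cone_gen G)"
    proof
      fix s assume "s \<in> G"
      then obtain \<rho> where \<rho>: "\<rho> \<in> rays \<Sigma>" "s = ray_gen \<rho>" using G by (auto simp: gens_def)
      have "cone_gen {s} \<subseteq> cone_gen G" using \<open>s \<in> G\<close> fin by (intro cone_gen_mono) auto
      then show "s \<in> gens (cone_gen G)" using \<rho> ray_gen(3) ray_gen_in_gens_iff by simp
    qed
  qed
qed

lemma zero_in_fan: "{0} \<in> \<Sigma>" and gens_zero: "gens {0} = {}"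
proof -
  obtain \<sigma> where "\<sigma> \<in> \<Sigma>" using is_fan by (auto simp: fan_def)
  then show "{0} \<in> \<Sigma>" "gens {0} = {}"
    using cone_of_gens_subset[of \<sigma> "{}"] by (auto simp: cone_gen_empty)
qed

text \<open>Face inclusion is inclusion of \<open>gens\<close>, and dimension is cardinality, so
  passing from a facet to the cone adds one vector.\<close>

lemma is_facet_iff:
  assumes "\<sigma> \<in> \<Sigma>" "\<tau> \<in> \<Sigma>"
  shows "is_facet \<sigma> \<tau> \<longleftrightarrow> (\<exists>v. v \<notin> gens \<sigma> \<and> gens \<tau> = insert v (gens \<sigma>))"
proof
  assume "is_facet \<sigma> \<tau>"
  then have sub: "gens \<sigma> \<subseteq> gens \<tau>" and "card (gens \<tau>) = card (gens \<sigma>) + 1"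
    using gens_mono assms by (auto simp: is_facet_def card_gens is_face_subset)
  then have "card (gens \<tau> - gens \<sigma>) = 1"
    using card_Diff_subset[OF finite_gens sub] by simp
  then obtain v where "gens \<tau> - gens \<sigma> = {v}" by (auto simp: card_1_singleton_iff)
  then show "\<exists>v. v \<notin> gens \<sigma> \<and> gens \<tau> = insert v (gens \<sigma>)" using sub by blast
next
  assume "\<exists>v. v \<notin> gens \<sigma> \<and> gens \<tau> = insert v (gens \<sigma>)"
  then obtain v where v: "v \<notin> gens \<sigma>" "gens \<tau> = insert v (gens \<sigma>)" by blast
  then have "\<sigma> \<subseteq> \<tau>" using gens_subset_iff assms by blast
  moreover have "card (gens \<tau>) = card (gens \<sigma>) + 1" using v finite_gens by simp
  ultimately show "is_facet \<sigma> \<tau>"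
    using is_face_iff_subset assms by (simp add: is_facet_def card_gens)
qed

lemma M_perp_iff: "\<sigma> \<in> \<Sigma> \<Longrightarrow> M_perp \<sigma> = {m \<in> M_rat. \<forall>w\<in>gens \<sigma>. m w = 0}"
  using M_perp_cone_gen[OF finite_gens] cone_gen_gens by metis

lemma functional_on_gens:
  assumes "\<sigma> \<in> \<Sigma>"
  obtains m where "m \<in> M_rat" "\<And>w. w \<in> gens \<sigma> \<Longrightarrow> m w = g w"
  using functional_extend[OF independent_gens[OF assms]] by metis

text \<open>Elements of the quotient dual spaces thus become assignments of values to ray vectors,
  and restriction to a face forgets some of the values.\<close>

lemma M_perp_coset:
  assumes "\<sigma> \<in> \<Sigma>" "m \<in> M_rat"
  shows "m +o M_perp \<sigma> = {m' \<in> M_rat. \<forall>w\<in>gens \<sigma>. m' w = m w}"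
proof -
  have "m' \<in> m +o M_perp \<sigma>" if "m' \<in> M_rat" "\<forall>w\<in>gens \<sigma>. m' w = m w" for m'
  proof -
    have "m' - m \<in> M_perp \<sigma>" using that assms by (simp add: M_perp_iff M_rat_diff)
    then have "m + (m' - m) \<in> m +o M_perp \<sigma>" by (rule set_plus_intro2)
    then show ?thesis by simp
  qed
  then show ?thesis using assms by (auto simp: elt_set_plus_def M_perp_iff M_rat_add)
qed

subsection \<open>The Cartier divisors of the rays\<close>

text \<open>The local equation of the divisor of \<rho> on \<sigma>, as a coset. If \<rho> does not
  lie in \<sigma>, all prescribed values are 0 and the coset is
  \<open>M_perp \<sigma>\<close>.\<close>

definition ray_equations :: "'v set \<Rightarrow> 'v set \<Rightarrow> ('v \<Rightarrow> rat) set" where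
  "ray_equations \<rho> \<sigma> = {m \<in> M_rat. \<forall>w\<in>gens \<sigma>. m w = (if w = ray_gen \<rho> then 1 else 0)}"

lemma gens_ray: "\<rho> \<in> rays \<Sigma> \<Longrightarrow> gens \<rho> = {ray_gen \<rho>}"
proof -
  assume \<rho>: "\<rho> \<in> rays \<Sigma>"
  then have "card (gens \<rho>) = 1" using card_gens by (simp add: rays_def)
  moreover have "ray_gen \<rho> \<in> gens \<rho>" using \<rho> by (simp add: ray_gen_in_gens_iff)
  ultimately show ?thesis by (auto simp: card_1_singleton_iff)
qed

lemma ray_equations_coset:
  assumes "\<sigma> \<in> \<Sigma>"
  obtains m where "m \<in> ray_equations \<rho> \<sigma>" "ray_equations \<rho> \<sigma> = m +o M_perp \<sigma>"
proof -
  obtain m where m: "m \<in> M_rat" "\<And>w. w \<in> gens \<sigma> \<Longrightarrow> m w = (if w = ray_gen \<rho> then 1 else 0)"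
    using functional_on_gens[OF assms, of "\<lambda>w. if w = ray_gen \<rho> then 1 else 0"] by blast
  then have "m \<in> ray_equations \<rho> \<sigma>" by (simp add: ray_equations_def)
  moreover have "ray_equations \<rho> \<sigma> = m +o M_perp \<sigma>"
    unfolding M_perp_coset[OF assms m(1)] ray_equations_def using m(2) by auto
  ultimately show thesis by (rule that)
qed

lemma M_perp_plus:
  assumes "\<sigma> \<in> \<Sigma>" "\<tau> \<in> \<Sigma>" "\<tau> \<subseteq> \<sigma>"
  shows "M_perp \<sigma> + M_perp \<tau> = M_perp \<tau>"
proof
  have "M_perp \<sigma> \<subseteq> M_perp \<tau>" using assms(3) by (auto simp: M_perp_def)
  then show "M_perp \<sigma> + M_perp \<tau> \<subseteq> M_perp \<tau>"
    by (auto simp: set_plus_def M_perp_def M_rat_add)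
  have "0 \<in> M_perp \<sigma>" by (simp add: M_perp_def M_rat_zero)
  then show "M_perp \<tau> \<subseteq> M_perp \<sigma> + M_perp \<tau>" using set_plus_intro[of 0 "M_perp \<sigma>"] by fastforce
qed

lemma M_restr_coset:
  assumes "\<sigma> \<in> \<Sigma>" "\<tau> \<in> \<Sigma>" "\<tau> \<subseteq> \<sigma>"
  shows "M_restr \<tau> (m +o M_perp \<sigma>) = m +o M_perp \<tau>"
  unfolding M_restr_def using M_perp_plus[OF assms] by (simp add: set_plus_rearrange3)

lemma pairing_M_quot_ray:
  assumes "\<rho> \<in> rays \<Sigma>" "m \<in> M_rat"
  shows "pairing {m' \<in> M_rat. \<forall>w\<in>gens \<rho>. m' w = m w} {ray_gen \<rho>} = m (ray_gen \<rho>)"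
  using assms by (intro pairing_eqI[of m]) (auto simp: gens_ray)

lemma lookup_divisor_cycle:
  assumes "\<rho> \<in> rays \<Sigma>"
  shows "Poly_Mapping.lookup (divisor_cycle N \<Sigma> D) \<rho> = pairing (D \<rho>) {ray_gen \<rho>}"
proof -
  have lk: "Poly_Mapping.lookup (c *\<^sub>Q V_cycle \<rho>') \<rho> = (if \<rho>' = \<rho> then c else 0)" for c \<rho>'
    by (simp add: scaleQ_poly_mapping_def Poly_Mapping.map.rep_eq V_cycle_def lookup_single
        scaleQ_rat_def when_def)
  show ?thesis using assms finite_rays by (simp add: divisor_cycle_def lookup_sum lk)
qed

text \<open>Injectivity of the cycle map, which gives uniqueness in \<open>ray_divisor\<close>:
  compatibility with restriction carries the values on rays to every cone, where they determine the
  coset.\<close>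

lemma rat_cartier_eqI:
  assumes D: "rat_cartier \<Sigma> D" and D': "rat_cartier \<Sigma> D'"
    and eq: "\<And>\<rho>. \<rho> \<in> rays \<Sigma> \<Longrightarrow> pairing (D \<rho>) {ray_gen \<rho>} = pairing (D' \<rho>) {ray_gen \<rho>}"
  shows "D = D'"
proof
  fix \<sigma>
  show "D \<sigma> = D' \<sigma>"
  proof (cases "\<sigma> \<in> \<Sigma>")
    \<comment> \<open>Outside the fan both divisors are \<open>undefined\<close>, by
      extensionality.\<close>
    case False
    have "D \<in> (\<Pi>\<^sub>E \<sigma>\<in>\<Sigma>. M_quot \<sigma>)" "D' \<in> (\<Pi>\<^sub>E \<sigma>\<in>\<Sigma>. M_quot \<sigma>)"
      using D D' by (simp_all add: rat_cartier_def)
    then show ?thesis using PiE_arb[OF _ False] by metis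
  next
    case \<sigma>: True
    have coset: "\<exists>m\<in>M_rat. D \<sigma> = {m' \<in> M_rat. \<forall>w\<in>gens \<sigma>. m' w = m w} \<and>
        (\<forall>\<rho>\<in>rays \<Sigma>. \<rho> \<subseteq> \<sigma> \<longrightarrow> pairing (D \<rho>) {ray_gen \<rho>} = m (ray_gen \<rho>))"
      if D: "rat_cartier \<Sigma> D" for D
    proof -
      obtain m where m: "m \<in> M_rat" "D \<sigma> = m +o M_perp \<sigma>"
        using D \<sigma> by (auto simp: rat_cartier_def M_quot_def PiE_iff)
      have "pairing (D \<rho>) {ray_gen \<rho>} = m (ray_gen \<rho>)" if \<rho>: "\<rho> \<in> rays \<Sigma>" "\<rho> \<subseteq> \<sigma>" for \<rho>
      proof -
        have "\<rho> \<in> \<Sigma>" using \<rho> by (simp add: rays_def)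
        have "D \<rho> = m +o M_perp \<rho>"
        proof (cases "\<rho> = \<sigma>")
          case False
          then have "proper_face \<rho> \<sigma>"
            using \<rho>(2) \<sigma> \<open>\<rho> \<in> \<Sigma>\<close> is_face_iff_subset by (simp add: proper_face_def)
          then have "D \<rho> = M_restr \<rho> (D \<sigma>)" using D \<sigma> \<open>\<rho> \<in> \<Sigma>\<close> by (simp add: rat_cartier_def)
          then show ?thesis using M_restr_coset \<sigma> \<open>\<rho> \<in> \<Sigma>\<close> \<rho>(2) m(2) by simp
        qed (simp add: m)
        then show ?thesis
          using pairing_M_quot_ray[OF \<rho>(1) m(1)] M_perp_coset[OF \<open>\<rho> \<in> \<Sigma>\<close> m(1)] by simp
      qed
      then show ?thesis using m M_perp_coset[OF \<sigma>] by blast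
    qed
    obtain m where m: "D \<sigma> = {m' \<in> M_rat. \<forall>w\<in>gens \<sigma>. m' w = m w}"
      "\<And>\<rho>. \<rho> \<in> rays \<Sigma> \<Longrightarrow> \<rho> \<subseteq> \<sigma> \<Longrightarrow> pairing (D \<rho>) {ray_gen \<rho>} = m (ray_gen \<rho>)"
      using coset[OF D] by blast
    obtain m' where m': "D' \<sigma> = {m'' \<in> M_rat. \<forall>w\<in>gens \<sigma>. m'' w = m' w}"
      "\<And>\<rho>. \<rho> \<in> rays \<Sigma> \<Longrightarrow> \<rho> \<subseteq> \<sigma> \<Longrightarrow> pairing (D' \<rho>) {ray_gen \<rho>} = m' (ray_gen \<rho>)"
      using coset[OF D'] by blast
    have "m w = m' w" if "w \<in> gens \<sigma>" for w
      using that m(2) m'(2) eq by (auto simp: gens_def)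
    then show ?thesis unfolding m(1) m'(1) by auto
  qed
qed

text \<open>The full isomorphism between divisors and cycles is avoided: one divisor with the right
  cycle is exhibited, and injectivity does the rest.\<close>

lemma ray_divisor_eq:
  assumes \<rho>: "\<rho> \<in> rays \<Sigma>"
  shows "ray_divisor N \<Sigma> \<rho> = restrict (ray_equations \<rho>) \<Sigma>"
proof -
  let ?D = "restrict (ray_equations \<rho>) \<Sigma>"
  have cartier: "rat_cartier \<Sigma> ?D"
    unfolding rat_cartier_def
  proof (intro conjI ballI impI)
    show "?D \<in> (\<Pi>\<^sub>E \<sigma>\<in>\<Sigma>. M_quot \<sigma>)"
      unfolding restrict_PiE_iff
    proof
      fix \<sigma> assume "\<sigma> \<in> \<Sigma>"
      then obtain m where "m \<in> ray_equations \<rho> \<sigma>" "ray_equations \<rho> \<sigma> = m +o M_perp \<sigma>"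
        by (rule ray_equations_coset)
      then show "ray_equations \<rho> \<sigma> \<in> M_quot \<sigma>" by (auto simp: M_quot_def ray_equations_def)
    qed
    fix \<sigma> \<tau> assume \<sigma>\<tau>: "\<sigma> \<in> \<Sigma>" "\<tau> \<in> \<Sigma>" "proper_face \<tau> \<sigma>"
    then have sub: "\<tau> \<subseteq> \<sigma>" by (simp add: proper_face_def is_face_subset)
    obtain m where m: "m \<in> ray_equations \<rho> \<sigma>" "ray_equations \<rho> \<sigma> = m +o M_perp \<sigma>"
      using ray_equations_coset[OF \<sigma>\<tau>(1)] .
    have "m \<in> M_rat" "\<And>w. w \<in> gens \<tau> \<Longrightarrow> m w = (if w = ray_gen \<rho> then 1 else 0)"
      using m(1) gens_mono[OF sub] by (auto simp: ray_equations_def)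
    then have "ray_equations \<rho> \<tau> = m +o M_perp \<tau>"
      unfolding M_perp_coset[OF \<sigma>\<tau>(2) \<open>m \<in> M_rat\<close>] ray_equations_def by auto
    then show "M_restr \<tau> (?D \<sigma>) = ?D \<tau>"
      using \<sigma>\<tau> m(2) M_restr_coset[OF \<sigma>\<tau>(1,2) sub] by simp
  qed
  have pairing: "pairing (?D \<rho>') {ray_gen \<rho>'} = (if \<rho>' = \<rho> then 1 else 0)" if \<rho>': "\<rho>' \<in> rays \<Sigma>" for \<rho>'
  proof -
    have "\<rho>' \<in> \<Sigma>" using \<rho>' by (simp add: rays_def)
    obtain m where "m \<in> ray_equations \<rho> \<rho>'" using ray_equations_coset[OF \<open>\<rho>' \<in> \<Sigma>\<close>] by blast
    then show ?thesis
      using \<open>\<rho>' \<in> \<Sigma>\<close> inj_ray_gen \<rho> \<rho>'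
      by (intro pairing_eqI[of m]) (auto simp: ray_equations_def gens_ray inj_on_eq_iff)
  qed
  have cycle: "divisor_cycle N \<Sigma> ?D = V_cycle \<rho>"
  proof -
    have "divisor_cycle N \<Sigma> ?D = (\<Sum>\<rho>'\<in>rays \<Sigma>. if \<rho>' = \<rho> then V_cycle \<rho> else 0)"
      unfolding divisor_cycle_def
    proof (rule sum.cong[OF refl])
      fix \<rho>' assume "\<rho>' \<in> rays \<Sigma>"
      then show "pairing (?D \<rho>') {ray_gen \<rho>'} *\<^sub>Q V_cycle \<rho>' = (if \<rho>' = \<rho> then V_cycle \<rho> else 0)"
        unfolding pairing[OF \<open>\<rho>' \<in> rays \<Sigma>\<close>] by (simp add: scaleQ_one)
    qed
    then show ?thesis using finite_rays \<rho> by simp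
  qed
  show ?thesis
    unfolding ray_divisor_def
  proof (rule the_equality)
    show "rat_cartier \<Sigma> ?D \<and> divisor_cycle N \<Sigma> ?D = V_cycle \<rho>" using cartier cycle ..
    fix D assume D: "rat_cartier \<Sigma> D \<and> divisor_cycle N \<Sigma> D = V_cycle \<rho>"
    show "D = ?D"
    proof (rule rat_cartier_eqI)
      show "pairing (D \<rho>') {ray_gen \<rho>'} = pairing (?D \<rho>') {ray_gen \<rho>'}" if "\<rho>' \<in> rays \<Sigma>" for \<rho>'
        using D cycle lookup_divisor_cycle[OF that] by metis
    qed (use D cartier in auto)
  qed
qed

end

section \<open>The action of the ray divisors\<close>

lemma lookup_scaleQ: "Poly_Mapping.lookup (c *\<^sub>Q f) k = c *\<^sub>Q Poly_Mapping.lookup f k"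
  by (simp add: scaleQ_poly_mapping_def Poly_Mapping.map.rep_eq when_def)

lemma lookup_V_cycle: "Poly_Mapping.lookup (V_cycle \<sigma>) \<tau> = (if \<tau> = \<sigma> then 1 else 0)"
  by (auto simp: V_cycle_def lookup_single)

locale fan_with_complements = simplicial_fan N n \<Sigma>
  for N :: "'v::rat_vector set" and n \<Sigma> +
  fixes \<Psi> :: "'v set \<Rightarrow> ('v \<Rightarrow> rat) set"
  assumes complements: "choice_of_complements \<Sigma> \<Psi>"
begin

section \<open>Projections along the complements\<close>

lemma complement:
  assumes "\<sigma> \<in> \<Sigma>"
  shows "\<Psi> \<sigma> \<subseteq> M_rat" "rat_vector.subspace (\<Psi> \<sigma>)" "rat_vector.dim (\<Psi> \<sigma>) = rat_vector.dim \<sigma>"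
    "\<Psi> \<sigma> \<inter> M_perp \<sigma> = {0}"
  using complements assms by (auto simp: choice_of_complements_def)

lemma complement_mono:
  assumes "\<sigma> \<in> \<Sigma>" "\<tau> \<in> \<Sigma>" "\<tau> \<subseteq> \<sigma>"
  shows "\<Psi> \<tau> \<subseteq> \<Psi> \<sigma>"
  using complements assms is_face_iff_subset[OF assms(1,2)]
  by (cases "\<tau> = \<sigma>") (auto simp: choice_of_complements_def proper_face_def)

text \<open>An element of \<Psi>(\<sigma>) vanishing on all ray vectors lies in M(\<sigma>), hence
  is 0; since dim \<Psi>(\<sigma>) is the number of ray vectors, injectivity gives
  interpolation.\<close>

lemma complement_interpolate:
  assumes "\<sigma> \<in> \<Sigma>"
  obtains u where "u \<in> \<Psi> \<sigma>" "\<And>w. w \<in> gens \<sigma> \<Longrightarrow> u w = g w"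
proof (rule functionals_interpolate[OF complement(2)[OF assms] finite_gens])
  show "card (gens \<sigma>) = rat_vector.dim (\<Psi> \<sigma>)"
    using card_gens[OF assms] complement(3)[OF assms] by simp
  show "f = 0" if "f \<in> \<Psi> \<sigma>" "\<And>x. x \<in> gens \<sigma> \<Longrightarrow> f x = 0" for f
  proof -
    have "f \<in> \<Psi> \<sigma> \<inter> M_perp \<sigma>"
      using that complement(1)[OF assms] by (auto simp: M_perp_iff[OF assms])
    then show ?thesis using complement(4)[OF assms] by simp
  qed
qed (rule that)

lemma proj_eqI:
  assumes \<sigma>: "\<sigma> \<in> \<Sigma>" and x: "x \<in> M_perp \<sigma>" "m - x \<in> \<Psi> \<sigma>"
  shows "proj \<Psi> \<sigma> m = x"
  unfolding proj_def
proof (rule the_equality)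
  show "x \<in> M_perp \<sigma> \<and> m - x \<in> \<Psi> \<sigma>" using x by simp
  fix y assume y: "y \<in> M_perp \<sigma> \<and> m - y \<in> \<Psi> \<sigma>"
  have "(m - x) - (m - y) \<in> \<Psi> \<sigma>"
    using x y by (intro rat_vector.subspace_diff[of _ "m - x"] complement(2)[OF \<sigma>]) auto
  moreover have "y - x \<in> M_perp \<sigma>"
    using x y by (auto simp: M_perp_iff[OF \<sigma>] M_rat_diff)
  ultimately have "y - x \<in> \<Psi> \<sigma> \<inter> M_perp \<sigma>" by simp
  then show "y = x" using complement(4)[OF \<sigma>] by simp
qed

text \<open>Subtract from m the element of \<Psi>(\<sigma>) with the same values on the ray vectors;
  the difference vanishes on \<sigma>.\<close>

lemma proj:
  assumes \<sigma>: "\<sigma> \<in> \<Sigma>" and m: "m \<in> M_rat"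
  shows "proj \<Psi> \<sigma> m \<in> M_perp \<sigma>" "m - proj \<Psi> \<sigma> m \<in> \<Psi> \<sigma>"
proof -
  obtain u where u: "u \<in> \<Psi> \<sigma>" "\<And>w. w \<in> gens \<sigma> \<Longrightarrow> u w = m w"
    using complement_interpolate[OF \<sigma>] by blast
  have "m - u \<in> M_perp \<sigma>"
    using u m complement(1)[OF \<sigma>] by (auto simp: M_perp_iff[OF \<sigma>] M_rat_diff)
  moreover have "m - (m - u) \<in> \<Psi> \<sigma>" using u(1) by simp
  ultimately show "proj \<Psi> \<sigma> m \<in> M_perp \<sigma>" "m - proj \<Psi> \<sigma> m \<in> \<Psi> \<sigma>"
    using proj_eqI[OF \<sigma>] by simp_all
qed

lemma proj_M_perp: "\<sigma> \<in> \<Sigma> \<Longrightarrow> m \<in> M_perp \<sigma> \<Longrightarrow> proj \<Psi> \<sigma> m = m"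
  using complement(2) by (intro proj_eqI) (auto intro: rat_vector.subspace_0)

text \<open>Here u is the element of \<Psi>(\<tau>) dual to the new ray vector v, so the correction
  kills the value at v. The removed part stays in \<Psi>(\<tau>) because \<Psi>(\<sigma>)
  \<subseteq> \<Psi>(\<tau>). That u does not depend on m is what later makes the correction
  symmetric in the two divisors.\<close>

lemma proj_facet:
  assumes \<sigma>: "\<sigma> \<in> \<Sigma>" and \<tau>: "\<tau> \<in> \<Sigma>" and v: "v \<notin> gens \<sigma>" "gens \<tau> = insert v (gens \<sigma>)"
  obtains u where "\<forall>m\<in>M_rat. proj \<Psi> \<tau> m = proj \<Psi> \<sigma> m - proj \<Psi> \<sigma> m v *\<^sub>Q u"
proof -
  obtain u where u: "u \<in> \<Psi> \<tau>" "\<And>w. w \<in> gens \<tau> \<Longrightarrow> u w = (if w = v then 1 else 0)"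
    using complement_interpolate[OF \<tau>, of "\<lambda>w. if w = v then 1 else 0"] by blast
  have "\<sigma> \<subseteq> \<tau>" using v gens_subset_iff[OF \<tau> \<sigma>] by blast
  have "proj \<Psi> \<tau> m = proj \<Psi> \<sigma> m - proj \<Psi> \<sigma> m v *\<^sub>Q u" if m: "m \<in> M_rat" for m
  proof (rule proj_eqI[OF \<tau>])
    show "proj \<Psi> \<sigma> m - proj \<Psi> \<sigma> m v *\<^sub>Q u \<in> M_perp \<tau>"
      using proj(1)[OF \<sigma> m] u v complement(1)[OF \<tau>]
      by (auto simp: M_perp_iff[OF \<sigma>] M_perp_iff[OF \<tau>] scaleQ_fun_def scaleQ_rat_def
          intro!: M_rat_diff M_rat_scale[unfolded scaleQ_fun_def scaleQ_rat_def])
    have "(m - proj \<Psi> \<sigma> m) + proj \<Psi> \<sigma> m v *\<^sub>Q u \<in> \<Psi> \<tau>"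
      using proj(2)[OF \<sigma> m] complement_mono[OF \<tau> \<sigma> \<open>\<sigma> \<subseteq> \<tau>\<close>] u(1) complement(2)[OF \<tau>]
      by (intro rat_vector.subspace_add rat_vector.subspace_scale) auto
    then show "m - (proj \<Psi> \<sigma> m - proj \<Psi> \<sigma> m v *\<^sub>Q u) \<in> \<Psi> \<tau>" by (simp add: algebra_simps)
  qed
  then show thesis using that by blast
qed

text \<open>The matrix of the divisor of \<rho> in the basis of cones, extended by 0 to pairs that
  are not facets, so that all sums can run over the whole fan.\<close>

definition coeff :: "'v set \<Rightarrow> 'v set \<Rightarrow> 'v set \<Rightarrow> rat" where
  "coeff \<rho> \<sigma> \<tau> = (if \<sigma> \<in> \<Sigma> \<and> \<tau> \<in> \<Sigma> \<and> is_facet \<sigma> \<tau>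
     then pairing (proj \<Psi> \<sigma> ` ray_equations \<rho> \<tau>) (normal_gen N \<tau> \<sigma>) else 0)"

text \<open>A functional p in M(\<sigma>) equals p(v) f on the span of \<tau>, and f is \<alpha> on
  the normal generator. The same \<alpha> serves every \<rho>; it is the reciprocal of a positive
  integer, since v is a lattice point with f(v) = 1.\<close>

lemma coeff_facet:
  assumes \<sigma>: "\<sigma> \<in> \<Sigma>" and \<tau>: "\<tau> \<in> \<Sigma>" and v: "v \<notin> gens \<sigma>" "gens \<tau> = insert v (gens \<sigma>)"
    and f: "f \<in> M_rat" "f v = 1" "\<And>w. w \<in> gens \<sigma> \<Longrightarrow> f w = 0"
  obtains \<alpha> where "0 < \<alpha>" "f ` (N \<inter> rat_vector.span (gens \<tau>)) = range (\<lambda>j. of_int j * \<alpha>)"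
    "\<forall>\<rho>. \<forall>m\<in>ray_equations \<rho> \<tau>. coeff \<rho> \<sigma> \<tau> = \<alpha> * proj \<Psi> \<sigma> m v"
proof -
  have ins: "insert v (gens \<sigma>) \<subseteq> N" using gens_subset_lattice[of \<tau>] v(2) by simp
  obtain \<alpha> where \<alpha>: "0 < \<alpha>" "f ` (N \<inter> rat_vector.span (gens \<tau>)) = range (\<lambda>j. of_int j * \<alpha>)"
    "normal_gen N \<tau> \<sigma> = {x \<in> N \<inter> rat_vector.span (gens \<tau>). f x = \<alpha>}"
    using normal_gen_cone_gen[OF lattice finite_gens ins f]
    unfolding v(2)[symmetric] cone_gen_gens[OF \<sigma>] cone_gen_gens[OF \<tau>] .
  have "coeff \<rho> \<sigma> \<tau> = \<alpha> * proj \<Psi> \<sigma> m v" if m: "m \<in> ray_equations \<rho> \<tau>" for \<rho> m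
  proof -
    have "of_int 1 * \<alpha> \<in> f ` (N \<inter> rat_vector.span (gens \<tau>))" unfolding \<alpha>(2) by (rule rangeI)
    then obtain x0 where x0: "x0 \<in> normal_gen N \<tau> \<sigma>" unfolding \<alpha>(3) by auto
    have m_rat: "m \<in> M_rat" using m by (simp add: ray_equations_def)
    have "pairing (proj \<Psi> \<sigma> ` ray_equations \<rho> \<tau>) (normal_gen N \<tau> \<sigma>) = \<alpha> * proj \<Psi> \<sigma> m v"
    proof (rule pairing_eqI[of "proj \<Psi> \<sigma> m" _ x0])
      fix p x assume "p \<in> proj \<Psi> \<sigma> ` ray_equations \<rho> \<tau>" and x: "x \<in> normal_gen N \<tau> \<sigma>"
      then obtain m' where m': "m' \<in> ray_equations \<rho> \<tau>" "p = proj \<Psi> \<sigma> m'" by blast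
      have m'_rat: "m' \<in> M_rat" using m' by (simp add: ray_equations_def)
      have same: "m' w = m w" if "w \<in> gens \<tau>" for w
        using m m'(1) that by (simp add: ray_equations_def)
      have "m' - m \<in> M_perp \<sigma>"
        using same v(2) m_rat m'_rat by (simp add: M_perp_iff[OF \<sigma>] M_rat_diff)
      moreover note pm = proj[OF \<sigma> m_rat]
      ultimately have "proj \<Psi> \<sigma> m + (m' - m) \<in> M_perp \<sigma>"
        by (auto simp: M_perp_iff[OF \<sigma>] intro!: M_rat_add)
      \<comment> \<open>Local equations differ by an element of M(\<tau>), which lies in M(\<sigma>)
        and is fixed by the projection; so the value at v does not depend on the
        representative.\<close>
      then have p: "p = proj \<Psi> \<sigma> m + (m' - m)"
        unfolding m'(2) using pm(2) by (intro proj_eqI[OF \<sigma>]) (simp_all add: algebra_simps)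
      have perp: "p \<in> M_perp \<sigma>" unfolding m'(2) by (rule proj(1)[OF \<sigma> m'_rat])
      then have "p \<in> M_rat" "\<And>w. w \<in> gens \<sigma> \<Longrightarrow> p w = 0" by (auto simp: M_perp_iff[OF \<sigma>])
      have "p x = (p v *\<^sub>Q f) x"
      proof (rule M_rat_eq_on_span[OF \<open>p \<in> M_rat\<close>])
        show "p v *\<^sub>Q f \<in> M_rat" using f(1) by (rule M_rat_scale)
        show "x \<in> rat_vector.span (gens \<tau>)" using x unfolding \<alpha>(3) by simp
        show "p w = (p v *\<^sub>Q f) w" if "w \<in> gens \<tau>" for w
          using that v(2) f \<open>\<And>w. w \<in> gens \<sigma> \<Longrightarrow> p w = 0\<close>
          by (auto simp: scaleQ_fun_def scaleQ_rat_def)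
      qed
      moreover have "p v = proj \<Psi> \<sigma> m v" using same[of v] v(2) by (simp add: p)
      moreover have "f x = \<alpha>" using x unfolding \<alpha>(3) by simp
      ultimately show "p x = \<alpha> * proj \<Psi> \<sigma> m v" by (simp add: scaleQ_fun_def scaleQ_rat_def)
    qed (use m x0 in auto)
    moreover have "is_facet \<sigma> \<tau>" unfolding is_facet_iff[OF \<sigma> \<tau>] using v by blast
    ultimately show ?thesis using \<sigma> \<tau> by (simp add: coeff_def)
  qed
  then show thesis using that[OF \<alpha>(1,2)] by blast
qed

lemma coeff_nonzero:
  assumes "coeff \<rho> \<sigma> \<tau> \<noteq> 0"
  obtains v where "\<sigma> \<in> \<Sigma>" "\<tau> \<in> \<Sigma>" "v \<notin> gens \<sigma>" "gens \<tau> = insert v (gens \<sigma>)"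
  using assms is_facet_iff by (auto simp: coeff_def split: if_splits)

text \<open>Only the two cones between \<open>\<sigma>\<close> and \<open>\<gamma>\<close> contribute. If \<open>(x, y)\<close> and \<open>(x', y')\<close> are the values
  on the two new rays of the projections along \<open>\<Psi>(\<sigma>)\<close> of local equations for \<open>\<rho>\<close> and \<open>\<rho>'\<close>, then the
  sum is \<open>\<kappa> (x y' + y x' - s x x' - t y y')\<close> with \<open>s\<close> and \<open>t\<close> depending only on \<open>\<Psi>\<close> and the cones.\<close>

lemma coeff_symmetric_flag:
  assumes \<sigma>: "\<sigma> \<in> \<Sigma>" and \<gamma>: "\<gamma> \<in> \<Sigma>" and vw: "v \<notin> gens \<sigma>" "w \<notin> gens \<sigma>" "v \<noteq> w"
    and gens_\<gamma>: "gens \<gamma> = insert v (insert w (gens \<sigma>))"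
  shows "(\<Sum>\<tau>\<in>\<Sigma>. coeff \<rho> \<sigma> \<tau> * coeff \<rho>' \<tau> \<gamma>) = (\<Sum>\<tau>\<in>\<Sigma>. coeff \<rho>' \<sigma> \<tau> * coeff \<rho> \<tau> \<gamma>)"
proof -
  define \<tau>\<^sub>1 where "\<tau>\<^sub>1 = cone_gen (insert v (gens \<sigma>))"
  define \<tau>\<^sub>2 where "\<tau>\<^sub>2 = cone_gen (insert w (gens \<sigma>))"
  have \<tau>\<^sub>1: "\<tau>\<^sub>1 \<in> \<Sigma>" "gens \<tau>\<^sub>1 = insert v (gens \<sigma>)"
    unfolding \<tau>\<^sub>1_def using cone_of_gens_subset[OF \<gamma>, of "insert v (gens \<sigma>)"] gens_\<gamma> by blast+
  have \<tau>\<^sub>2: "\<tau>\<^sub>2 \<in> \<Sigma>" "gens \<tau>\<^sub>2 = insert w (gens \<sigma>)"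
    unfolding \<tau>\<^sub>2_def using cone_of_gens_subset[OF \<gamma>, of "insert w (gens \<sigma>)"] gens_\<gamma> by blast+
  have "\<tau>\<^sub>1 \<noteq> \<tau>\<^sub>2" using \<tau>\<^sub>1(2) \<tau>\<^sub>2(2) vw by auto
  have w\<tau>\<^sub>1: "w \<notin> gens \<tau>\<^sub>1" "gens \<gamma> = insert w (gens \<tau>\<^sub>1)"
    and v\<tau>\<^sub>2: "v \<notin> gens \<tau>\<^sub>2" "gens \<gamma> = insert v (gens \<tau>\<^sub>2)"
    using \<tau>\<^sub>1(2) \<tau>\<^sub>2(2) vw gens_\<gamma> by auto
  have two: "(\<Sum>\<tau>\<in>\<Sigma>. coeff \<rho> \<sigma> \<tau> * coeff \<rho>' \<tau> \<gamma>)
      = coeff \<rho> \<sigma> \<tau>\<^sub>1 * coeff \<rho>' \<tau>\<^sub>1 \<gamma> + coeff \<rho> \<sigma> \<tau>\<^sub>2 * coeff \<rho>' \<tau>\<^sub>2 \<gamma>" for \<rho> \<rho>'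
  proof -
    have "coeff \<rho> \<sigma> \<tau> * coeff \<rho>' \<tau> \<gamma> = 0" if "\<tau> \<in> \<Sigma> - {\<tau>\<^sub>1, \<tau>\<^sub>2}" for \<tau>
    proof (rule ccontr)
      assume "coeff \<rho> \<sigma> \<tau> * coeff \<rho>' \<tau> \<gamma> \<noteq> 0"
      then have "coeff \<rho> \<sigma> \<tau> \<noteq> 0" "coeff \<rho>' \<tau> \<gamma> \<noteq> 0" by auto
      obtain a where a: "a \<notin> gens \<sigma>" "gens \<tau> = insert a (gens \<sigma>)"
        using \<open>coeff \<rho> \<sigma> \<tau> \<noteq> 0\<close> by (rule coeff_nonzero)
      obtain b where b: "gens \<gamma> = insert b (gens \<tau>)"
        using \<open>coeff \<rho>' \<tau> \<gamma> \<noteq> 0\<close> by (rule coeff_nonzero)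
      have "a \<in> insert v (insert w (gens \<sigma>))" using a(2) b gens_\<gamma> by auto
      then have "gens \<tau> = gens \<tau>\<^sub>1 \<or> gens \<tau> = gens \<tau>\<^sub>2" using a \<tau>\<^sub>1(2) \<tau>\<^sub>2(2) by auto
      then have "\<tau> = \<tau>\<^sub>1 \<or> \<tau> = \<tau>\<^sub>2" using that \<tau>\<^sub>1(1) \<tau>\<^sub>2(1) gens_inj by blast
      then show False using that by blast
    qed
    then have "(\<Sum>\<tau>\<in>\<Sigma>. coeff \<rho> \<sigma> \<tau> * coeff \<rho>' \<tau> \<gamma>)
        = (\<Sum>\<tau>\<in>{\<tau>\<^sub>1, \<tau>\<^sub>2}. coeff \<rho> \<sigma> \<tau> * coeff \<rho>' \<tau> \<gamma>)"
      using finite_fan \<tau>\<^sub>1(1) \<tau>\<^sub>2(1) by (intro sum.mono_neutral_right) auto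
    then show ?thesis using \<open>\<tau>\<^sub>1 \<noteq> \<tau>\<^sub>2\<close> by simp
  qed
  \<comment> \<open>f and g are the coordinates along v and w in the span of \<gamma> modulo
    \<sigma>; each serves twice, once for a lower facet pair and once for an upper one.\<close>
  obtain f where f: "f \<in> M_rat" "\<And>x. x \<in> gens \<gamma> \<Longrightarrow> f x = (if x = v then 1 else 0)"
    using functional_on_gens[OF \<gamma>, of "\<lambda>x. if x = v then 1 else 0"] by blast
  obtain g where g: "g \<in> M_rat" "\<And>x. x \<in> gens \<gamma> \<Longrightarrow> g x = (if x = w then 1 else 0)"
    using functional_on_gens[OF \<gamma>, of "\<lambda>x. if x = w then 1 else 0"] by blast
  have fv: "f v = 1" "\<And>x. x \<in> gens \<sigma> \<Longrightarrow> f x = 0" "\<And>x. x \<in> gens \<tau>\<^sub>2 \<Longrightarrow> f x = 0"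
    and gw: "g w = 1" "\<And>x. x \<in> gens \<sigma> \<Longrightarrow> g x = 0" "\<And>x. x \<in> gens \<tau>\<^sub>1 \<Longrightarrow> g x = 0"
    using f(2) g(2) vw \<tau>\<^sub>1(2) \<tau>\<^sub>2(2) gens_\<gamma> by auto
  obtain \<alpha>\<^sub>1 where \<alpha>\<^sub>1: "0 < \<alpha>\<^sub>1" "f ` (N \<inter> rat_vector.span (gens \<tau>\<^sub>1)) = range (\<lambda>j. of_int j * \<alpha>\<^sub>1)"
    "\<forall>\<rho>. \<forall>m\<in>ray_equations \<rho> \<tau>\<^sub>1. coeff \<rho> \<sigma> \<tau>\<^sub>1 = \<alpha>\<^sub>1 * proj \<Psi> \<sigma> m v"
    using coeff_facet[OF \<sigma> \<tau>\<^sub>1(1) vw(1) \<tau>\<^sub>1(2) f(1) fv(1,2)] .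
  obtain \<beta>\<^sub>1 where \<beta>\<^sub>1: "0 < \<beta>\<^sub>1" "g ` (N \<inter> rat_vector.span (gens \<gamma>)) = range (\<lambda>j. of_int j * \<beta>\<^sub>1)"
    "\<forall>\<rho>. \<forall>m\<in>ray_equations \<rho> \<gamma>. coeff \<rho> \<tau>\<^sub>1 \<gamma> = \<beta>\<^sub>1 * proj \<Psi> \<tau>\<^sub>1 m w"
    using coeff_facet[OF \<tau>\<^sub>1(1) \<gamma> w\<tau>\<^sub>1 g(1) gw(1,3)] .
  obtain \<alpha>\<^sub>2 where \<alpha>\<^sub>2: "0 < \<alpha>\<^sub>2" "g ` (N \<inter> rat_vector.span (gens \<tau>\<^sub>2)) = range (\<lambda>j. of_int j * \<alpha>\<^sub>2)"
    "\<forall>\<rho>. \<forall>m\<in>ray_equations \<rho> \<tau>\<^sub>2. coeff \<rho> \<sigma> \<tau>\<^sub>2 = \<alpha>\<^sub>2 * proj \<Psi> \<sigma> m w"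
    using coeff_facet[OF \<sigma> \<tau>\<^sub>2(1) vw(2) \<tau>\<^sub>2(2) g(1) gw(1,2)] .
  obtain \<beta>\<^sub>2 where \<beta>\<^sub>2: "0 < \<beta>\<^sub>2" "f ` (N \<inter> rat_vector.span (gens \<gamma>)) = range (\<lambda>j. of_int j * \<beta>\<^sub>2)"
    "\<forall>\<rho>. \<forall>m\<in>ray_equations \<rho> \<gamma>. coeff \<rho> \<tau>\<^sub>2 \<gamma> = \<beta>\<^sub>2 * proj \<Psi> \<tau>\<^sub>2 m v"
    using coeff_facet[OF \<tau>\<^sub>2(1) \<gamma> v\<tau>\<^sub>2 f(1) fv(1,3)] .
  have \<kappa>: "\<alpha>\<^sub>1 * \<beta>\<^sub>1 = \<alpha>\<^sub>2 * \<beta>\<^sub>2"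
  proof (rule covolume_symmetric)
    show "add_subgroup (N \<inter> rat_vector.span (gens \<gamma>))"
      using lattice_add_subgroup[OF lattice] by (rule add_subgroup_Int_subspace) auto
    \<comment> \<open>The lattice of \<open>\<tau>\<^sub>1\<close> is the kernel of g in that of
      \<gamma>, so \<open>\<alpha>\<^sub>1\<close> measures the axis g = 0 and
      \<open>\<beta>\<^sub>1\<close> the projection onto the other axis.\<close>
    have "{x \<in> N \<inter> rat_vector.span (gens \<gamma>). g x = 0} = N \<inter> rat_vector.span (gens \<tau>\<^sub>1)"
      using span_insert_kernel[where S = "gens \<tau>\<^sub>1", OF g(1) gw(1,3)] unfolding w\<tau>\<^sub>1(2) by blast
    then show "f ` {x \<in> N \<inter> rat_vector.span (gens \<gamma>). g x = 0} = range (\<lambda>j. of_int j * \<alpha>\<^sub>1)"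
      using \<alpha>\<^sub>1(2) by simp
    have "{x \<in> N \<inter> rat_vector.span (gens \<gamma>). f x = 0} = N \<inter> rat_vector.span (gens \<tau>\<^sub>2)"
      using span_insert_kernel[where S = "gens \<tau>\<^sub>2", OF f(1) fv(1,3)] unfolding v\<tau>\<^sub>2(2) by blast
    then show "g ` {x \<in> N \<inter> rat_vector.span (gens \<gamma>). f x = 0} = range (\<lambda>j. of_int j * \<alpha>\<^sub>2)"
      using \<alpha>\<^sub>2(2) by simp
  qed (use f(1) g(1) \<alpha>\<^sub>1(1) \<beta>\<^sub>1(1,2) \<alpha>\<^sub>2(1) \<beta>\<^sub>2(1,2) in auto)
  obtain u\<^sub>1 where u\<^sub>1: "\<forall>m\<in>M_rat. proj \<Psi> \<tau>\<^sub>1 m = proj \<Psi> \<sigma> m - proj \<Psi> \<sigma> m v *\<^sub>Q u\<^sub>1"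
    using proj_facet[OF \<sigma> \<tau>\<^sub>1(1) vw(1) \<tau>\<^sub>1(2)] .
  obtain u\<^sub>2 where u\<^sub>2: "\<forall>m\<in>M_rat. proj \<Psi> \<tau>\<^sub>2 m = proj \<Psi> \<sigma> m - proj \<Psi> \<sigma> m w *\<^sub>Q u\<^sub>2"
    using proj_facet[OF \<sigma> \<tau>\<^sub>2(1) vw(2) \<tau>\<^sub>2(2)] .
  \<comment> \<open>One local equation on \<gamma> restricts to both intermediate cones, so all four
    coefficients are expressed by its two projected values.\<close>
  have coeffs: "coeff \<rho> \<sigma> \<tau>\<^sub>1 = \<alpha>\<^sub>1 * proj \<Psi> \<sigma> m v" "coeff \<rho> \<sigma> \<tau>\<^sub>2 = \<alpha>\<^sub>2 * proj \<Psi> \<sigma> m w"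
    "coeff \<rho> \<tau>\<^sub>1 \<gamma> = \<beta>\<^sub>1 * (proj \<Psi> \<sigma> m w - proj \<Psi> \<sigma> m v * u\<^sub>1 w)"
    "coeff \<rho> \<tau>\<^sub>2 \<gamma> = \<beta>\<^sub>2 * (proj \<Psi> \<sigma> m v - proj \<Psi> \<sigma> m w * u\<^sub>2 v)"
    if m: "m \<in> ray_equations \<rho> \<gamma>" for \<rho> m
  proof -
    have "m \<in> M_rat" "m \<in> ray_equations \<rho> \<tau>\<^sub>1" "m \<in> ray_equations \<rho> \<tau>\<^sub>2"
      using m \<tau>\<^sub>1(2) \<tau>\<^sub>2(2) gens_\<gamma> by (auto simp: ray_equations_def)
    then show "coeff \<rho> \<sigma> \<tau>\<^sub>1 = \<alpha>\<^sub>1 * proj \<Psi> \<sigma> m v" "coeff \<rho> \<sigma> \<tau>\<^sub>2 = \<alpha>\<^sub>2 * proj \<Psi> \<sigma> m w"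
      "coeff \<rho> \<tau>\<^sub>1 \<gamma> = \<beta>\<^sub>1 * (proj \<Psi> \<sigma> m w - proj \<Psi> \<sigma> m v * u\<^sub>1 w)"
      "coeff \<rho> \<tau>\<^sub>2 \<gamma> = \<beta>\<^sub>2 * (proj \<Psi> \<sigma> m v - proj \<Psi> \<sigma> m w * u\<^sub>2 v)"
      using \<alpha>\<^sub>1(3) \<alpha>\<^sub>2(3) \<beta>\<^sub>1(3) \<beta>\<^sub>2(3) m u\<^sub>1 u\<^sub>2
      by (simp_all add: scaleQ_fun_def scaleQ_rat_def)
  qed
  obtain m where m: "m \<in> ray_equations \<rho> \<gamma>" using ray_equations_coset[OF \<gamma>] by blast
  obtain m' where m': "m' \<in> ray_equations \<rho>' \<gamma>" using ray_equations_coset[OF \<gamma>] by blast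
  define x y x' y' where "x = proj \<Psi> \<sigma> m v" and "y = proj \<Psi> \<sigma> m w"
    and "x' = proj \<Psi> \<sigma> m' v" and "y' = proj \<Psi> \<sigma> m' w"
  \<comment> \<open>The mixed terms x y' and y x' trade places between the two intermediate cones,
    which is why their lattice factors must agree; the remaining terms are symmetric one by
    one.\<close>
  have "(\<alpha>\<^sub>1 * \<beta>\<^sub>1) * (x * (y' - x' * u\<^sub>1 w)) + (\<alpha>\<^sub>2 * \<beta>\<^sub>2) * (y * (x' - y' * u\<^sub>2 v))
      = (\<alpha>\<^sub>1 * \<beta>\<^sub>1) * (x' * (y - x * u\<^sub>1 w)) + (\<alpha>\<^sub>2 * \<beta>\<^sub>2) * (y' * (x - y * u\<^sub>2 v))"
    unfolding \<kappa> by (simp add: algebra_simps)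
  then show ?thesis
    unfolding two coeffs[OF m] coeffs[OF m'] x_def y_def x'_def y'_def
    by (simp add: ac_simps)
qed

lemma coeff_symmetric:
  "(\<Sum>\<tau>\<in>\<Sigma>. coeff \<rho> \<sigma> \<tau> * coeff \<rho>' \<tau> \<gamma>) = (\<Sum>\<tau>\<in>\<Sigma>. coeff \<rho>' \<sigma> \<tau> * coeff \<rho> \<tau> \<gamma>)"
\<comment> \<open>The case distinction quantifies over the divisors as well, so that in the second
  case every term on either side vanishes.\<close>
proof (cases "\<exists>\<rho> \<rho>' \<tau>. coeff \<rho> \<sigma> \<tau> \<noteq> 0 \<and> coeff \<rho>' \<tau> \<gamma> \<noteq> 0")
  case True
  then obtain \<rho>\<^sub>1 \<rho>\<^sub>2 \<tau> where nz: "coeff \<rho>\<^sub>1 \<sigma> \<tau> \<noteq> 0" "coeff \<rho>\<^sub>2 \<tau> \<gamma> \<noteq> 0" by blast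
  obtain v where v: "\<sigma> \<in> \<Sigma>" "v \<notin> gens \<sigma>" "gens \<tau> = insert v (gens \<sigma>)"
    using nz(1) by (rule coeff_nonzero)
  obtain w where w: "\<gamma> \<in> \<Sigma>" "w \<notin> gens \<tau>" "gens \<gamma> = insert w (gens \<tau>)"
    using nz(2) by (rule coeff_nonzero)
  show ?thesis
    using v w by (intro coeff_symmetric_flag[of \<sigma> \<gamma> w v]) auto
next
  case False
  then have zero: "coeff \<rho> \<sigma> \<tau> * coeff \<rho>' \<tau> \<gamma> = 0" for \<rho> \<rho>' \<tau> by auto
  show ?thesis by (simp only: zero)
qed

section \<open>Ray divisors as operators on cycles\<close>

abbreviation ray_act :: "'v set \<Rightarrow> 'v cyc \<Rightarrow> 'v cyc" where
  "ray_act \<rho> \<equiv> divisor_act N \<Sigma> \<Psi> (ray_divisor N \<Sigma> \<rho>)"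

lemma act_V_ray_divisor:
  assumes "\<rho> \<in> rays \<Sigma>"
  shows "act_V N \<Sigma> \<Psi> (ray_divisor N \<Sigma> \<rho>) \<sigma> = (\<Sum>\<tau>\<in>\<Sigma>. coeff \<rho> \<sigma> \<tau> *\<^sub>Q V_cycle \<tau>)"
proof -
  have "\<sigma> \<in> \<Sigma>" if "\<tau> \<in> \<Sigma>" "is_facet \<sigma> \<tau>" for \<tau>
    using that face_in_fan by (auto simp: is_facet_def)
  then show ?thesis
    unfolding act_V_def ray_divisor_eq[OF assms]
    using finite_fan by (intro sum.mono_neutral_cong_left) (auto simp: coeff_def)
qed

text \<open>Summation over the fan instead of the support of z makes linearity evident. It holds for
  every z, since \<open>coeff\<close> vanishes outside the fan, so later arguments need no
  restriction to a carrier.\<close>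

lemma lookup_ray_act:
  assumes "\<rho> \<in> rays \<Sigma>"
  shows "Poly_Mapping.lookup (ray_act \<rho> z) \<tau> = (\<Sum>\<sigma>\<in>\<Sigma>. Poly_Mapping.lookup z \<sigma> * coeff \<rho> \<sigma> \<tau>)"
proof -
  have outside: "coeff \<rho> \<sigma> \<tau> = 0" if "\<sigma> \<notin> \<Sigma> \<or> \<tau> \<notin> \<Sigma>" for \<sigma> \<tau>
    using that by (auto simp: coeff_def)
  have act: "Poly_Mapping.lookup (act_V N \<Sigma> \<Psi> (ray_divisor N \<Sigma> \<rho>) \<sigma>) \<tau> = coeff \<rho> \<sigma> \<tau>" for \<sigma>
    using finite_fan outside[of \<sigma> \<tau>]
    by (simp add: act_V_ray_divisor[OF assms] lookup_sum lookup_scaleQ lookup_V_cycle scaleQ_rat_def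
        if_distrib cong: if_cong)
  have "Poly_Mapping.lookup (ray_act \<rho> z) \<tau>
      = (\<Sum>\<sigma>\<in>Poly_Mapping.keys z. Poly_Mapping.lookup z \<sigma> * coeff \<rho> \<sigma> \<tau>)"
    by (simp add: divisor_act_def lookup_sum lookup_scaleQ act scaleQ_rat_def)
  also have "\<dots> = (\<Sum>\<sigma>\<in>\<Sigma> \<union> Poly_Mapping.keys z. Poly_Mapping.lookup z \<sigma> * coeff \<rho> \<sigma> \<tau>)"
    using finite_fan by (intro sum.mono_neutral_left) (auto simp: in_keys_iff)
  also have "\<dots> = (\<Sum>\<sigma>\<in>\<Sigma>. Poly_Mapping.lookup z \<sigma> * coeff \<rho> \<sigma> \<tau>)"
    using finite_fan outside by (intro sum.mono_neutral_right) auto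
  finally show ?thesis .
qed

lemma ray_act_add: "\<rho> \<in> rays \<Sigma> \<Longrightarrow> ray_act \<rho> (y + z) = ray_act \<rho> y + ray_act \<rho> z"
  by (rule poly_mapping_eqI) (simp add: lookup_ray_act lookup_add sum.distrib algebra_simps)

lemma ray_act_scale: "\<rho> \<in> rays \<Sigma> \<Longrightarrow> ray_act \<rho> (c *\<^sub>Q z) = c *\<^sub>Q ray_act \<rho> z"
  by (rule poly_mapping_eqI)
    (simp add: lookup_ray_act lookup_scaleQ scaleQ_rat_def sum_distrib_left ac_simps)

lemma keys_ray_act: "\<rho> \<in> rays \<Sigma> \<Longrightarrow> Poly_Mapping.keys (ray_act \<rho> z) \<subseteq> \<Sigma>"
  by (rule subsetI, rule ccontr) (simp add: in_keys_iff lookup_ray_act coeff_def)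

lemma ray_act_commute:
  assumes "\<rho> \<in> rays \<Sigma>" "\<rho>' \<in> rays \<Sigma>"
  shows "ray_act \<rho> (ray_act \<rho>' z) = ray_act \<rho>' (ray_act \<rho> z)"
proof (rule poly_mapping_eqI)
  fix \<gamma>
  have expand: "Poly_Mapping.lookup (ray_act \<rho> (ray_act \<rho>' z)) \<gamma>
      = (\<Sum>\<sigma>\<in>\<Sigma>. Poly_Mapping.lookup z \<sigma> * (\<Sum>\<tau>\<in>\<Sigma>. coeff \<rho>' \<sigma> \<tau> * coeff \<rho> \<tau> \<gamma>))"
    if "\<rho> \<in> rays \<Sigma>" "\<rho>' \<in> rays \<Sigma>" for \<rho> \<rho>'
  proof -
    have "Poly_Mapping.lookup (ray_act \<rho> (ray_act \<rho>' z)) \<gamma>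
      = (\<Sum>\<tau>\<in>\<Sigma>. \<Sum>\<sigma>\<in>\<Sigma>. Poly_Mapping.lookup z \<sigma> * coeff \<rho>' \<sigma> \<tau> * coeff \<rho> \<tau> \<gamma>)"
      using that by (simp add: lookup_ray_act sum_distrib_right)
    also have "\<dots> = (\<Sum>\<sigma>\<in>\<Sigma>. \<Sum>\<tau>\<in>\<Sigma>. Poly_Mapping.lookup z \<sigma> * coeff \<rho>' \<sigma> \<tau> * coeff \<rho> \<tau> \<gamma>)"
      by (rule sum.swap)
    finally show ?thesis by (simp add: sum_distrib_left mult.assoc)
  qed
  show "Poly_Mapping.lookup (ray_act \<rho> (ray_act \<rho>' z)) \<gamma>
      = Poly_Mapping.lookup (ray_act \<rho>' (ray_act \<rho> z)) \<gamma>"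
    unfolding expand[OF assms] expand[OF assms(2,1)] by (simp only: coeff_symmetric[of \<rho>' _ \<rho>])
qed

text \<open>If \<open>\<tau>\<close> is spanned by \<open>\<sigma>\<close> and \<open>\<rho>\<close>, then \<open>\<rho>\<close> acts on \<open>[V(\<sigma>)]\<close> by a nonzero multiple of
  \<open>[V(\<tau>)]\<close>: its local equation vanishes on every other cone having \<open>\<sigma>\<close> as a facet, and already lies
  in \<open>M(\<sigma>)\<close> on \<open>\<tau>\<close>, so that \<open>\<Psi>\<close> does not matter.\<close>

lemma V_cycle_from_facet:
  assumes \<tau>: "\<tau> \<in> \<Sigma>" "gens \<tau> \<noteq> {}"
  obtains \<rho> \<sigma> c where "\<rho> \<in> rays \<Sigma>" "\<sigma> \<in> \<Sigma>" "card (gens \<sigma>) < card (gens \<tau>)"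
    "V_cycle \<tau> = c *\<^sub>Q ray_act \<rho> (V_cycle \<sigma>)"
proof -
  obtain v where v: "v \<in> gens \<tau>" using \<tau>(2) by blast
  obtain \<rho> where \<rho>: "\<rho> \<in> rays \<Sigma>" "v = ray_gen \<rho>" using v by (auto simp: gens_def)
  define \<sigma> where "\<sigma> = cone_gen (gens \<tau> - {v})"
  have \<sigma>: "\<sigma> \<in> \<Sigma>" "gens \<sigma> = gens \<tau> - {v}"
    unfolding \<sigma>_def by (rule cone_of_gens_subset[OF \<tau>(1)], simp)+
  have v\<sigma>: "v \<notin> gens \<sigma>" "gens \<tau> = insert v (gens \<sigma>)" using \<sigma>(2) v by auto
  have vals: "\<exists>\<alpha>>0. coeff \<rho> \<sigma> \<tau>' = \<alpha> * (if w = v then 1 else 0)"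
    if \<tau>': "\<tau>' \<in> \<Sigma>" "w \<notin> gens \<sigma>" "gens \<tau>' = insert w (gens \<sigma>)" for \<tau>' w
  proof -
    obtain m where m: "m \<in> ray_equations \<rho> \<tau>'" using ray_equations_coset[OF \<tau>'(1)] by blast
    have "m \<in> M_perp \<sigma>"
      using m v\<sigma>(1) \<tau>'(3) \<rho>(2) by (auto simp: M_perp_iff[OF \<sigma>(1)] ray_equations_def)
    then have "proj \<Psi> \<sigma> m = m" by (rule proj_M_perp[OF \<sigma>(1)])
    moreover have "m w = (if w = v then 1 else 0)"
      using m \<tau>'(3) \<rho>(2) by (simp add: ray_equations_def)
    moreover obtain f where "f \<in> M_rat" "\<And>x. x \<in> gens \<tau>' \<Longrightarrow> f x = (if x = w then 1 else 0)"
      using functional_on_gens[OF \<tau>'(1), of "\<lambda>x. if x = w then 1 else 0"] by blast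
    ultimately show ?thesis
      using \<tau>' m by (elim coeff_facet[OF \<sigma>(1) \<tau>']) (auto split: if_splits)
  qed
  have other: "coeff \<rho> \<sigma> \<tau>' = 0" if "\<tau>' \<in> \<Sigma>" "\<tau>' \<noteq> \<tau>" for \<tau>'
  proof (rule ccontr)
    assume nz: "coeff \<rho> \<sigma> \<tau>' \<noteq> 0"
    then obtain w where w: "w \<notin> gens \<sigma>" "gens \<tau>' = insert w (gens \<sigma>)" by (rule coeff_nonzero)
    have "w \<noteq> v" using w(2) v\<sigma>(2) gens_inj[OF that(1) \<tau>(1)] that(2) by auto
    then show False using vals[OF that(1) w] nz by auto
  qed
  obtain \<alpha> where \<alpha>: "0 < \<alpha>" "coeff \<rho> \<sigma> \<tau> = \<alpha>" using vals[OF \<tau>(1) v\<sigma>] by auto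
  have "ray_act \<rho> (V_cycle \<sigma>) = \<alpha> *\<^sub>Q V_cycle \<tau>"
  proof (rule poly_mapping_eqI)
    fix \<tau>'
    have "Poly_Mapping.lookup (ray_act \<rho> (V_cycle \<sigma>)) \<tau>' = coeff \<rho> \<sigma> \<tau>'"
      using finite_fan \<sigma>(1) by (simp add: lookup_ray_act[OF \<rho>(1)] lookup_V_cycle if_distrib[of "\<lambda>x. x * _"] cong: if_cong)
    also have "\<dots> = (if \<tau>' = \<tau> then \<alpha> else 0)"
    proof (cases "\<tau>' \<in> \<Sigma>")
      case True
      then show ?thesis using \<alpha>(2) other[of \<tau>'] by simp
    next
      case False
      then show ?thesis using \<tau>(1) by (auto simp: coeff_def)
    qed
    finally show "Poly_Mapping.lookup (ray_act \<rho> (V_cycle \<sigma>)) \<tau>' = Poly_Mapping.lookup (\<alpha> *\<^sub>Q V_cycle \<tau>) \<tau>'"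
      by (simp add: lookup_scaleQ lookup_V_cycle scaleQ_rat_def)
  qed
  then have "V_cycle \<tau> = (1 / \<alpha>) *\<^sub>Q ray_act \<rho> (V_cycle \<sigma>)" using \<alpha>(1) by simp
  moreover have "card (gens \<sigma>) < card (gens \<tau>)" using v\<sigma> finite_gens by simp
  ultimately show thesis using that \<rho>(1) \<sigma>(1) by blast
qed

end

section \<open>Commuting operators\<close>

locale commuting_operators =
  fixes r :: nat and T :: "nat \<Rightarrow> 'z::rat_vector \<Rightarrow> 'z"
  assumes T_add: "i \<in> {1..r} \<Longrightarrow> T i (y + z) = T i y + T i z"
    and T_scale: "i \<in> {1..r} \<Longrightarrow> T i (c *\<^sub>Q z) = c *\<^sub>Q T i z"
    and T_commute: "i \<in> {1..r} \<Longrightarrow> j \<in> {1..r} \<Longrightarrow> T i (T j z) = T j (T i z)"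
begin

lemma funpow_T_add: "i \<in> {1..r} \<Longrightarrow> (T i ^^ k) (y + z) = (T i ^^ k) y + (T i ^^ k) z"
  by (induction k) (simp_all add: T_add)

lemma funpow_T_scale: "i \<in> {1..r} \<Longrightarrow> (T i ^^ k) (c *\<^sub>Q z) = c *\<^sub>Q (T i ^^ k) z"
  by (induction k) (simp_all add: T_scale)

lemma funpow_T_commute:
  assumes "i \<in> {1..r}" "j \<in> {1..r}"
  shows "(T i ^^ k) ((T j ^^ l) z) = (T j ^^ l) ((T i ^^ k) z)"
proof -
  have one: "T i ((T j ^^ l) z) = (T j ^^ l) (T i z)" for z
  proof (induction l)
    case (Suc l)
    show ?case using T_commute[OF assms, of "(T j ^^ l) z"] Suc by simp
  qed simp
  show ?thesis by (induction k) (simp_all add: one)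
qed

lemma foldr_T_add:
  "set xs \<subseteq> {1..r} \<Longrightarrow> foldr (\<lambda>i. T i ^^ e i) xs (y + z) = foldr (\<lambda>i. T i ^^ e i) xs y + foldr (\<lambda>i. T i ^^ e i) xs z"
  by (induction xs) (simp_all add: funpow_T_add)

lemma foldr_T_scale:
  "set xs \<subseteq> {1..r} \<Longrightarrow> foldr (\<lambda>i. T i ^^ e i) xs (c *\<^sub>Q z) = c *\<^sub>Q foldr (\<lambda>i. T i ^^ e i) xs z"
  by (induction xs) (simp_all add: funpow_T_scale)

lemma foldr_T_commute:
  "set xs \<subseteq> {1..r} \<Longrightarrow> j \<in> {1..r} \<Longrightarrow>
    foldr (\<lambda>i. T i ^^ e i) xs ((T j ^^ k) z) = (T j ^^ k) (foldr (\<lambda>i. T i ^^ e i) xs z)"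
  by (induction xs) (simp_all add: funpow_T_commute)

text \<open>The powers at each index split, and the second power at the head of the list is moved
  past the first factors of the tail; this is where commutation makes monomials multiply
  correctly.\<close>

lemma foldr_T_plus:
  "set xs \<subseteq> {1..r} \<Longrightarrow>
    foldr (\<lambda>i. T i ^^ (e i + f i)) xs z = foldr (\<lambda>i. T i ^^ e i) xs (foldr (\<lambda>i. T i ^^ f i) xs z)"
  by (induction xs) (simp_all add: funpow_add foldr_T_commute)

lemma foldr_T_single:
  "distinct xs \<Longrightarrow> foldr (\<lambda>j. T j ^^ (if j = i then 1 else 0)) xs z = (if i \<in> set xs then T i z else z)"
  by (induction xs) auto

lemma set_indices: "set [1..<Suc r] \<subseteq> {1..r}"
  by auto

lemma monom_act_add: "monom_act r T e (y + z) = monom_act r T e y + monom_act r T e z"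
  unfolding monom_act_def by (rule foldr_T_add[OF set_indices])

lemma monom_act_scale: "monom_act r T e (c *\<^sub>Q z) = c *\<^sub>Q monom_act r T e z"
  unfolding monom_act_def by (rule foldr_T_scale[OF set_indices])

lemma monom_act_plus: "monom_act r T (e + f) z = monom_act r T e (monom_act r T f z)"
  unfolding monom_act_def lookup_add by (rule foldr_T_plus[OF set_indices])

lemma monom_act_zero: "monom_act r T 0 z = z"
proof -
  have "foldr (\<lambda>i. T i ^^ 0) xs z = z" for xs by (induction xs) auto
  then show ?thesis by (simp add: monom_act_def)
qed

lemma monom_act_single:
  assumes "i \<in> {1..r}"
  shows "monom_act r T (Poly_Mapping.single i 1) z = T i z"
proof -
  have "(\<lambda>j. T j ^^ Poly_Mapping.lookup (Poly_Mapping.single i 1) j)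
      = (\<lambda>j. T j ^^ (if j = i then 1 else 0))"
    by (auto simp: lookup_single fun_eq_iff)
  moreover have "i \<in> set [1..<Suc r]" using assms by auto
  ultimately show ?thesis unfolding monom_act_def by (simp only: foldr_T_single distinct_upt if_True)
qed

section \<open>From monomials to polynomials\<close>

lemma poly_act_superset:
  assumes "finite A" "Poly_Mapping.keys p \<subseteq> A"
  shows "poly_act r T p z = (\<Sum>e\<in>A. Poly_Mapping.lookup p e *\<^sub>Q monom_act r T e z)"
  unfolding poly_act_def using assms by (intro sum.mono_neutral_left) (auto simp: in_keys_iff)

lemma poly_act_add_left: "poly_act r T (p + q) z = poly_act r T p z + poly_act r T q z"
proof -
  let ?A = "Poly_Mapping.keys p \<union> Poly_Mapping.keys q"
  have "poly_act r T (p + q) z = (\<Sum>e\<in>?A. Poly_Mapping.lookup (p + q) e *\<^sub>Q monom_act r T e z)"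
    by (rule poly_act_superset) (auto dest: subsetD[OF keys_add])
  also have "\<dots> = (\<Sum>e\<in>?A. Poly_Mapping.lookup p e *\<^sub>Q monom_act r T e z)
      + (\<Sum>e\<in>?A. Poly_Mapping.lookup q e *\<^sub>Q monom_act r T e z)"
    by (simp add: lookup_add scaleQ_add_left sum.distrib)
  finally show ?thesis by (simp add: poly_act_superset[of ?A])
qed

lemma poly_act_single: "poly_act r T (Poly_Mapping.single e c) z = c *\<^sub>Q monom_act r T e z"
  by (simp add: poly_act_superset[of "{e}"])

lemma poly_act_zero_left: "poly_act r T 0 z = 0"
  by (simp add: poly_act_def)

lemma poly_act_sum_left: "poly_act r T (\<Sum>a\<in>A. p a) z = (\<Sum>a\<in>A. poly_act r T (p a) z)"
  by (induction A rule: infinite_finite_induct) (simp_all add: poly_act_zero_left poly_act_add_left)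

lemma poly_act_add_right: "poly_act r T p (y + z) = poly_act r T p y + poly_act r T p z"
  by (simp add: poly_act_def monom_act_add scaleQ_add_right sum.distrib)

lemma poly_act_scale_right: "poly_act r T p (c *\<^sub>Q z) = c *\<^sub>Q poly_act r T p z"
  by (simp add: poly_act_def monom_act_scale rat_vector.scale_sum_right ac_simps)

lemma poly_act_zero_right: "poly_act r T p 0 = 0"
  using poly_act_scale_right[of p 0 0] by simp

lemma poly_act_sum_right: "poly_act r T p (\<Sum>a\<in>A. z a) = (\<Sum>a\<in>A. poly_act r T p (z a))"
  by (induction A rule: infinite_finite_induct) (simp_all add: poly_act_zero_right poly_act_add_right)

text \<open>Both factors are expanded into monomials, where \<open>monom_act_plus\<close> applies;
  swapping the sums lets the inner one be read as the action of p on a single term of q.\<close>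

lemma poly_act_mult: "poly_act r T (p * q) z = poly_act r T p (poly_act r T q z)"
proof -
  have decomp: "p = (\<Sum>e\<in>Poly_Mapping.keys p. Poly_Mapping.single e (Poly_Mapping.lookup p e))"
    for p :: rat_mpoly
    by (rule poly_mapping_eqI) (simp add: lookup_sum lookup_single when_def in_keys_iff)
  have "poly_act r T (p * q) z = poly_act r T
      ((\<Sum>e\<in>Poly_Mapping.keys p. Poly_Mapping.single e (Poly_Mapping.lookup p e))
        * (\<Sum>f\<in>Poly_Mapping.keys q. Poly_Mapping.single f (Poly_Mapping.lookup q f))) z"
    using decomp[of p] decomp[of q] by simp
  also have "\<dots> = (\<Sum>e\<in>Poly_Mapping.keys p. \<Sum>f\<in>Poly_Mapping.keys q.
      (Poly_Mapping.lookup p e * Poly_Mapping.lookup q f) *\<^sub>Q monom_act r T e (monom_act r T f z))"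
    by (simp add: sum_product poly_act_sum_left mult_single poly_act_single monom_act_plus)
  also have "\<dots> = (\<Sum>f\<in>Poly_Mapping.keys q. \<Sum>e\<in>Poly_Mapping.keys p.
      (Poly_Mapping.lookup p e * Poly_Mapping.lookup q f) *\<^sub>Q monom_act r T e (monom_act r T f z))"
    by (rule sum.swap)
  also have "\<dots> = (\<Sum>f\<in>Poly_Mapping.keys q.
      poly_act r T p (Poly_Mapping.lookup q f *\<^sub>Q monom_act r T f z))"
    by (simp add: poly_act_scale_right) (simp add: poly_act_def rat_vector.scale_sum_right ac_simps)
  also have "\<dots> = poly_act r T p (poly_act r T q z)"
    unfolding poly_act_sum_right[symmetric] by (simp add: poly_act_def[of r T q])
  finally show ?thesis .
qed

lemma poly_act_one: "poly_act r T 1 z = z"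
  using poly_act_single[of 0 1 z] by (simp add: monom_act_zero scaleQ_one)

lemma poly_act_const: "poly_act r T (const_Y c) z = c *\<^sub>Q z"
  by (simp add: const_Y_def poly_act_single monom_act_zero)

lemma poly_act_var: "i \<in> {1..r} \<Longrightarrow> poly_act r T (var_Y i) z = T i z"
  by (simp add: var_Y_def poly_act_single monom_act_single[simplified] scaleQ_one)

lemma poly_act_invariant:
  assumes U: "rat_vector.subspace U" "\<And>i z. i \<in> {1..r} \<Longrightarrow> z \<in> U \<Longrightarrow> T i z \<in> U" and z: "z \<in> U"
  shows "poly_act r T p z \<in> U"
proof -
  have pow: "(T i ^^ k) z \<in> U" if "i \<in> {1..r}" "z \<in> U" for i k z
    using that by (induction k) (auto intro: U(2))
  have "foldr (\<lambda>i. T i ^^ e i) xs z \<in> U" if "set xs \<subseteq> {1..r}" for e xs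
    using that z by (induction xs) (auto intro: pow)
  then have "monom_act r T e z \<in> U" for e
    unfolding monom_act_def using set_indices by blast
  then show ?thesis
    unfolding poly_act_def using U(1)
    by (intro rat_vector.subspace_sum rat_vector.subspace_scale)
qed

end

section \<open>Polynomial rings and cyclic modules\<close>

lemma poly_ring_Y_simps [simp]:
  "mult (poly_ring_Y r) = (*)" "one (poly_ring_Y r) = 1"
  "zero (poly_ring_Y r) = 0" "add (poly_ring_Y r) = (+)"
  by (simp_all add: poly_ring_Y_def)

lemma carrier_poly_ring_Y:
  "p \<in> carrier (poly_ring_Y r) \<longleftrightarrow> (\<forall>e\<in>Poly_Mapping.keys p. Poly_Mapping.keys e \<subseteq> {1..r})"
  by (simp add: poly_ring_Y_def)

lemma poly_ring_Y_closed:
  "0 \<in> carrier (poly_ring_Y r)" "1 \<in> carrier (poly_ring_Y r)" "const_Y c \<in> carrier (poly_ring_Y r)"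
  "i \<in> {1..r} \<Longrightarrow> var_Y i \<in> carrier (poly_ring_Y r)"
  "p \<in> carrier (poly_ring_Y r) \<Longrightarrow> - p \<in> carrier (poly_ring_Y r)"
  "p \<in> carrier (poly_ring_Y r) \<Longrightarrow> q \<in> carrier (poly_ring_Y r) \<Longrightarrow> p + q \<in> carrier (poly_ring_Y r)"
  "p \<in> carrier (poly_ring_Y r) \<Longrightarrow> q \<in> carrier (poly_ring_Y r) \<Longrightarrow> p * q \<in> carrier (poly_ring_Y r)"
proof -
  show "p + q \<in> carrier (poly_ring_Y r)"
    if "p \<in> carrier (poly_ring_Y r)" "q \<in> carrier (poly_ring_Y r)"
    using that keys_add[of p q] by (auto simp: carrier_poly_ring_Y)
  show "p * q \<in> carrier (poly_ring_Y r)"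
    if "p \<in> carrier (poly_ring_Y r)" "q \<in> carrier (poly_ring_Y r)"
  proof -
    have "Poly_Mapping.keys e \<subseteq> {1..r}" if e: "e \<in> Poly_Mapping.keys (p * q)" for e
    proof -
      obtain a b where ab: "e = a + b" "a \<in> Poly_Mapping.keys p" "b \<in> Poly_Mapping.keys q"
        using e keys_mult[of p q] by blast
      then have "Poly_Mapping.keys a \<subseteq> {1..r}" "Poly_Mapping.keys b \<subseteq> {1..r}"
        using \<open>p \<in> carrier (poly_ring_Y r)\<close> \<open>q \<in> carrier (poly_ring_Y r)\<close>
        by (simp_all add: carrier_poly_ring_Y)
      then show ?thesis using keys_add[of a b] ab(1) by blast
    qed
    then show ?thesis by (simp add: carrier_poly_ring_Y)
  qed
qed (auto simp: carrier_poly_ring_Y const_Y_def var_Y_def in_keys_iff split: if_splits)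

lemma cring_poly_ring_Y: "cring (poly_ring_Y r)"
proof (rule cringI)
  show "abelian_group (poly_ring_Y r)"
  proof (rule abelian_groupI)
    fix p assume "p \<in> carrier (poly_ring_Y r)"
    then show "\<exists>q\<in>carrier (poly_ring_Y r). q \<oplus>\<^bsub>poly_ring_Y r\<^esub> p = \<zero>\<^bsub>poly_ring_Y r\<^esub>"
      by (intro bexI[of _ "- p"]) (auto intro: poly_ring_Y_closed)
  qed (auto simp: poly_ring_Y_closed ac_simps)
  show "comm_monoid (poly_ring_Y r)"
    by (rule comm_monoidI) (auto simp: poly_ring_Y_closed ac_simps)
qed (simp only: poly_ring_Y_simps distrib_right)

text \<open>The annihilator of the generator is the required ideal. The product on the module lifts
  its left factor to a scalar; commutativity of the ring makes the lift irrelevant.\<close>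

lemma cyclic_module_quotient:
  fixes R :: "'a ring" and M :: "('a, 'c) module"
  assumes "Module.module R M" and x: "x \<in> carrier M"
    and cyclic: "(\<lambda>a. a \<odot>\<^bsub>M\<^esub> x) ` carrier R = carrier M"
  shows "\<exists>I \<phi> mul e. ideal I R \<and> \<phi> \<in> module_iso R (quot_module R I) M
    \<and> (\<forall>a\<in>carrier R. \<phi> (I +>\<^bsub>R\<^esub> a) = a \<odot>\<^bsub>M\<^esub> x)
    \<and> cring (M\<lparr>monoid.mult := mul, one := e\<rparr>)
    \<and> \<phi> \<in> ring_iso (R Quot I) (M\<lparr>monoid.mult := mul, one := e\<rparr>)"
proof -
  interpret Module.module R M by (rule assms(1))
  define lift where "lift y = (SOME a. a \<in> carrier R \<and> a \<odot>\<^bsub>M\<^esub> x = y)" for y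
  have lift: "lift y \<in> carrier R" "lift y \<odot>\<^bsub>M\<^esub> x = y" if "y \<in> carrier M" for y
  proof -
    have "\<exists>a. a \<in> carrier R \<and> a \<odot>\<^bsub>M\<^esub> x = y" using that unfolding cyclic[symmetric] by blast
    then have "lift y \<in> carrier R \<and> lift y \<odot>\<^bsub>M\<^esub> x = y" unfolding lift_def by (rule someI_ex)
    then show "lift y \<in> carrier R" "lift y \<odot>\<^bsub>M\<^esub> x = y" by blast+
  qed
  \<comment> \<open>An arbitrary lift is used as scalar. That it can be replaced by any other scalar
    with the same effect on x is the content of \<open>mul\<close>.\<close>
  define mul where "mul y z = lift y \<odot>\<^bsub>M\<^esub> z" for y z
  define S where "S = M\<lparr>monoid.mult := mul, one := x\<rparr>"
  have S: "carrier S = carrier M" "add S = add M" "zero S = zero M" "mult S = mul" "one S = x"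
    by (simp_all add: S_def)
  have mul: "mul (a \<odot>\<^bsub>M\<^esub> x) z = a \<odot>\<^bsub>M\<^esub> z" if a: "a \<in> carrier R" and z: "z \<in> carrier M" for a z
  proof -
    define a' b where "a' = lift (a \<odot>\<^bsub>M\<^esub> x)" and "b = lift z"
    have a': "a' \<in> carrier R" "a' \<odot>\<^bsub>M\<^esub> x = a \<odot>\<^bsub>M\<^esub> x"
      using lift[of "a \<odot>\<^bsub>M\<^esub> x"] a x by (simp_all add: a'_def)
    have b: "b \<in> carrier R" "b \<odot>\<^bsub>M\<^esub> x = z" using lift[OF z] by (simp_all add: b_def)
    \<comment> \<open>With z = b x, acting by c on z is acting by b on c x, hence depends on c only
      through c x.\<close>
    have swap: "c \<odot>\<^bsub>M\<^esub> (b \<odot>\<^bsub>M\<^esub> x) = b \<odot>\<^bsub>M\<^esub> (c \<odot>\<^bsub>M\<^esub> x)" if "c \<in> carrier R" for c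
      using that b(1) x by (simp add: smult_assoc1[symmetric] R.m_comm)
    show ?thesis
      unfolding mul_def a'_def[symmetric] using swap[OF a'(1)] swap[OF a] a'(2) b(2) by simp
  qed
  have reps: "\<exists>a\<in>carrier R. y = a \<odot>\<^bsub>M\<^esub> x" if "y \<in> carrier M" for y
    using that unfolding cyclic[symmetric] by blast
  have abelian: "abelian_group S"
    by (rule abelian_groupI) (auto simp: S M.a_ac intro: bexI[of _ "\<ominus>\<^bsub>M\<^esub> _"] M.l_neg)
  have comm: "comm_monoid S"
  proof (rule comm_monoidI)
    fix y z w assume "y \<in> carrier S" "z \<in> carrier S" "w \<in> carrier S"
    then obtain a b where "a \<in> carrier R" "y = a \<odot>\<^bsub>M\<^esub> x" "b \<in> carrier R" "z = b \<odot>\<^bsub>M\<^esub> x"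
      and w: "w \<in> carrier M"
      using reps S(1) by metis
    then show "(y \<otimes>\<^bsub>S\<^esub> z) \<otimes>\<^bsub>S\<^esub> w = y \<otimes>\<^bsub>S\<^esub> (z \<otimes>\<^bsub>S\<^esub> w)"
      using x mul[of "a \<otimes>\<^bsub>R\<^esub> b" w] by (simp add: S mul smult_assoc1)
  next
    fix y z assume "y \<in> carrier S" "z \<in> carrier S"
    then obtain a b where ab: "a \<in> carrier R" "y = a \<odot>\<^bsub>M\<^esub> x" "b \<in> carrier R" "z = b \<odot>\<^bsub>M\<^esub> x"
      using reps S(1) by metis
    then show "y \<otimes>\<^bsub>S\<^esub> z \<in> carrier S" using x by (simp add: S mul)
    show "y \<otimes>\<^bsub>S\<^esub> z = z \<otimes>\<^bsub>S\<^esub> y"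
      using ab x by (simp add: S mul smult_assoc1[symmetric] R.m_comm)
  next
    fix y assume "y \<in> carrier S"
    then show "\<one>\<^bsub>S\<^esub> \<otimes>\<^bsub>S\<^esub> y = y" using mul[of "\<one>\<^bsub>R\<^esub>" y] x by (simp add: S)
  qed (simp add: S x)
  have cring: "cring S"
  proof (rule cringI[OF abelian comm])
    fix y z w assume "y \<in> carrier S" "z \<in> carrier S" "w \<in> carrier S"
    then obtain a b where "a \<in> carrier R" "y = a \<odot>\<^bsub>M\<^esub> x" "b \<in> carrier R" "z = b \<odot>\<^bsub>M\<^esub> x"
      and w: "w \<in> carrier M"
      using reps S(1) by metis
    then show "(y \<oplus>\<^bsub>S\<^esub> z) \<otimes>\<^bsub>S\<^esub> w = y \<otimes>\<^bsub>S\<^esub> w \<oplus>\<^bsub>S\<^esub> z \<otimes>\<^bsub>S\<^esub> w"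
      using x mul[of "a \<oplus>\<^bsub>R\<^esub> b" w] by (simp add: S mul smult_l_distr)
  qed
  \<comment> \<open>Evaluation at x is a surjective ring homomorphism onto the new ring, so the
    first isomorphism theorem supplies both the ideal and \<phi>.\<close>
  define h where "h a = a \<odot>\<^bsub>M\<^esub> x" for a
  have "h \<in> ring_hom R S"
    using x by (intro ring_hom_memI) (simp_all add: h_def S mul smult_assoc1 smult_l_distr)
  then interpret h: ring_hom_ring R S h
    using R.ring_axioms cring.axioms(1)[OF cring] by (intro ring_hom_ringI2)
  define I where "I = a_kernel R S h"
  define \<phi> where "\<phi> C = the_elem (h ` C)" for C
  have iso: "\<phi> \<in> ring_iso (R Quot I) S"
    unfolding \<phi>_def I_def using cyclic by (intro h.FactRing_iso_set) (simp add: h_def S)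
  have \<phi>: "\<phi> (I +>\<^bsub>R\<^esub> a) = a \<odot>\<^bsub>M\<^esub> x" if "a \<in> carrier R" for a
    unfolding \<phi>_def I_def h.the_elem_simp[OF that] by (simp add: h_def)
  have ideal: "ideal I R" unfolding I_def by (rule h.kernel_is_ideal)
  then interpret I: ideal I R .
  have coset: "I +>\<^bsub>R\<^esub> a \<in> carrier (R Quot I)" if "a \<in> carrier R" for a
    using that by (auto simp: FactRing_def A_RCOSETS_def' a_r_coset_def)
  have "\<phi> \<in> module_iso R (quot_module R I) M"
    unfolding module_iso_def
  proof (intro CollectI conjI ballI)
    show "bij_betw \<phi> (carrier (quot_module R I)) (carrier M)"
      using iso by (simp add: ring_iso_def quot_module_def S)
    fix C assume C: "C \<in> carrier (quot_module R I)"
    then have C': "C \<in> carrier (R Quot I)" by (simp add: quot_module_def)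
    then have \<phi>C: "\<phi> C \<in> carrier M" using ring_iso_memE(1)[OF iso] by (simp add: S)
    show "\<phi> (C \<oplus>\<^bsub>quot_module R I\<^esub> D) = \<phi> C \<oplus>\<^bsub>M\<^esub> \<phi> D" if "D \<in> carrier (quot_module R I)" for D
      using ring_iso_memE(3)[OF iso C', of D] that by (simp add: quot_module_def S)
    show "\<phi> (a \<odot>\<^bsub>quot_module R I\<^esub> C) = a \<odot>\<^bsub>M\<^esub> \<phi> C" if a: "a \<in> carrier R" for a
      using ring_iso_memE(2)[OF iso coset[OF a] C'] \<phi>[OF a] mul[OF a \<phi>C] by (simp add: quot_module_def S)
  qed
  with ideal \<phi> cring iso show ?thesis unfolding S_def by blast
qed

section \<open>Cycles as a cyclic module\<close>

lemma subspace_keys_subset: "rat_vector.subspace {z :: 'k \<Rightarrow>\<^sub>0 rat. Poly_Mapping.keys z \<subseteq> A}"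
proof (rule rat_vector.subspaceI)
  fix y z :: "'k \<Rightarrow>\<^sub>0 rat" assume "y \<in> {z. Poly_Mapping.keys z \<subseteq> A}" "z \<in> {z. Poly_Mapping.keys z \<subseteq> A}"
  then show "y + z \<in> {z. Poly_Mapping.keys z \<subseteq> A}" using keys_add[of y z] by auto
next
  fix c and z :: "'k \<Rightarrow>\<^sub>0 rat" assume "z \<in> {z. Poly_Mapping.keys z \<subseteq> A}"
  then show "c *\<^sub>Q z \<in> {z. Poly_Mapping.keys z \<subseteq> A}"
    by (auto simp: in_keys_iff lookup_scaleQ scaleQ_rat_def)
qed simp

lemma sum_V_cycle:
  assumes "finite A" "Poly_Mapping.keys z \<subseteq> A"
  shows "z = (\<Sum>\<sigma>\<in>A. Poly_Mapping.lookup z \<sigma> *\<^sub>Q V_cycle \<sigma>)"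
  using assms
  by (intro poly_mapping_eqI)
    (auto simp: lookup_sum lookup_scaleQ lookup_V_cycle scaleQ_rat_def if_distrib in_keys_iff cong: if_cong)

context simplicial_fan
begin

lemma dim_le_rank: "rat_vector.dim (\<sigma> :: 'v set) \<le> n"
proof -
  obtain B :: "'v set" where "finite B" "card B = n" "rat_vector.span B = UNIV"
    using lattice unfolding lattice_of_rank_def by blast
  then show ?thesis using rat_vector.dim_le_card[of \<sigma> B] by simp
qed

text \<open>The grading only sorts basis cycles by codimension. The truncated difference n - dim
  \<sigma> in the proof is a true one by \<open>dim_le_rank\<close>, so every cone lands in some
  degree k \<le> n.\<close>

lemma Z_star_eq: "Z_star n \<Sigma> = {z. Poly_Mapping.keys z \<subseteq> \<Sigma>}"
proof
  have sub: "Z_cycles n \<Sigma> k \<subseteq> {z. Poly_Mapping.keys z \<subseteq> \<Sigma>}" for k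
    unfolding Z_cycles_def
    by (intro rat_vector.span_minimal subspace_keys_subset) (auto simp: V_cycle_def)
  show "Z_star n \<Sigma> \<subseteq> {z. Poly_Mapping.keys z \<subseteq> \<Sigma>}"
  proof
    fix z :: "'v cyc" assume "z \<in> Z_star n \<Sigma>"
    then obtain y where y: "z = (\<Sum>k\<le>n. y k)" "\<And>k. k \<le> n \<Longrightarrow> y k \<in> Z_cycles n \<Sigma> k"
      by (auto simp: Z_star_def)
    show "z \<in> {z. Poly_Mapping.keys z \<subseteq> \<Sigma>}"
      unfolding y(1) by (rule rat_vector.subspace_sum[OF subspace_keys_subset])
        (use y(2) sub in \<open>blast intro: atMost_iff[THEN iffD1]\<close>)
  qed
  show "{z. Poly_Mapping.keys z \<subseteq> \<Sigma>} \<subseteq> Z_star n \<Sigma>"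
  proof
    fix z :: "'v cyc" assume "z \<in> {z. Poly_Mapping.keys z \<subseteq> \<Sigma>}"
    then have z: "z = (\<Sum>\<sigma>\<in>\<Sigma>. Poly_Mapping.lookup z \<sigma> *\<^sub>Q V_cycle \<sigma>)"
      by (intro sum_V_cycle finite_fan) simp
    define part where
      "part k = (\<Sum>\<sigma> | \<sigma> \<in> \<Sigma> \<and> n - rat_vector.dim \<sigma> = k. Poly_Mapping.lookup z \<sigma> *\<^sub>Q V_cycle \<sigma>)" for k
    have "part k \<in> Z_cycles n \<Sigma> k" for k
      unfolding part_def Z_cycles_def using dim_le_rank
      by (intro rat_vector.span_sum rat_vector.span_scale rat_vector.span_base) auto
    moreover have "(\<Sum>k\<le>n. part k) = (\<Sum>\<sigma>\<in>\<Sigma>. Poly_Mapping.lookup z \<sigma> *\<^sub>Q V_cycle \<sigma>)"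
      unfolding part_def using finite_fan by (intro sum.group) auto
    ultimately have "z = (\<Sum>k\<le>n. part k) \<and> (\<forall>k\<le>n. part k \<in> Z_cycles n \<Sigma> k)" using z by simp
    then show "z \<in> Z_star n \<Sigma>" unfolding Z_star_def by blast
  qed
qed

end

locale indexed_fan_with_complements = fan_with_complements N n \<Sigma> \<Psi>
  for N :: "'v::rat_vector set" and n \<Sigma> \<Psi> +
  fixes r :: nat and \<rho> :: "nat \<Rightarrow> 'v set"
  assumes indexing: "bij_betw \<rho> {1..r} (rays \<Sigma>)"
begin

lemma ray_index: "i \<in> {1..r} \<Longrightarrow> \<rho> i \<in> rays \<Sigma>"
  using indexing by (rule bij_betwE[rule_format])

sublocale commuting_operators r "\<lambda>i. ray_act (\<rho> i)"
  by unfold_locales (simp_all add: ray_index ray_act_add ray_act_scale ray_act_commute)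

abbreviation P :: "rat_mpoly ring" where "P \<equiv> poly_ring_Y r"

abbreviation Z :: "(rat_mpoly, 'v cyc) module" where "Z \<equiv> cycle_module N n \<Sigma> \<Psi> r \<rho>"

lemma Z_simps [simp]:
  "carrier Z = {z. Poly_Mapping.keys z \<subseteq> \<Sigma>}" "zero Z = 0" "add Z = (+)"
  "smult Z = poly_act r (\<lambda>i. ray_act (\<rho> i))"
  by (simp_all add: cycle_module_def Z_star_eq)

lemma module_cycles: "Module.module P Z"
proof (rule moduleI)
  note sub = subspace_keys_subset[of \<Sigma>]
  show "abelian_group Z"
  proof (rule abelian_groupI)
    fix z assume "z \<in> carrier Z"
    then show "\<exists>y\<in>carrier Z. y \<oplus>\<^bsub>Z\<^esub> z = \<zero>\<^bsub>Z\<^esub>"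
      using rat_vector.subspace_neg[OF sub] by (intro bexI[of _ "- z"]) auto
  qed (use rat_vector.subspace_add[OF sub] rat_vector.subspace_0[OF sub] in \<open>auto simp: ac_simps\<close>)
  show "p \<odot>\<^bsub>Z\<^esub> z \<in> carrier Z" if "z \<in> carrier Z" for p z
    using that poly_act_invariant[OF sub] keys_ray_act ray_index by simp
qed (simp_all add: cring_poly_ring_Y poly_act_add_left poly_act_add_right poly_act_mult poly_act_one)

lemma X_cycle_in_Z: "X_cycle \<in> carrier Z"
  using zero_in_fan by (simp add: X_cycle_def V_cycle_def)

text \<open>The multiples of [X] are closed under addition, rational scalars and ray divisors, so
  induction on the number of rays puts every basis cycle among them.\<close>

lemma cycles_cyclic: "(\<lambda>p. p \<odot>\<^bsub>Z\<^esub> X_cycle) ` carrier P = carrier Z"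
proof
  interpret Module.module P Z by (rule module_cycles)
  show "(\<lambda>p. p \<odot>\<^bsub>Z\<^esub> X_cycle) ` carrier P \<subseteq> carrier Z"
    using smult_closed X_cycle_in_Z by blast
  define K where "K = (\<lambda>p. p \<odot>\<^bsub>Z\<^esub> X_cycle) ` carrier P"
  have K_act: "p \<odot>\<^bsub>Z\<^esub> z \<in> K" if "p \<in> carrier P" "z \<in> K" for p z
    using that poly_ring_Y_closed(7)[of p r]
    by (auto simp: K_def poly_act_mult[symmetric] intro!: imageI)
  have K_scale: "c *\<^sub>Q z \<in> K" if "z \<in> K" for c z
    using K_act[OF poly_ring_Y_closed(3)[of c] that] by (simp add: poly_act_const)
  have K_ray: "ray_act (\<rho> i) z \<in> K" if "z \<in> K" "i \<in> {1..r}" for i z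
    using K_act[OF poly_ring_Y_closed(4) that(1)] that(2) by (simp add: poly_act_var)
  have K_add: "y + z \<in> K" if "y \<in> K" "z \<in> K" for y z
    using that poly_ring_Y_closed(6)[of _ r]
    by (auto simp: K_def poly_act_add_left[symmetric] intro!: imageI)
  have X: "X_cycle \<in> K"
    using poly_ring_Y_closed(2)[of r] by (auto simp: K_def poly_act_one intro!: image_eqI[of _ _ 1])
  have V: "V_cycle \<tau> \<in> K" if "\<tau> \<in> \<Sigma>" for \<tau>
    using that
  proof (induction "card (gens \<tau>)" arbitrary: \<tau> rule: less_induct)
    case less
    show ?case
    proof (cases "gens \<tau> = {}")
      case True
      then have "\<tau> = {0}" using gens_inj[OF less.prems zero_in_fan] gens_zero by simp
      then show ?thesis using X by (simp add: X_cycle_def)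
    next
      case False
      obtain \<rho>' \<sigma> c where \<sigma>: "\<rho>' \<in> rays \<Sigma>" "\<sigma> \<in> \<Sigma>" "card (gens \<sigma>) < card (gens \<tau>)"
        "V_cycle \<tau> = c *\<^sub>Q ray_act \<rho>' (V_cycle \<sigma>)"
        using V_cycle_from_facet[OF less.prems False] .
      obtain i where "i \<in> {1..r}" "\<rho>' = \<rho> i"
        using \<sigma>(1) unfolding bij_betw_imp_surj_on[OF indexing, symmetric] by blast
      then show ?thesis
        unfolding \<sigma>(4) using less.hyps[OF \<sigma>(3,2)] by (simp only: K_scale K_ray)
    qed
  qed
  show "carrier Z \<subseteq> (\<lambda>p. p \<odot>\<^bsub>Z\<^esub> X_cycle) ` carrier P"
    unfolding K_def[symmetric]
  proof
    fix z assume "z \<in> carrier Z"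
    then have z: "z = (\<Sum>\<sigma>\<in>\<Sigma>. Poly_Mapping.lookup z \<sigma> *\<^sub>Q V_cycle \<sigma>)"
      by (intro sum_V_cycle finite_fan) simp
    have "0 \<in> K" using K_scale[OF X, of 0] by simp
    then have "(\<Sum>\<sigma>\<in>A. Poly_Mapping.lookup z \<sigma> *\<^sub>Q V_cycle \<sigma>) \<in> K" if "A \<subseteq> \<Sigma>" for A
      using that by (induction A rule: infinite_finite_induct) (auto intro: K_add K_scale V)
    then show "z \<in> K" by (subst z) blast
  qed
qed

lemma submodule_gen_X_cycle: "submodule_gen P Z {X_cycle} = carrier Z"
proof
  interpret Module.module P Z by (rule module_cycles)
  show "submodule_gen P Z {X_cycle} \<subseteq> carrier Z"
    unfolding submodule_gen_def using carrier_is_submodule X_cycle_in_Z by blast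
  show "carrier Z \<subseteq> submodule_gen P Z {X_cycle}"
    unfolding submodule_gen_def cycles_cyclic[symmetric] using submoduleE(4) by blast
qed

end

text \<open>Since constants and variables generate the polynomial ring, the clauses on
  \<open>const_Y\<close> and \<open>var_Y\<close> tie the module structure to the intended action.
  The unit \<open>e\<close> is [X], because \<phi> preserves units and sends the coset of 1 to
  [X].\<close>

theorem mainTheorem5:
  fixes N :: "'v::rat_vector set" and n :: nat
    and \<Sigma> :: "'v set set"
    and r :: nat and \<rho> :: "nat \<Rightarrow> 'v set"
    and \<Psi> :: "'v set \<Rightarrow> ('v \<Rightarrow> rat) set"
  assumes "lattice_of_rank N n"
    and "fan N \<Sigma>"
    and "simplicial \<Sigma>"
    and "bij_betw \<rho> {1..r} (rays \<Sigma>)"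
    and "choice_of_complements \<Sigma> \<Psi>"
  shows "let P = poly_ring_Y r; Z = cycle_module N n \<Sigma> \<Psi> r \<rho> in
    Module.module P Z
    \<and> (\<forall>c. \<forall>z\<in>carrier Z. const_Y c \<odot>\<^bsub>Z\<^esub> z = c *\<^sub>Q z)
    \<and> (\<forall>i\<in>{1..r}. \<forall>z\<in>carrier Z.
         var_Y i \<odot>\<^bsub>Z\<^esub> z = divisor_act N \<Sigma> \<Psi> (ray_divisor N \<Sigma> (\<rho> i)) z)
    \<and> X_cycle \<in> carrier Z
    \<and> submodule_gen P Z {X_cycle} = carrier Z
    \<and> (\<exists>I \<phi> mul e.
         ideal I P
         \<and> \<phi> \<in> module_iso P (quot_module P I) Z
         \<and> (\<forall>p\<in>carrier P. \<phi> (I +>\<^bsub>P\<^esub> p) = p \<odot>\<^bsub>Z\<^esub> X_cycle)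
         \<and> cring (Z\<lparr>monoid.mult := mul, one := e\<rparr>)
         \<and> \<phi> \<in> ring_iso (P Quot I) (Z\<lparr>monoid.mult := mul, one := e\<rparr>))"
proof -
  interpret indexed_fan_with_complements N n \<Sigma> \<Psi> r \<rho>
    using assms by unfold_locales
  show ?thesis
    unfolding Let_def
    using module_cycles X_cycle_in_Z submodule_gen_X_cycle
      cyclic_module_quotient[OF module_cycles X_cycle_in_Z cycles_cyclic]
    by (intro conjI ballI allI) (simp_all add: poly_act_const poly_act_var del: Z_simps(1))
qed

end
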